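(* Let $N\ge2$ and let $\mathcal Q_{\mathrm{AKOS}}$ be the linear decorated quiver with frozen $X_0$ (type $-$, with a dashed loop of type $-$ and label $q_1$), unfrozen $X_1,\dots,X_{N-1}$ (each with one loop of label $q_1$), frozen $X_N$ (type $+$, with a dashed loop of type $+$ and label $q_1$), and arrows $X_j\to X_{j+1}$ (label $1$), $X_{j+1}\to X_j$ (label $q_3$) for $0\le j\le N-1$. Let $\mathcal P_+:X_0\to X_1\to\cdots\to X_N$ and $\mathcal P_-:X_N\to X_{N-1}\to\cdots\to X_0$. The assignment $$\bar W_1(z)=\Sigma[\mathcal P_+](z),\qquad :\Upsilon_1(z)\Upsilon_{N-1}(q_3^{N/2}z):=\Psi[\mathcal P_+](z),$$ $$\bar W_{N-1}(q_3^{N/2}z)=\Sigma[\mathcal P_-](z),\qquad :\Upsilon_1(q_3^Nz)\Upsilon_{N-1}(q_3^{N/2}z):=\Psi[\mathcal P_-](z)$$ defines a free field realization of the algebra $\mathcal W_{\mathfrak q,\mathfrak t}(\mathfrak{gl}(N))=\mathcal W_{\mathfrak q,\mathfrak t}(\mathfrak{sl}(N))\otimes\mathcal H_1$, and the subalgebra generated by these currents commutes with the bosonic screening charges attached to the unfrozen vertices $1,\dots,N-1$.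
   Context: **Parameters.** $q_1,q_2,q_3\in\mathbb C^\times$, $q_1q_2q_3=1$, otherwise generic; $q=q_2^{1/2}$; $(\mathfrak q,\mathfrak t)=(q_2,q_1^{-1})$. $f^{[n]}$: replace $q$, $q_c$, labels by $n$-th powers. **Seeds.** For a decorated quiver (vertices unfrozen or frozen of type $\pm$; plain arrows with labels; dashed loops of type $\pm$ at frozen vertices of type $\pm$) put $\epsilon_{ii}=0$, $\epsilon_{ij}=\#(i\to j)-\#(j\to i)$, $C_{ij}=(q-q^{-1})c_{ij}$ with $c_{ii}=(q-q^{-1})-\sum_{\ell:i\to i}(q\kappa_\ell-q^{-1}\kappa_\ell^{-1})$ ($i$ unfrozen), $c_{ii}=\mp q^{\mp1}\pm\sum_{\ell\ \mathrm{dashed}}q^{\mp1}\kappa_\ell^{\mp1}$ ($i$ frozen of type $\pm$), $c_{ij}=\sum_{a:i\to j}q^{-1}\kappa_a^{-1}-\sum_{a:j\to i}q\kappa_a$ ($i\ne j$). $\mathcal A_{\mathcal Q}$: (completed) algebra generated by $X_i^{\pm1},x_{i,n}$ ($n\ne0$), $X_iX_j=q^{2\epsilon_{ij}}X_jX_i$, $[X_i,x_{j,n}]=0$, $[x_{i,n},x_{j,m}]=\frac{\delta_{n+m,0}}nC^{[n]}_{ij}$ for $n>0$ (modes of the same sign commute). $X_i(z)=X_ie^{\sum_{n>0}z^nx_{i,-n}}e^{\sum_{n>0}z^{-n}x_{i,n}}$; $:\ :$ puts $x_{i,n}$, $n>0$, to the right. (Here all $\epsilon_{ij}=0$.) **Paths.**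 For a path $Z_0\to\cdots\to Z_n$ along arrows with labels $\kappa_1,\dots,\kappa_n$: $\Sigma[\mathcal P](z)=\sum_{j=0}^{n-1}:Z_0(z)Z_1(\kappa_1z)\cdots Z_j(\kappa_1\cdots\kappa_jz):$, $\Psi[\mathcal P](z)=:Z_0(z)Z_1(\kappa_1z)\cdots Z_n(\kappa_1\cdots\kappa_nz):$. **$\mathcal W_{\mathfrak q,\mathfrak t}(\mathfrak{sl}(N))$** is the algebra generated by the modes of $W_i$, $W_i(q_3^{(i-1)/2}z)=\sum_{1\le j_1<\cdots<j_i\le N}:\Lambda_{j_1}(z)\Lambda_{j_2}(q_3z)\cdots\Lambda_{j_i}(q_3^{i-1}z):$, where $\Lambda_i(z)=q_3^{\,i-(N+1)/2}e^{\sum_{k>0}z^k\lambda_{i,-k}}e^{\sum_{k>0}z^{-k}\lambda_{i,k}}e^{\tau\lambda_{i,0}}$, $\tau=\sqrt{-(\log q_1)(\log q_2)}$, $\lambda_{i,0}$ central, $[\lambda_{i,k},\lambda_{j,l}]=-\frac1k(1-q_1^k)(1-q_2^k)\delta_{k+l,0}\theta_{ij}$ for $k>0$ with $\theta_{ij}=\frac{1-q_3^k}{1-q_3^{-kN}}q_3^{-kN}$ ($i<j$), $\frac{1-q_3^{-k(N-1)}}{1-q_3^{-kN}}$ ($i=j$), $\frac{1-q_3^k}{1-q_3^{-kN}}$ ($i>j$), and $\sum_iq_3^{-ik}\lambda_{i,k}=0$ for all $k$ (so $W_N=1$). **$\mathcal W_{\mathfrak q,\mathfrak t}(\mathfrak{gl}(N))$.**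 Let $\beta_k$ ($k\neq0$) commute with all $\lambda_{i,l}$ and satisfy $[\beta_k,\beta_l]=-\frac1k(1-q_1^k)(1-q_2^k)(1-q_3^k)(1-q_3^{Nk})\delta_{k+l,0}$ for $k>0$; they generate the Heisenberg algebra $\mathcal H_1$. Put $$\Upsilon_1(z)=\exp\Bigl(\sum_{k>0}\tfrac{q_3^{-Nk/2}z^k}{q_3^{Nk/2}-q_3^{-Nk/2}}\beta_{-k}\Bigr)\exp\Bigl(\sum_{k>0}\tfrac{q_3^{-Nk/2}z^{-k}}{q_3^{Nk/2}-q_3^{-Nk/2}}\beta_k\Bigr),$$ $$\Upsilon_{N-1}(q_3^{N/2}z)=\exp\Bigl(-\sum_{k>0}\tfrac{q_3^{Nk/2}z^k}{q_3^{Nk/2}-q_3^{-Nk/2}}\beta_{-k}\Bigr)\exp\Bigl(-\sum_{k>0}\tfrac{q_3^{-Nk/2}z^{-k}}{q_3^{Nk/2}-q_3^{-Nk/2}}\beta_k\Bigr),$$ and $\bar W_i(z)=\Upsilon_i(z)W_i(z)$ for $i=1,N-1$ (these two definitions being understood as two separate currents also when $N=2$). "Defines a free field realization" means: the algebra of the $\lambda_{i,k},\beta_k$ contains vertex operators $X_j(z)$ having the operator products encoded by $\mathcal Q_{\mathrm{AKOS}}$ and for which the displayed equalities hold. **Bosonic screening charges** at an unfrozen vertex $k$ with one loop of label $\kappa$ ($=q_1$): $Q_k^\pm=\oint S_k^\pm(z)\frac{dz}z$; for $\sigma=\sigma_\pm$, $\sigma_+=q$, $\sigma_-=\kappa^{1/2}$,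 $\bar\sigma=q\kappa^{1/2}\sigma^{-1}$, $s_n=x_{k,n}/(\sigma^n-\sigma^{-n})$, $X_k=\sigma^{-2s_0}$, one adjoins $S$ with $[s_0,S]=2\frac{\log\bar\sigma}{\log\sigma}S$, $SX_j=\bar\sigma^{-2}X_jS$ for $j\ne k$ adjacent to $k$, $S$ commuting with the other zero modes, and $S_k^\pm(z)=Sz^{-s_0}e^{-\sum_{n>0}z^ns_{-n}}e^{-\sum_{n>0}z^{-n}s_n}$.
   Formalization: In the screening current the zero-mode factor S z^{-s_0} is read as the Weyl-ordered z^{-s_0/2} S z^{-s_0/2} = S z^{-s_0 - log(σ̄)/log(σ)}; with the plain product and measure dz/z the charges do not commute with Σ[P_±]. *)

theory Defs
  imports Complex_Main "HOL-Library.Groups_Big_Fun"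
begin

text \<open>
  Conventions. The parameters \<open>q\<^sub>1, q\<^sub>2, q\<^sub>3\<close> are given through chosen logarithms
  \<open>l1, l2, l3\<close>, so that fractional powers and \<open>log q\<^sub>a\<close> are unambiguous; \<open>qpow l x\<close> is \<open>(exp l)\<^sup>x\<close>.
  The (completed) free field algebra is treated through its modules: a complex vector space
  with scalar multiplication \<open>scale\<close> on which the generators act by operators \<open>'v \<Rightarrow> 'v\<close> such that
  all modes of vertex operators are well defined (locally finite sums).
  A current \<open>F(z) = \<Sum>\<^sub>m z\<^sup>m F\<^sub>m\<close> is the family \<open>m \<mapsto> F\<^sub>m\<close> of its modes.
\<close>

definition qpow :: "complex \<Rightarrow> complex \<Rightarrow> complex"
  where "qpow l x = exp (x * l)"

section \<open>Operators on a complex vector space\<close>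

abbreviation linear_op :: "(complex \<Rightarrow> 'v \<Rightarrow> 'v::ab_group_add) \<Rightarrow> ('v \<Rightarrow> 'v) \<Rightarrow> bool"
  where "linear_op scale A \<equiv> Vector_Spaces.linear scale scale A"

inductive_set gen_alg :: "(complex \<Rightarrow> 'v \<Rightarrow> 'v::ab_group_add) \<Rightarrow> ('v \<Rightarrow> 'v) set \<Rightarrow> ('v \<Rightarrow> 'v) set"
  for scale G where
  gen: "A \<in> G \<Longrightarrow> A \<in> gen_alg scale G"
| one: "id \<in> gen_alg scale G"
| smult: "A \<in> gen_alg scale G \<Longrightarrow> (\<lambda>v. scale c (A v)) \<in> gen_alg scale G"
| plus: "A \<in> gen_alg scale G \<Longrightarrow> B \<in> gen_alg scale G \<Longrightarrow> (\<lambda>v. A v + B v) \<in> gen_alg scale G"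
| mult: "A \<in> gen_alg scale G \<Longrightarrow> B \<in> gen_alg scale G \<Longrightarrow> A \<circ> B \<in> gen_alg scale G"

definition diagonalizable_op :: "(complex \<Rightarrow> 'v \<Rightarrow> 'v::ab_group_add) \<Rightarrow> ('v \<Rightarrow> 'v) \<Rightarrow> bool"
  where "diagonalizable_op scale D \<longleftrightarrow> linear_op scale D \<and>
    (\<forall>v. v \<in> module.span scale {u. \<exists>\<mu>. D u = scale \<mu> u})"

text \<open>The operator \<open>f(D)\<close> for diagonalizable \<open>D\<close>.\<close>

definition fun_op :: "(complex \<Rightarrow> 'v \<Rightarrow> 'v::ab_group_add) \<Rightarrow> (complex \<Rightarrow> complex) \<Rightarrow> ('v \<Rightarrow> 'v) \<Rightarrow> 'v \<Rightarrow> 'v"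
  where "fun_op scale f D =
    (THE F. linear_op scale F \<and> (\<forall>\<mu> u. D u = scale \<mu> u \<longrightarrow> F u = scale (f \<mu>) u))"

section \<open>Vertex operators and currents\<close>

text \<open>
  The pair \<open>(A, a)\<close> stands for the normally ordered exponential
  \<open>A exp(\<Sum>\<^bsub>n>0\<^esub> z\<^sup>n a\<^bsub>-n\<^esub>) exp(\<Sum>\<^bsub>n>0\<^esub> z\<^bsup>-n\<^esup> a\<^sub>n)\<close>; the entry \<open>a\<^sub>0\<close> is never used.
\<close>

type_synonym 'v vop = "('v \<Rightarrow> 'v) \<times> (int \<Rightarrow> 'v \<Rightarrow> 'v)"
type_synonym 'v current = "int \<Rightarrow> 'v \<Rightarrow> 'v"

text \<open>
  Coefficient of \<open>t\<^sup>m\<close> in \<open>exp(\<Sum>\<^bsub>n>0\<^esub> t\<^sup>n a\<^sub>n) = \<Sum>\<^sub>r (\<Sum>\<^bsub>n>0\<^esub> t\<^sup>n a\<^sub>n)\<^sup>r / r!\<close>: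
  a sum over the compositions \<open>ns\<close> of \<open>m\<close>.
\<close>

definition exp_coeff ::
    "(complex \<Rightarrow> 'v \<Rightarrow> 'v::ab_group_add) \<Rightarrow> (nat \<Rightarrow> 'v \<Rightarrow> 'v) \<Rightarrow> nat \<Rightarrow> 'v \<Rightarrow> 'v"
  where "exp_coeff scale a m v =
    (\<Sum>ns | 0 \<notin> set ns \<and> sum_list ns = m. scale (1 / fact (length ns)) (foldr a ns v))"

definition vop_current :: "(complex \<Rightarrow> 'v \<Rightarrow> 'v::ab_group_add) \<Rightarrow> 'v vop \<Rightarrow> 'v current"
  where "vop_current scale V m v = Sum_any (\<lambda>b::nat.
     if m + int b \<ge> 0
     then fst V (exp_coeff scale (\<lambda>n. snd V (- int n)) (nat (m + int b))
                  (exp_coeff scale (\<lambda>n. snd V (int n)) b v))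
     else 0)"

text \<open>Substitution \<open>z \<mapsto> c z\<close>.\<close>

definition vop_arg :: "(complex \<Rightarrow> 'v \<Rightarrow> 'v) \<Rightarrow> complex \<Rightarrow> 'v vop \<Rightarrow> 'v vop"
  where "vop_arg scale c V = (fst V, \<lambda>n v. scale (c powi (- n)) (snd V n v))"

definition cur_arg :: "(complex \<Rightarrow> 'v \<Rightarrow> 'v) \<Rightarrow> complex \<Rightarrow> 'v current \<Rightarrow> 'v current"
  where "cur_arg scale c F m v = scale (c powi m) (F m v)"

definition cur_mult :: "'v::ab_group_add current \<Rightarrow> 'v current \<Rightarrow> 'v current"
  where "cur_mult F G m v = Sum_any (\<lambda>b::int. F (m - b) (G b v))"

text \<open>
  Normally ordered product \<open>:V\<^sub>1(z) V\<^sub>2(z) \<dots>:\<close>. Modes of the same sign commute, so moving the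
  positive modes to the right adds up the exponents.
\<close>

definition nord :: "'v::ab_group_add vop list \<Rightarrow> 'v vop"
  where "nord Vs = (foldr (\<circ>) (map fst Vs) id, \<lambda>n v. \<Sum>V\<leftarrow>Vs. snd V n v)"

section \<open>Decorated quivers\<close>

datatype vertex_type = Unfrozen | FrozenPlus | FrozenMinus

text \<open>
  An arrow \<open>i \<rightarrow> j\<close> with label \<open>\<kappa>\<close> is \<open>(i, \<kappa>, j)\<close>; plain loops are arrows \<open>(i, \<kappa>, i)\<close>. A dashed loop
  \<open>(i, \<kappa>)\<close> has the type of the frozen vertex \<open>i\<close> it is attached to.
\<close>

record quiver =
  verts :: "nat set"
  vtype :: "nat \<Rightarrow> vertex_type"
  arrows :: "(nat \<times> complex \<times> nat) list"
  dashed :: "(nat \<times> complex) list"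

definition labels :: "quiver \<Rightarrow> nat \<Rightarrow> nat \<Rightarrow> complex list"
  where "labels Q i j = [\<kappa>. (a, \<kappa>, b) \<leftarrow> arrows Q, a = i \<and> b = j]"

definition dashed_labels :: "quiver \<Rightarrow> nat \<Rightarrow> complex list"
  where "dashed_labels Q i = [\<kappa>. (a, \<kappa>) \<leftarrow> dashed Q, a = i]"

definition quiver_eps :: "quiver \<Rightarrow> nat \<Rightarrow> nat \<Rightarrow> int"
  where "quiver_eps Q i j =
    (if i = j then 0 else int (length (labels Q i j)) - int (length (labels Q j i)))"

definition quiver_c :: "quiver \<Rightarrow> complex \<Rightarrow> nat \<Rightarrow> nat \<Rightarrow> complex"
  where "quiver_c Q q i j =
    (if i = j then
       (case vtype Q i of
          Unfrozen \<Rightarrow> (q - inverse q) - (\<Sum>\<kappa>\<leftarrow>labels Q i i. q * \<kappa> - inverse q * inverse \<kappa>)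
        | FrozenPlus \<Rightarrow> - inverse q + (\<Sum>\<kappa>\<leftarrow>dashed_labels Q i. inverse q * inverse \<kappa>)
        | FrozenMinus \<Rightarrow> q - (\<Sum>\<kappa>\<leftarrow>dashed_labels Q i. q * \<kappa>))
     else (\<Sum>\<kappa>\<leftarrow>labels Q i j. inverse q * inverse \<kappa>) - (\<Sum>\<kappa>\<leftarrow>labels Q j i. q * \<kappa>))"

definition quiver_C :: "quiver \<Rightarrow> complex \<Rightarrow> nat \<Rightarrow> nat \<Rightarrow> complex"
  where "quiver_C Q q i j = (q - inverse q) * quiver_c Q q i j"

definition quiver_pow :: "nat \<Rightarrow> quiver \<Rightarrow> quiver"
  where "quiver_pow n Q = Q\<lparr>arrows := map (\<lambda>(a, \<kappa>, b). (a, \<kappa> ^ n, b)) (arrows Q),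
                            dashed := map (\<lambda>(a, \<kappa>). (a, \<kappa> ^ n)) (dashed Q)\<rparr>"

text \<open>\<open>C\<^sub>i\<^sub>j\<^bsup>[n]\<^esup>\<close>\<close>

definition quiver_Cn :: "quiver \<Rightarrow> complex \<Rightarrow> nat \<Rightarrow> nat \<Rightarrow> nat \<Rightarrow> complex"
  where "quiver_Cn Q q n i j = quiver_C (quiver_pow n Q) (q ^ n) i j"

text \<open>
  The operators \<open>X\<^sub>i\<close>, \<open>x\<^bsub>i,n\<^esub>\<close> (\<open>n \<noteq> 0\<close>) satisfy the relations of the algebra of the quiver.
\<close>

definition quiver_relations ::
    "(complex \<Rightarrow> 'v \<Rightarrow> 'v::ab_group_add) \<Rightarrow> quiver \<Rightarrow> complex \<Rightarrow>
     (nat \<Rightarrow> 'v \<Rightarrow> 'v) \<Rightarrow> (nat \<Rightarrow> int \<Rightarrow> 'v \<Rightarrow> 'v) \<Rightarrow> bool"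
  where "quiver_relations scale Q q X x \<longleftrightarrow>
    (\<forall>i\<in>verts Q. linear_op scale (X i) \<and> bij (X i)) \<and>
    (\<forall>i\<in>verts Q. \<forall>n. n \<noteq> 0 \<longrightarrow> linear_op scale (x i n)) \<and>
    (\<forall>i\<in>verts Q. \<forall>j\<in>verts Q. \<forall>v.
        X i (X j v) = scale (q powi (2 * quiver_eps Q i j)) (X j (X i v))) \<and>
    (\<forall>i\<in>verts Q. \<forall>j\<in>verts Q. \<forall>n v. n \<noteq> 0 \<longrightarrow> X i (x j n v) = x j n (X i v)) \<and>
    (\<forall>i\<in>verts Q. \<forall>j\<in>verts Q. \<forall>n m v. n \<noteq> 0 \<longrightarrow> m \<noteq> 0 \<longrightarrow> n + m \<noteq> 0 \<longrightarrow>
        x i n (x j m v) = x j m (x i n v)) \<and>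
    (\<forall>i\<in>verts Q. \<forall>j\<in>verts Q. \<forall>n::nat. \<forall>v. n > 0 \<longrightarrow>
        x i (int n) (x j (- int n) v) - x j (- int n) (x i (int n) v)
          = scale (quiver_Cn Q q n i j / of_nat n) v)"

text \<open>
  A path is its initial vertex and the list of its arrows. \<open>path_vop \<dots> c Z\<^sub>0 as\<close> is
  \<open>:Z\<^sub>0(c z) Z\<^sub>1(\<kappa>\<^sub>1 c z) \<dots> Z\<^sub>n(\<kappa>\<^sub>1\<dots>\<kappa>\<^sub>n c z):\<close>.
\<close>

type_synonym path = "nat \<times> (nat \<times> complex \<times> nat) list"

fun is_path_from :: "quiver \<Rightarrow> nat \<Rightarrow> (nat \<times> complex \<times> nat) list \<Rightarrow> bool" where
  "is_path_from Q i [] \<longleftrightarrow> i \<in> verts Q"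
| "is_path_from Q i ((a, \<kappa>, b) # as) \<longleftrightarrow>
     a = i \<and> i \<in> verts Q \<and> (a, \<kappa>, b) \<in> set (arrows Q) \<and> is_path_from Q b as"

definition is_path :: "quiver \<Rightarrow> path \<Rightarrow> bool"
  where "is_path Q P \<longleftrightarrow> is_path_from Q (fst P) (snd P)"

fun path_vops :: "(complex \<Rightarrow> 'v \<Rightarrow> 'v) \<Rightarrow> (nat \<Rightarrow> 'v vop) \<Rightarrow> complex \<Rightarrow> nat \<Rightarrow>
    (nat \<times> complex \<times> nat) list \<Rightarrow> 'v vop list" where
  "path_vops scale Z c i [] = [vop_arg scale c (Z i)]"
| "path_vops scale Z c i ((a, \<kappa>, b) # as) =
     vop_arg scale c (Z i) # path_vops scale Z (c * \<kappa>) b as"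

definition path_Sigma ::
    "(complex \<Rightarrow> 'v \<Rightarrow> 'v::ab_group_add) \<Rightarrow> (nat \<Rightarrow> 'v vop) \<Rightarrow> path \<Rightarrow> 'v current"
  where "path_Sigma scale Z P m v = (\<Sum>j<length (snd P).
     vop_current scale (nord (path_vops scale Z 1 (fst P) (take j (snd P)))) m v)"

definition path_Psi ::
    "(complex \<Rightarrow> 'v \<Rightarrow> 'v::ab_group_add) \<Rightarrow> (nat \<Rightarrow> 'v vop) \<Rightarrow> path \<Rightarrow> 'v current"
  where "path_Psi scale Z P = vop_current scale (nord (path_vops scale Z 1 (fst P) (snd P)))"

definition akos_quiver :: "nat \<Rightarrow> complex \<Rightarrow> complex \<Rightarrow> quiver"
  where "akos_quiver N q1 q3 = \<lparr>
    verts = {0..N},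
    vtype = (\<lambda>i. if i = 0 then FrozenMinus else if i = N then FrozenPlus else Unfrozen),
    arrows = [(i, q1, i). i \<leftarrow> [1..<N]] @ [(j, 1, Suc j). j \<leftarrow> [0..<N]] @ [(Suc j, q3, j). j \<leftarrow> [0..<N]],
    dashed = [(0, q1), (N, q1)]\<rparr>"

definition path_plus :: "nat \<Rightarrow> path"
  where "path_plus N = (0, [(j, 1, Suc j). j \<leftarrow> [0..<N]])"

definition path_minus :: "nat \<Rightarrow> complex \<Rightarrow> path"
  where "path_minus N q3 = (N, [(Suc j, q3, j). j \<leftarrow> rev [0..<N]])"

lemma is_path_from_plus:
  "m \<le> N \<Longrightarrow> is_path_from (akos_quiver N q1 q3) m [(j, 1, Suc j). j \<leftarrow> [m..<N]]"
proof (induction "N - m" arbitrary: m)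
  case 0
  then show ?case by (simp add: akos_quiver_def)
next
  case (Suc d)
  then have "m < N" "d = N - Suc m" by auto
  then show ?case using Suc(1)[of "Suc m"]
    by (auto simp: upt_conv_Cons akos_quiver_def)
qed

lemma is_path_from_minus:
  "m \<le> N \<Longrightarrow> is_path_from (akos_quiver N q1 q3) m [(Suc j, q3, j). j \<leftarrow> rev [0..<m]]"
  by (induction m) (auto simp: akos_quiver_def)

lemma is_path_akos:
  "is_path (akos_quiver N q1 q3) (path_plus N)"
  "is_path (akos_quiver N q1 q3) (path_minus N q3)"
  using is_path_from_plus[of 0 N] is_path_from_minus[of N N]
  by (simp_all add: is_path_def path_plus_def path_minus_def)

section \<open>The free fields \<open>\<lambda>\<^bsub>i,k\<^esub>\<close>, \<open>\<beta>\<^sub>k\<close> and the currents of the W-algebra\<close>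

definition theta :: "complex \<Rightarrow> nat \<Rightarrow> int \<Rightarrow> nat \<Rightarrow> nat \<Rightarrow> complex"
  where "theta q3 N k i j =
    (if i < j then (1 - q3 powi k) / (1 - q3 powi (- k * int N)) * q3 powi (- k * int N)
     else if i = j then (1 - q3 powi (- k * (int N - 1))) / (1 - q3 powi (- k * int N))
     else (1 - q3 powi k) / (1 - q3 powi (- k * int N)))"

text \<open>
  Modules over the algebra of the \<open>\<lambda>\<^bsub>i,k\<^esub>\<close> (\<open>1 \<le> i \<le> N\<close>) and \<open>\<beta>\<^sub>k\<close> (\<open>k \<noteq> 0\<close>) on which the modes of
  vertex operators act: positive modes act locally nilpotently, almost all of them kill a given
  vector, and \<open>\<lambda>\<^bsub>i,0\<^esub>\<close> is diagonalizable, so that \<open>exp(\<tau> \<lambda>\<^bsub>i,0\<^esub>)\<close> makes sense.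
\<close>

locale free_field_module = vector_space scale
  for scale :: "complex \<Rightarrow> 'v \<Rightarrow> 'v::ab_group_add" +
  fixes N :: nat and q1 q2 q3 :: complex
    and lam :: "nat \<Rightarrow> int \<Rightarrow> 'v \<Rightarrow> 'v" and beta :: "int \<Rightarrow> 'v \<Rightarrow> 'v"
  assumes lam_linear: "\<And>i k. i \<in> {1..N} \<Longrightarrow> linear_op scale (lam i k)"
    and beta_linear: "\<And>k. k \<noteq> 0 \<Longrightarrow> linear_op scale (beta k)"
    and lam_zero_central: "\<And>i j k v. i \<in> {1..N} \<Longrightarrow> j \<in> {1..N} \<Longrightarrow>
          lam i 0 (lam j k v) = lam j k (lam i 0 v)"
    and lam_comm: "\<And>i j k l v. i \<in> {1..N} \<Longrightarrow> j \<in> {1..N} \<Longrightarrow> k \<noteq> 0 \<Longrightarrow> l \<noteq> 0 \<Longrightarrow> k + l \<noteq> 0 \<Longrightarrow>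
          lam i k (lam j l v) = lam j l (lam i k v)"
    and lam_bracket: "\<And>i j k v. i \<in> {1..N} \<Longrightarrow> j \<in> {1..N} \<Longrightarrow> k > 0 \<Longrightarrow>
          lam i k (lam j (- k) v) - lam j (- k) (lam i k v)
            = scale (- 1 / of_int k * (1 - q1 powi k) * (1 - q2 powi k) * theta q3 N k i j) v"
    and lam_relation: "\<And>k v. (\<Sum>i = 1..N. scale (q3 powi (- int i * k)) (lam i k v)) = 0"
    and beta_lam: "\<And>i k l v. i \<in> {1..N} \<Longrightarrow> k \<noteq> 0 \<Longrightarrow> beta k (lam i l v) = lam i l (beta k v)"
    and beta_comm: "\<And>k l v. k \<noteq> 0 \<Longrightarrow> l \<noteq> 0 \<Longrightarrow> k + l \<noteq> 0 \<Longrightarrow> beta k (beta l v) = beta l (beta k v)"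
    and beta_bracket: "\<And>k v. k > 0 \<Longrightarrow>
          beta k (beta (- k) v) - beta (- k) (beta k v)
            = scale (- 1 / of_int k * (1 - q1 powi k) * (1 - q2 powi k) * (1 - q3 powi k)
                      * (1 - q3 powi (int N * k))) v"
    and lam_zero_diag: "\<And>i. i \<in> {1..N} \<Longrightarrow> diagonalizable_op scale (lam i 0)"
    and smooth: "\<And>v. \<exists>K. \<forall>k>K. (\<forall>i\<in>{1..N}. lam i k v = 0) \<and> beta k v = 0"
    and lam_nilpotent: "\<And>i k v. i \<in> {1..N} \<Longrightarrow> k > 0 \<Longrightarrow> \<exists>r. (lam i k ^^ r) v = 0"
    and beta_nilpotent: "\<And>k v. k > 0 \<Longrightarrow> \<exists>r. (beta k ^^ r) v = 0"

definition Lambda :: "(complex \<Rightarrow> 'v \<Rightarrow> 'v::ab_group_add) \<Rightarrow> nat \<Rightarrow> complex \<Rightarrow> complex \<Rightarrow>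
    (nat \<Rightarrow> int \<Rightarrow> 'v \<Rightarrow> 'v) \<Rightarrow> nat \<Rightarrow> 'v vop"
  where "Lambda scale N l3 tau lam i =
    (\<lambda>v. scale (qpow l3 (of_nat i - (of_nat N + 1) / 2)) (fun_op scale (\<lambda>\<mu>. exp (tau * \<mu>)) (lam i 0) v),
     lam i)"

text \<open>
  \<open>W_shifted\<close> is \<open>W\<^sub>i(q\<^sub>3\<^bsup>(i-1)/2\<^esup> z)\<close>; the set \<open>J\<close> is \<open>{j\<^sub>1 < \<dots> < j\<^sub>i}\<close>.
\<close>

definition W_shifted :: "(complex \<Rightarrow> 'v \<Rightarrow> 'v::ab_group_add) \<Rightarrow> nat \<Rightarrow> complex \<Rightarrow> complex \<Rightarrow>
    (nat \<Rightarrow> int \<Rightarrow> 'v \<Rightarrow> 'v) \<Rightarrow> nat \<Rightarrow> 'v current"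
  where "W_shifted scale N l3 tau lam i m v = (\<Sum>J | J \<subseteq> {1..N} \<and> card J = i.
     vop_current scale
       (nord [vop_arg scale (qpow l3 (of_nat s)) (Lambda scale N l3 tau lam (sorted_list_of_set J ! s)).
              s \<leftarrow> [0..<i]]) m v)"

definition W_current :: "(complex \<Rightarrow> 'v \<Rightarrow> 'v::ab_group_add) \<Rightarrow> nat \<Rightarrow> complex \<Rightarrow> complex \<Rightarrow>
    (nat \<Rightarrow> int \<Rightarrow> 'v \<Rightarrow> 'v) \<Rightarrow> nat \<Rightarrow> 'v current"
  where "W_current scale N l3 tau lam i =
    cur_arg scale (qpow l3 (- (of_nat i - 1) / 2)) (W_shifted scale N l3 tau lam i)"

text \<open>
  \<open>Upsilon_first\<close> is \<open>\<Upsilon>\<^sub>1(z)\<close> and \<open>Upsilon_last\<close> is \<open>\<Upsilon>\<^bsub>N-1\<^esub>(z)\<close>; they are different also for \<open>N = 2\<close>.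
  With \<open>d\<^sub>k = q\<^sub>3\<^bsup>Nk/2\<^esup> - q\<^sub>3\<^bsup>-Nk/2\<^esup>\<close>, the exponents of \<open>\<Upsilon>\<^sub>1(z)\<close> are \<open>q\<^sub>3\<^bsup>-Nk/2\<^esup> z\<^bsup>\<plusminus>k\<^esup> \<beta>\<^bsub>\<mp>k\<^esub> / d\<^sub>k\<close>, and those of
  \<open>\<Upsilon>\<^bsub>N-1\<^esub>(w)\<close> are \<open>- w\<^bsup>\<plusminus>k\<^esup> \<beta>\<^bsub>\<mp>k\<^esub> / d\<^sub>k\<close>. Hence at \<open>w = q\<^sub>3\<^bsup>N/2\<^esup> z\<close> the coefficient of \<open>\<beta>\<^bsub>-k\<^esub>\<close> is
  \<open>- q\<^sub>3\<^bsup>Nk/2\<^esup> z\<^sup>k / d\<^sub>k\<close> and that of \<open>\<beta>\<^sub>k\<close> is \<open>- q\<^sub>3\<^bsup>-Nk/2\<^esup> z\<^bsup>-k\<^esup> / d\<^sub>k\<close>. (With \<open>q\<^sub>3\<^bsup>+Nk/2\<^esup>\<close> in the latter, both modes of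
  \<open>:\<Upsilon>\<^sub>1(z) \<Upsilon>\<^bsub>N-1\<^esub>(q\<^sub>3\<^bsup>N/2\<^esup> z):\<close> would be \<open>-\<beta>\<^bsub>\<plusminus>k\<^esub>\<close>, with non-zero commutator, whereas \<open>\<Sum>\<^sub>i\<^sub>j C\<^sub>i\<^sub>j = 0\<close>.)
\<close>

definition Upsilon_first :: "(complex \<Rightarrow> 'v \<Rightarrow> 'v) \<Rightarrow> nat \<Rightarrow> complex \<Rightarrow>
    (int \<Rightarrow> 'v \<Rightarrow> 'v) \<Rightarrow> 'v vop"
  where "Upsilon_first scale N l3 beta =
    (id, \<lambda>n v. let h = of_nat N * of_int \<bar>n\<bar> / 2 in
           scale (qpow l3 (- h) / (qpow l3 h - qpow l3 (- h))) (beta n v))"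

definition Upsilon_last :: "(complex \<Rightarrow> 'v \<Rightarrow> 'v) \<Rightarrow> nat \<Rightarrow> complex \<Rightarrow>
    (int \<Rightarrow> 'v \<Rightarrow> 'v) \<Rightarrow> 'v vop"
  where "Upsilon_last scale N l3 beta =
    (id, \<lambda>n v. let h = of_nat N * of_int \<bar>n\<bar> / 2 in
           scale (- 1 / (qpow l3 h - qpow l3 (- h))) (beta n v))"

definition Wbar_first :: "(complex \<Rightarrow> 'v \<Rightarrow> 'v::ab_group_add) \<Rightarrow> nat \<Rightarrow> complex \<Rightarrow> complex \<Rightarrow>
    (nat \<Rightarrow> int \<Rightarrow> 'v \<Rightarrow> 'v) \<Rightarrow> (int \<Rightarrow> 'v \<Rightarrow> 'v) \<Rightarrow> 'v current"
  where "Wbar_first scale N l3 tau lam beta =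
    cur_mult (vop_current scale (Upsilon_first scale N l3 beta)) (W_current scale N l3 tau lam 1)"

definition Wbar_last :: "(complex \<Rightarrow> 'v \<Rightarrow> 'v::ab_group_add) \<Rightarrow> nat \<Rightarrow> complex \<Rightarrow> complex \<Rightarrow>
    (nat \<Rightarrow> int \<Rightarrow> 'v \<Rightarrow> 'v) \<Rightarrow> (int \<Rightarrow> 'v \<Rightarrow> 'v) \<Rightarrow> 'v current"
  where "Wbar_last scale N l3 tau lam beta =
    cur_mult (vop_current scale (Upsilon_last scale N l3 beta)) (W_current scale N l3 tau lam (N - 1))"

text \<open>
  The \<open>X\<^sub>i\<^bsup>\<plusminus>1\<^esup>\<close> and \<open>x\<^bsub>i,n\<^esub>\<close> belong to the free field algebra: the former are generated by the
  \<open>exp(\<plusminus>\<tau> \<lambda>\<^bsub>j,0\<^esub>)\<close>, the latter are linear combinations of the modes \<open>\<lambda>\<^bsub>j,n\<^esub>\<close> and \<open>\<beta>\<^sub>n\<close>.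
\<close>

definition free_field_vops :: "(complex \<Rightarrow> 'v \<Rightarrow> 'v::ab_group_add) \<Rightarrow> nat \<Rightarrow> complex \<Rightarrow>
    (nat \<Rightarrow> int \<Rightarrow> 'v \<Rightarrow> 'v) \<Rightarrow> (int \<Rightarrow> 'v \<Rightarrow> 'v) \<Rightarrow> nat set \<Rightarrow>
    (nat \<Rightarrow> 'v \<Rightarrow> 'v) \<Rightarrow> (nat \<Rightarrow> int \<Rightarrow> 'v \<Rightarrow> 'v) \<Rightarrow> bool"
  where "free_field_vops scale N tau lam beta I X x \<longleftrightarrow>
    (let Z = gen_alg scale
               {fun_op scale (\<lambda>\<mu>. exp (c * tau * \<mu>)) (lam j 0) | c j. c \<in> {1, -1} \<and> j \<in> {1..N}}
     in \<forall>i\<in>I. X i \<in> Z \<and> inv (X i) \<in> Z) \<and>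
    (\<forall>i\<in>I. \<forall>n. n \<noteq> 0 \<longrightarrow>
       (\<exists>a b. x i n = (\<lambda>v. (\<Sum>j = 1..N. scale (a j) (lam j n v)) + scale b (beta n v))))"

section \<open>Bosonic screening charges\<close>

text \<open>
  \<open>screening_logs lq l\<kappa> pos\<close> is \<open>(log \<sigma>, log \<sigma>')\<close> with \<open>\<sigma>'\<close> the quantity \<open>q \<kappa>\<^bsup>1/2\<^esup> / \<sigma>\<close>, where
  \<open>q = exp lq\<close>, \<open>\<kappa> = exp l\<kappa>\<close>, and \<open>\<sigma> = \<sigma>\<^sub>+ = q\<close> or \<open>\<sigma> = \<sigma>\<^sub>- = \<kappa>\<^bsup>1/2\<^esup>\<close> as \<open>pos\<close> holds or not.
\<close>

definition screening_logs :: "complex \<Rightarrow> complex \<Rightarrow> bool \<Rightarrow> complex \<times> complex"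
  where "screening_logs lq l\<kappa> pos = (if pos then (lq, l\<kappa> / 2) else (l\<kappa> / 2, lq))"

text \<open>
  The operators \<open>s\<^sub>0\<close> and \<open>S\<close> on the module satisfy the relations of the extended algebra at the
  vertex \<open>k\<close>. A zero mode commutes with all non-zero modes.
\<close>

definition screening_relations ::
    "(complex \<Rightarrow> 'v \<Rightarrow> 'v::ab_group_add) \<Rightarrow> quiver \<Rightarrow> (nat \<Rightarrow> 'v \<Rightarrow> 'v) \<Rightarrow>
     (nat \<Rightarrow> int \<Rightarrow> 'v \<Rightarrow> 'v) \<Rightarrow> nat \<Rightarrow> complex \<times> complex \<Rightarrow> ('v \<Rightarrow> 'v) \<Rightarrow> ('v \<Rightarrow> 'v) \<Rightarrow> bool"
  where "screening_relations scale Q X x k L s0 S \<longleftrightarrow>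
    (let ls = fst L; ls' = snd L; I = verts Q;
         adj = (\<lambda>j. j \<noteq> k \<and> (labels Q j k \<noteq> [] \<or> labels Q k j \<noteq> []))
     in diagonalizable_op scale s0 \<and> linear_op scale S \<and>
        X k = fun_op scale (\<lambda>\<mu>. exp (- 2 * \<mu> * ls)) s0 \<and>
        (\<forall>j\<in>I. \<forall>v. s0 (X j v) = X j (s0 v)) \<and>
        (\<forall>j\<in>I. \<forall>n v. n \<noteq> 0 \<longrightarrow> s0 (x j n v) = x j n (s0 v)) \<and>
        (\<forall>v. s0 (S v) - S (s0 v) = scale (2 * ls' / ls) (S v)) \<and>
        (\<forall>j\<in>I. \<forall>v. adj j \<longrightarrow> S (X j v) = scale (exp (- 2 * ls')) (X j (S v))) \<and>
        (\<forall>j\<in>I. \<forall>v. j \<noteq> k \<and> \<not> adj j \<longrightarrow> S (X j v) = X j (S v)) \<and>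
        (\<forall>j\<in>I. \<forall>n v. n \<noteq> 0 \<longrightarrow> S (x j n v) = x j n (S v)))"

text \<open>
  Coefficient of \<open>z\<^sup>\<alpha>\<close> (\<open>\<alpha>\<close> complex) in the operator \<open>z\<^bsup>a D\<^esup>\<close> for diagonalizable \<open>D\<close>.
\<close>

definition zpow_coeff ::
    "(complex \<Rightarrow> 'v \<Rightarrow> 'v::ab_group_add) \<Rightarrow> complex \<Rightarrow> ('v \<Rightarrow> 'v) \<Rightarrow> complex \<Rightarrow> 'v \<Rightarrow> 'v"
  where "zpow_coeff scale a D \<alpha> = fun_op scale (\<lambda>\<mu>. if a * \<mu> = \<alpha> then 1 else 0) D"

text \<open>
  The zero mode factor \<open>S z\<^bsup>-s\<^sub>0\<^esup>\<close> of a screening current is a normally ordered (Weyl ordered)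
  product of zero modes, that is \<open>z\<^bsup>-s\<^sub>0/2\<^esup> S z\<^bsup>-s\<^sub>0/2\<^esup>\<close>, which by the commutator of \<open>s\<^sub>0\<close> and \<open>S\<close> is
  the plain product \<open>S \<cdot> z\<^bsup>-s\<^sub>0\<^esup>\<close> times the scalar \<open>z\<close> to the power \<open>- log \<sigma>' / log \<sigma>\<close>. (The plain
  product integrated against \<open>dz/z\<close> does not commute with \<open>X\<^bsub>k-1\<^esub>(z) + :X\<^bsub>k-1\<^esub>(z) X\<^sub>k(z):\<close>: the two
  delta function terms, at \<open>z = \<sigma>\<^bsup>\<plusminus>1\<^esup> w\<close>, then have coefficients with ratio \<open>- \<sigma>'\<^bsup>-2\<^esup>\<close> instead of \<open>-1\<close>.)
\<close>

definition screening_zero ::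
    "(complex \<Rightarrow> 'v \<Rightarrow> 'v::ab_group_add) \<Rightarrow> ('v \<Rightarrow> 'v) \<Rightarrow> ('v \<Rightarrow> 'v) \<Rightarrow> complex \<Rightarrow> 'v \<Rightarrow> 'v"
  where "screening_zero scale s0 S \<gamma> v = Sum_any (\<lambda>\<alpha>::complex.
    zpow_coeff scale (- 1 / 2) s0 \<alpha> (S (zpow_coeff scale (- 1 / 2) s0 (\<gamma> - \<alpha>) v)))"

text \<open>
  Coefficient of \<open>z\<^sup>\<gamma>\<close> (\<open>\<gamma>\<close> complex) in \<open>S\<^sub>k(z)\<close>, with \<open>s\<^sub>n = x\<^bsub>k,n\<^esub> / (\<sigma>\<^sup>n - \<sigma>\<^bsup>-n\<^esup>)\<close>, and the screening
  charge, where \<open>\<oint> dz/z\<close> extracts the coefficient of \<open>z\<^sup>0\<close>.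
\<close>

definition screening_current ::
    "(complex \<Rightarrow> 'v \<Rightarrow> 'v::ab_group_add) \<Rightarrow> (nat \<Rightarrow> int \<Rightarrow> 'v \<Rightarrow> 'v) \<Rightarrow> nat \<Rightarrow>
     complex \<times> complex \<Rightarrow> ('v \<Rightarrow> 'v) \<Rightarrow> ('v \<Rightarrow> 'v) \<Rightarrow> complex \<Rightarrow> 'v \<Rightarrow> 'v"
  where "screening_current scale x k L s0 S \<gamma> v =
    (let s = (\<lambda>n u. scale (1 / (qpow (fst L) (of_int n) - qpow (fst L) (- of_int n))) (x k n u))
     in Sum_any (\<lambda>m::int. screening_zero scale s0 S (\<gamma> - of_int m)
                            (vop_current scale (id, \<lambda>n u. - s n u) m v)))"

definition screening_charge ::
    "(complex \<Rightarrow> 'v \<Rightarrow> 'v::ab_group_add) \<Rightarrow> (nat \<Rightarrow> int \<Rightarrow> 'v \<Rightarrow> 'v) \<Rightarrow> nat \<Rightarrow>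
     complex \<times> complex \<Rightarrow> ('v \<Rightarrow> 'v) \<Rightarrow> ('v \<Rightarrow> 'v) \<Rightarrow> 'v \<Rightarrow> 'v"
  where "screening_charge scale x k L s0 S = screening_current scale x k L s0 S 0"

end

theory Submission
  imports Defs
begin

text \<open>
  The realization is \<open>X\<^sub>0 = \<Upsilon>\<^sub>1 \<Lambda>\<^sub>N\<close>, \<open>X\<^sub>j = \<Lambda>\<^bsub>N-j\<^esub> / \<Lambda>\<^bsub>N-j+1\<^esub>\<close> for \<open>0 < j < N\<close> and
  \<open>X\<^sub>N(z) = \<Upsilon>\<^bsub>N-1\<^esub>(q\<^sub>3\<^bsup>N/2\<^esup> z) / \<Lambda>\<^sub>1(z)\<close>. Along \<open>P\<^sub>+\<close> the partial products telescope to
  \<open>\<Upsilon>\<^sub>1 \<Lambda>\<^bsub>N-j\<^esub>\<close>; along \<open>P\<^sub>-\<close> they become, because of \<open>W\<^sub>N = 1\<close>, the products of all \<open>\<Lambda>\<^sub>i\<close> but one. (The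
  order of the \<open>\<Lambda>\<^sub>i\<close> is forced by the second property.)

  A screening current \<open>S\<^sub>k\<close> has no contraction with a partial product unless the path has just reached
  a neighbour of \<open>k\<close> or \<open>k\<close> itself. With these two consecutive partial products \<open>T(w)\<close> and
  \<open>T(w) X\<^sub>k(c w)\<close> the contraction has one simple pole each, so the two commutators with \<open>S\<^sub>k(z)\<close> are
  delta functions, at \<open>z = \<sigma> c w\<close> and \<open>z = \<sigma>\<^bsup>-1\<^esup> c w\<close>. As \<open>X\<^sub>k(c w)\<close> is the ratio of \<open>S\<^sub>k\<close> at these two
  points, their integrals over \<open>z\<close> cancel.
\<close>

section \<open>Exponentials of commuting operators\<close>

text \<open>The poles are simple for the following reason. The brackets of \<open>xs k\<close> with
  the partial products are multiples of (1 - q1^n)(1 - q2^n)/n, and \<sigma>^2 is q1 or q2, so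
  division by \<sigma>^n - \<sigma>^-n cancels one factor. What is left has the form (1 - b^n) y^n /
  n, whose exponential is the rational function (1 - b y t) / (1 - y t). Both charges of a vertex
  are thus one computation with q1 and q2 exchanged. Series with non-commuting coefficients are
  handled through the logarithmic derivative, the recursion m F_m = sum of n a_n F_(m-n), which
  determines an exponential from F_0; additivity and the reordering of positive and negative modes
  are proved by checking it. In the W-currents no contraction occurs: the Heisenberg modes commute
  with the \<lambda>, and normal ordering adds exponents, so the four equalities reduce to
  identities between modes and between zero modes. The powers of z in a screening current are
  complex; splitting vectors into eigenvectors of s0 pairs each of them with at most one integer
  mode.\<close>

locale complex_vector_space = vector_space scale
  for scale :: "complex \<Rightarrow> 'v \<Rightarrow> 'v::ab_group_add" (infixr "*s" 75)
begin

abbreviation lin :: "('v \<Rightarrow> 'v) \<Rightarrow> bool"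
  where "lin \<equiv> linear_op scale"

abbreviation vcur :: "'v vop \<Rightarrow> 'v current"
  where "vcur \<equiv> vop_current scale"

section \<open>Linear operators and locally finite sums of them\<close>

lemma linI: "(\<And>u v. f (u + v) = f u + f v) \<Longrightarrow> (\<And>c v. f (c *s v) = c *s f v) \<Longrightarrow> lin f"
  by (simp add: Vector_Spaces.linear_iff vector_space_axioms)

lemma lin_add: "lin f \<Longrightarrow> f (u + v) = f u + f v"
  and lin_scale: "lin f \<Longrightarrow> f (c *s v) = c *s f v"
  by (simp_all add: Vector_Spaces.linear_iff)

lemma lin_zero: "lin f \<Longrightarrow> f 0 = 0"
  using lin_scale[of f 0 0] by simp

lemma lin_sum: "lin f \<Longrightarrow> f (\<Sum>i\<in>A. g i) = (\<Sum>i\<in>A. f (g i))"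
  by (induction A rule: infinite_finite_induct) (auto simp: lin_zero lin_add)

lemma lin_Sum_any:
  assumes "lin f" "finite {i. g i \<noteq> 0}"
  shows "f (Sum_any g) = Sum_any (\<lambda>i. f (g i))"
proof -
  have "{i. f (g i) \<noteq> 0} \<subseteq> {i. g i \<noteq> 0}" using lin_zero[OF assms(1)] by auto
  from Sum_any.expand_superset[OF assms(2) this] show ?thesis
    by (simp add: Sum_any.expand_set lin_sum[OF assms(1)])
qed

lemma lin_id: "lin id" "lin (\<lambda>v. v)"
  by (auto intro: linI)

lemma lin_zero_op: "lin (\<lambda>v. 0)"
  by (auto intro: linI)

lemma lin_comp: "lin f \<Longrightarrow> lin g \<Longrightarrow> lin (\<lambda>v. f (g v))"
  by (auto intro!: linI simp: lin_add lin_scale)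

lemma lin_plus: "lin f \<Longrightarrow> lin g \<Longrightarrow> lin (\<lambda>v. f v + g v)"
  by (auto intro!: linI simp: lin_add lin_scale algebra_simps scale_right_distrib)

lemma lin_cmult: "lin f \<Longrightarrow> lin (\<lambda>v. c *s f v)"
  by (auto intro!: linI simp: lin_add lin_scale scale_right_distrib scale_left_commute)

lemma lin_sum_op: "(\<And>i. i \<in> A \<Longrightarrow> lin (f i)) \<Longrightarrow> lin (\<lambda>v. \<Sum>i\<in>A. f i v)"
  by (induction A rule: infinite_finite_induct) (auto intro!: lin_zero_op lin_plus)

lemma lin_Sum_any_op:
  assumes "\<And>i. lin (f i)" "\<And>v. finite {i. f i v \<noteq> 0}"
  shows "lin (\<lambda>v. Sum_any (\<lambda>i. f i v))"
proof (rule linI)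
  fix u v
  show "Sum_any (\<lambda>i. f i (u + v)) = Sum_any (\<lambda>i. f i u) + Sum_any (\<lambda>i. f i v)"
    using Sum_any.distrib[OF assms(2)[of u] assms(2)[of v]] by (simp add: lin_add[OF assms(1)])
next
  fix c v
  show "Sum_any (\<lambda>i. f i (c *s v)) = c *s Sum_any (\<lambda>i. f i v)"
    using lin_Sum_any[OF lin_cmult[OF lin_id(2), of c] assms(2)[of v]]
    by (simp add: lin_scale[OF assms(1)])
qed

definition lin_modes :: "(nat \<Rightarrow> 'v \<Rightarrow> 'v) \<Rightarrow> bool"
  where "lin_modes a \<longleftrightarrow> (\<forall>n>0. lin (a n))"

definition comm_modes :: "(nat \<Rightarrow> 'v \<Rightarrow> 'v) \<Rightarrow> (nat \<Rightarrow> 'v \<Rightarrow> 'v) \<Rightarrow> bool"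
  where "comm_modes a b \<longleftrightarrow> (\<forall>n>0. \<forall>k>0. \<forall>v. a n (b k v) = b k (a n v))"

lemma lin_modesD: "lin_modes a \<Longrightarrow> n > 0 \<Longrightarrow> lin (a n)"
  by (simp add: lin_modes_def)

lemma comm_modesD: "comm_modes a b \<Longrightarrow> n > 0 \<Longrightarrow> k > 0 \<Longrightarrow> a n (b k v) = b k (a n v)"
  by (simp add: comm_modes_def)

section \<open>Compositions, powers and exponentials of a generating series\<close>

definition comps :: "nat \<Rightarrow> nat \<Rightarrow> nat list set"
  where "comps m r = {ns. 0 \<notin> set ns \<and> sum_list ns = m \<and> length ns = r}"

lemma length_le_sum_list: "0 \<notin> set ns \<Longrightarrow> length ns \<le> sum_list (ns :: nat list)"
  by (induction ns) auto

lemma finite_comps: "finite (comps m r)"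
proof (rule finite_subset)
  show "comps m r \<subseteq> {ns. set ns \<subseteq> {..m} \<and> length ns = r}"
    by (auto simp: comps_def intro: member_le_sum_list)
qed (simp add: finite_lists_length_eq)

lemma comps_0: "comps m 0 = (if m = 0 then {[]} else {})"
  by (auto simp: comps_def)

lemma comps_Suc: "comps m (Suc r) = (\<Union>n\<in>{1..m}. (#) n ` comps (m - n) r)"
  by (auto simp: comps_def length_Suc_conv image_iff intro!: bexI)

text \<open>This is the coefficient of t^m in the r-th power of the series with coefficients
  \<open>a n\<close>.\<close>

definition comp_sum :: "(nat \<Rightarrow> 'v \<Rightarrow> 'v) \<Rightarrow> nat \<Rightarrow> nat \<Rightarrow> 'v \<Rightarrow> 'v"
  where "comp_sum a r m v = (\<Sum>ns\<in>comps m r. foldr a ns v)"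

lemma comp_sum_0: "comp_sum a 0 m v = (if m = 0 then v else 0)"
  by (simp add: comp_sum_def comps_0)

lemma comp_sum_Suc:
  assumes "lin_modes a"
  shows "comp_sum a (Suc r) m v = (\<Sum>n=1..m. a n (comp_sum a r (m - n) v))"
proof -
  have "comp_sum a (Suc r) m v = (\<Sum>n=1..m. \<Sum>ns\<in>(#) n ` comps (m - n) r. foldr a ns v)"
    unfolding comp_sum_def comps_Suc
    by (subst sum.UNION_disjoint) (auto simp: finite_comps)
  also have "\<dots> = (\<Sum>n=1..m. a n (comp_sum a r (m - n) v))"
    unfolding comp_sum_def using lin_modesD[OF assms]
    by (intro sum.cong refl) (simp add: sum.reindex lin_sum)
  finally show ?thesis .
qed

abbreviation ecoeff :: "(nat \<Rightarrow> 'v \<Rightarrow> 'v) \<Rightarrow> nat \<Rightarrow> 'v \<Rightarrow> 'v"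
  where "ecoeff \<equiv> exp_coeff scale"

text \<open>A composition of m has at most m parts, so every cut-off \<open>M \<ge> m\<close> gives
  the same value. The free \<open>M\<close> allows one common range of r for all degrees m - n in a
  sum.\<close>

lemma exp_coeff_comp_sum:
  assumes "m \<le> M"
  shows "ecoeff a m v = (\<Sum>r\<le>M. (1 / fact r) *s comp_sum a r m v)"
proof -
  have eq: "{ns. 0 \<notin> set ns \<and> sum_list ns = m} = (\<Union>r\<in>{..M}. comps m r)"
    using assms by (auto simp: comps_def intro: order_trans[OF length_le_sum_list])
  have "ecoeff a m v = (\<Sum>r\<le>M. \<Sum>ns\<in>comps m r. (1 / fact (length ns)) *s foldr a ns v)"
    unfolding exp_coeff_def eq
    by (subst sum.UNION_disjoint) (auto simp: finite_comps, auto simp: comps_def)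
  also have "\<dots> = (\<Sum>r\<le>M. (1 / fact r) *s comp_sum a r m v)"
    unfolding comp_sum_def scale_sum_right
    by (intro sum.cong refl) (auto simp: comps_def)
  finally show ?thesis .
qed

lemma triangle_sum_swap:
  fixes f :: "nat \<Rightarrow> nat \<Rightarrow> 'b::comm_monoid_add"
  shows "(\<Sum>n\<le>m. \<Sum>k\<le>m - n. f n k) = (\<Sum>k\<le>m. \<Sum>n\<le>m - k. f n k)"
proof -
  have "(\<Sum>n\<le>m. \<Sum>k\<le>m - n. f n k) = (\<Sum>n\<in>{..m}. \<Sum>k | k \<in> {..m} \<and> n + k \<le> m. f n k)"
    by (intro sum.cong refl) auto
  also have "\<dots> = (\<Sum>k\<in>{..m}. \<Sum>n | n \<in> {..m} \<and> n + k \<le> m. f n k)"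
    by (rule sum.swap_restrict) auto
  also have "\<dots> = (\<Sum>k\<le>m. \<Sum>n\<le>m - k. f n k)"
    by (intro sum.cong refl) auto
  finally show ?thesis .
qed

lemma triangle_sum_diagonal:
  fixes f :: "nat \<Rightarrow> nat \<Rightarrow> 'b::comm_monoid_add"
  shows "(\<Sum>n\<le>m. \<Sum>k\<le>m - n. f n k) = (\<Sum>s\<le>m. \<Sum>n\<le>s. f n (s - n))"
proof -
  have "(\<Sum>n\<le>m. \<Sum>k\<le>m - n. f n k) = (\<Sum>(n, k)\<in>{(n, k). n + k \<le> m}. f n k)"
    by (subst sum.Sigma) (auto intro!: sum.cong)
  then show ?thesis by (simp add: sum.triangle_reindex_eq)
qed

text \<open>The weight n vanishes at 0, where \<open>a 0\<close> need not be linear. Triangular sums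
  are rearranged over \<open>{..m}\<close>, linearity is applied over \<open>{1..m}\<close>.\<close>

lemma sum_atMost_mult_index:
  "(\<Sum>n\<le>m. of_nat n *s f n) = (\<Sum>n=1..m. of_nat n *s f n)"
  by (rule sum.mono_neutral_right) (auto simp: not_le)

lemma exp_coeff_cong:
  assumes "\<And>n. n > 0 \<Longrightarrow> a n = b n"
  shows "ecoeff a m v = ecoeff b m v"
proof -
  have "foldr a ns v = foldr b ns v" if "0 \<notin> set ns" for ns
    using that by (induction ns) (auto simp: assms)
  then show ?thesis unfolding exp_coeff_def by (intro sum.cong refl) auto
qed

lemma exp_coeff_0: "ecoeff a 0 v = v"
  by (simp add: exp_coeff_comp_sum[of 0 0] comp_sum_0)

lemma lin_foldr: "lin_modes a \<Longrightarrow> 0 \<notin> set ns \<Longrightarrow> lin (foldr a ns)"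
proof (induction ns)
  case (Cons n ns)
  then have "lin (a n)" "lin (foldr a ns)" by (auto intro: lin_modesD)
  then show ?case using lin_comp[of "a n" "foldr a ns"] by (simp add: comp_def)
qed (simp add: lin_id)

lemma lin_exp_coeff:
  assumes "lin_modes a"
  shows "lin (ecoeff a m)"
  unfolding exp_coeff_def by (intro lin_sum_op lin_cmult lin_foldr[OF assms]) auto

lemma exp_coeff_commute:
  assumes "lin f" "\<And>n v. n > 0 \<Longrightarrow> f (a n v) = a n (f v)"
  shows "f (ecoeff a m v) = ecoeff a m (f v)"
proof -
  have "f (foldr a ns v) = foldr a ns (f v)" if "0 \<notin> set ns" for ns
    using that by (induction ns) (auto simp: assms(2))
  then show ?thesis unfolding exp_coeff_def lin_sum[OF assms(1)] lin_scale[OF assms(1)]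
    by (intro sum.cong refl) auto
qed

lemma exp_coeff_arg:
  assumes "lin_modes a"
  shows "ecoeff (\<lambda>n v. c ^ n *s a n v) m v = c ^ m *s ecoeff a m v"
proof -
  have *: "foldr (\<lambda>n v. c ^ n *s a n v) ns v = c ^ sum_list ns *s foldr a ns v" if "0 \<notin> set ns" for ns
    using that by (induction ns) (auto simp: lin_modesD[OF assms] lin_scale power_add)
  show ?thesis unfolding exp_coeff_def scale_sum_right
    by (intro sum.cong refl) (auto simp: * mult.commute)
qed

text \<open>Differentiating a power of the generating series costs commutativity of the \<open>a\<^sub>n\<close>.\<close>

lemma comp_sum_derivative:
  assumes lin: "lin_modes a"
    and comm: "comm_modes a a"
  shows "of_nat m *s comp_sum a (Suc r) m v
    = of_nat (Suc r) *s (\<Sum>n\<le>m. of_nat n *s a n (comp_sum a r (m - n) v))"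
proof (induction r arbitrary: m)
  case 0
  have "(\<Sum>n\<le>m. of_nat n *s a n (comp_sum a 0 (m - n) v)) = (\<Sum>n=1..m. of_nat n *s a n (comp_sum a 0 (m - n) v))"
    by (rule sum_atMost_mult_index)
  also have "\<dots> = (\<Sum>n=1..m. of_nat m *s a n (comp_sum a 0 (m - n) v))"
    by (intro sum.cong refl) (auto simp: comp_sum_0 lin_zero[OF lin_modesD[OF lin]])
  finally show ?case by (simp add: comp_sum_Suc[OF lin] scale_sum_right)
next
  case (Suc r)
  \<comment> \<open>With the zero operator at index 0, linearity and commutation hold for all
    indices, so that full triangles can be summed.\<close>
  let ?b = "\<lambda>n v. if n = 0 then 0 else a n v"
  have lb: "lin (?b n)" for n by (cases "n = 0") (auto intro: lin_zero_op lin_modesD[OF lin])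
  have cb: "?b n (?b k v) = ?b k (?b n v)" for n k v
    using comm_modesD[OF comm, of n k] lin_zero[OF lin_modesD[OF lin], of n] lin_zero[OF lin_modesD[OF lin], of k] by auto
  have P: "comp_sum a (Suc r) m v = (\<Sum>n\<le>m. ?b n (comp_sum a r (m - n) v))" for r m
    unfolding comp_sum_Suc[OF lin] by (rule sum.mono_neutral_cong_left) (auto simp: not_le)
  have ab: "(\<Sum>n\<le>m. of_nat n *s a n (F n)) = (\<Sum>n\<le>m. of_nat n *s ?b n (F n))" for F m
    by (intro sum.cong refl) auto
  \<comment> \<open>Leibniz rule: m = n + (m - n) differentiates either the first factor or the
    remaining power, and the latter is the induction hypothesis.\<close>
  have "of_nat m *s comp_sum a (Suc (Suc r)) m v
     = (\<Sum>n\<le>m. of_nat n *s ?b n (comp_sum a (Suc r) (m - n) v))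
     + (\<Sum>n\<le>m. ?b n (of_nat (m - n) *s comp_sum a (Suc r) (m - n) v))"
    unfolding P[of "Suc r"] scale_sum_right sum.distrib[symmetric]
    by (intro sum.cong refl)
       (auto simp: lin_scale[OF lb] scale_left_distrib[symmetric] simp del: of_nat_diff simp flip: of_nat_add)
  also have "(\<Sum>n\<le>m. ?b n (of_nat (m - n) *s comp_sum a (Suc r) (m - n) v))
     = of_nat (Suc r) *s (\<Sum>n\<le>m. \<Sum>k\<le>m - n. of_nat k *s ?b k (?b n (comp_sum a r (m - n - k) v)))"
    unfolding Suc ab lin_scale[OF lb] lin_sum[OF lb] scale_sum_right cb[of _ _ "comp_sum _ _ _ _"] ..
  also have "(\<Sum>n\<le>m. \<Sum>k\<le>m - n. of_nat k *s ?b k (?b n (comp_sum a r (m - n - k) v)))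
     = (\<Sum>k\<le>m. of_nat k *s ?b k (comp_sum a (Suc r) (m - k) v))"
    unfolding P lin_sum[OF lb] scale_sum_right
    by (subst triangle_sum_swap) (simp only: diff_commute)
  finally show ?case unfolding ab by (simp only: of_nat_Suc[of "Suc r"] scale_left_distrib scale_one)
qed

text \<open>The rule t d/dt exp(a(t)) = t a'(t) exp(a(t)), read off at t^m.\<close>

lemma exp_coeff_derivative:
  assumes "lin_modes a"
    and "comm_modes a a"
  shows "of_nat m *s ecoeff a m v = (\<Sum>n\<le>m. of_nat n *s a n (ecoeff a (m - n) v))"
proof -
  \<comment> \<open>One power more than necessary is included: differentiation lowers r by one, and
    the range r \<le> m must be left.\<close>
  have "of_nat m *s ecoeff a m v
      = (\<Sum>r\<le>Suc m. (1 / fact r) *s of_nat m *s comp_sum a r m v)"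
    by (subst exp_coeff_comp_sum[of m "Suc m"]) (simp_all only: scale_sum_right scale_left_commute le_SucI order_refl)
  also have "\<dots> = (\<Sum>r\<le>m. (1 / fact (Suc r)) *s of_nat m *s comp_sum a (Suc r) m v)"
    by (subst sum.atMost_Suc_shift) (simp add: comp_sum_0)
  also have "\<dots> = (\<Sum>r\<le>m. (1 / fact r) *s (\<Sum>n\<le>m. of_nat n *s a n (comp_sum a r (m - n) v)))"
    unfolding comp_sum_derivative[OF assms] by (intro sum.cong refl) (simp del: of_nat_Suc)
  also have "\<dots> = (\<Sum>n\<le>m. of_nat n *s (\<Sum>r\<le>m. (1 / fact r) *s a n (comp_sum a r (m - n) v)))"
    unfolding scale_sum_right by (subst sum.swap) (simp add: scale_left_commute)
  also have "\<dots> = (\<Sum>n=1..m. of_nat n *s (\<Sum>r\<le>m. (1 / fact r) *s a n (comp_sum a r (m - n) v)))"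
    by (rule sum_atMost_mult_index)
  also have "\<dots> = (\<Sum>n=1..m. of_nat n *s a n (ecoeff a (m - n) v))"
    by (intro sum.cong refl)
       (simp add: exp_coeff_comp_sum[of "m - _" m] lin_sum[OF lin_modesD[OF assms(1)]] lin_scale[OF lin_modesD[OF assms(1)]])
  finally show ?thesis by (simp add: sum_atMost_mult_index)
qed

text \<open>The term n = 0 drops out and m is invertible, so the recursion computes F m from smaller
  degrees. To recognize an expression as an exponential it is enough to check the recursion for
  it.\<close>

lemma exp_coeff_unique:
  assumes "lin_modes a"
    and "comm_modes a a"
    and F0: "F 0 = v"
    and F: "\<And>m. of_nat m *s F m = (\<Sum>n\<le>m. of_nat n *s a n (F (m - n)))"
  shows "F m = ecoeff a m v"
proof (induction m rule: less_induct)
  case (less m)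
  show ?case
  proof (cases "m = 0")
    case True
    then show ?thesis by (simp add: F0 exp_coeff_0)
  next
    case False
    have "of_nat m *s F m = (\<Sum>n=1..m. of_nat n *s a n (F (m - n)))"
      by (simp add: F sum_atMost_mult_index)
    also have "\<dots> = (\<Sum>n=1..m. of_nat n *s a n (ecoeff a (m - n) v))"
      by (intro sum.cong refl) (use less in auto)
    also have "\<dots> = of_nat m *s ecoeff a m v"
      by (simp add: exp_coeff_derivative[OF assms(1,2)] sum_atMost_mult_index)
    finally show ?thesis using False by (simp add: scale_left_imp_eq)
  qed
qed

text \<open>The derivative of exp(a) exp(b) falls on either factor. In the second case
  \<open>b n\<close> has to pass exp(a), which is where the two families must commute.\<close>

lemma exp_coeff_add:
  assumes la: "lin_modes a" and lb: "lin_modes b"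
    and aa: "comm_modes a a"
    and bb: "comm_modes b b"
    and ab: "comm_modes a b"
  shows "ecoeff (\<lambda>n v. a n v + b n v) m v
    = (\<Sum>i\<le>m. ecoeff a (m - i) (ecoeff b i v))"
proof -
  let ?A = "ecoeff a" and ?B = "ecoeff b"
  have bA: "b n (?A i v) = ?A i (b n v)" if "n > 0" for n i v
    by (rule exp_coeff_commute[OF lin_modesD[OF lb that]]) (simp add: comm_modesD[OF ab] that)
  define G where "G m = (\<Sum>i\<le>m. ?A (m - i) (?B i v))" for m
  have "G m = ecoeff (\<lambda>n v. a n v + b n v) m v"
  proof (rule exp_coeff_unique)
    show "G 0 = v" by (simp add: G_def exp_coeff_0)
    fix m
    have "of_nat m *s G m = (\<Sum>i\<le>m. of_nat (m - i) *s ?A (m - i) (?B i v))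
        + (\<Sum>i\<le>m. ?A (m - i) (of_nat i *s ?B i v))"
      unfolding G_def scale_sum_right sum.distrib[symmetric]
      by (intro sum.cong refl)
         (auto simp: lin_scale[OF lin_exp_coeff[OF la]] scale_left_distrib[symmetric] simp flip: of_nat_add)
    also have "(\<Sum>i\<le>m. of_nat (m - i) *s ?A (m - i) (?B i v))
        = (\<Sum>i\<le>m. \<Sum>n\<le>m - i. of_nat n *s a n (?A (m - n - i) (?B i v)))"
      unfolding exp_coeff_derivative[OF la aa] by (simp add: add.commute del: of_nat_diff)
    also have "\<dots> = (\<Sum>n\<le>m. \<Sum>i\<le>m - n. of_nat n *s a n (?A (m - n - i) (?B i v)))"
      by (rule triangle_sum_swap)
    also have "\<dots> = (\<Sum>n=1..m. of_nat n *s a n (G (m - n)))"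
      unfolding scale_sum_right[symmetric] sum_atMost_mult_index G_def
      by (intro sum.cong refl) (simp add: lin_sum[OF lin_modesD[OF la]])
    also have "(\<Sum>i\<le>m. ?A (m - i) (of_nat i *s ?B i v))
        = (\<Sum>i\<le>m. \<Sum>n\<le>i. ?A (m - i) (of_nat n *s b n (?B (i - n) v)))"
      unfolding exp_coeff_derivative[OF lb bb] lin_sum[OF lin_exp_coeff[OF la]] ..
    also have "\<dots> = (\<Sum>n\<le>m. \<Sum>i\<le>m - n. ?A (m - n - i) (of_nat n *s b n (?B i v)))"
      by (subst triangle_sum_diagonal) (simp add: diff_diff_left)
    also have "\<dots> = (\<Sum>n=1..m. of_nat n *s b n (G (m - n)))"
      unfolding lin_scale[OF lin_exp_coeff[OF la]] scale_sum_right[symmetric] sum_atMost_mult_index G_def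
      by (intro sum.cong refl) (simp add: lin_sum[OF lin_modesD[OF lb]] bA)
    finally show "of_nat m *s G m = (\<Sum>n\<le>m. of_nat n *s (a n (G (m - n)) + b n (G (m - n))))"
      by (simp add: sum_atMost_mult_index sum.distrib scale_right_distrib)
    show "lin_modes (\<lambda>n v. a n v + b n v)"
      using lin_modesD[OF la] lin_modesD[OF lb] by (auto simp: lin_modes_def intro: lin_plus)
    show "comm_modes (\<lambda>n v. a n v + b n v) (\<lambda>n v. a n v + b n v)"
      using lin_modesD[OF la] lin_modesD[OF lb]
      by (auto simp: comm_modes_def lin_add comm_modesD[OF aa] comm_modesD[OF bb] comm_modesD[OF ab])
  qed
  then show ?thesis by (simp add: G_def)
qed

text \<open>Integer degrees with value 0 below zero make shifts such as j - r in contractions free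
  of side conditions.\<close>

definition exp_coeff_int :: "(nat \<Rightarrow> 'v \<Rightarrow> 'v) \<Rightarrow> int \<Rightarrow> 'v \<Rightarrow> 'v"
  where "exp_coeff_int a m v = (if m < 0 then 0 else ecoeff a (nat m) v)"

lemma exp_coeff_int_of_nat [simp]: "exp_coeff_int a (int m) v = ecoeff a m v"
  by (simp add: exp_coeff_int_def)

lemma exp_coeff_int_neg [simp]: "m < 0 \<Longrightarrow> exp_coeff_int a m v = 0"
  by (simp add: exp_coeff_int_def)

lemma lin_exp_coeff_int: "lin_modes a \<Longrightarrow> lin (exp_coeff_int a m)"
  unfolding exp_coeff_int_def by (cases "m < 0") (auto intro: lin_zero_op lin_exp_coeff)

lemma exp_coeff_int_commute:
  assumes "lin f" "\<And>n v. n > 0 \<Longrightarrow> f (a n v) = a n (f v)"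
  shows "f (exp_coeff_int a m v) = exp_coeff_int a m (f v)"
  using exp_coeff_commute[of f a] assms by (simp add: exp_coeff_int_def lin_zero)

lemma exp_coeff_int_derivative:
  assumes "lin_modes a" "comm_modes a a" "q \<le> int K"
  shows "of_int q *s exp_coeff_int a q v = (\<Sum>p=1..K. of_nat p *s a p (exp_coeff_int a (q - int p) v))"
proof (cases "q < 0")
  case True
  then show ?thesis by (auto simp: lin_zero[OF lin_modesD[OF assms(1)]] intro!: sum.neutral[symmetric])
next
  case False
  then obtain m where m: "q = int m" using nonneg_eq_int by (metis not_less)
  have "(\<Sum>p=1..K. of_nat p *s a p (exp_coeff_int a (q - int p) v))
    = (\<Sum>p=1..m. of_nat p *s a p (ecoeff a (m - p) v))"
    using assms(3)
    by (intro sum.mono_neutral_cong_right)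
       (auto simp: m lin_zero[OF lin_modesD[OF assms(1)]] simp flip: of_nat_diff)
  then show ?thesis
    by (simp add: m exp_coeff_derivative[OF assms(1,2)] sum_atMost_mult_index)
qed

text \<open>\<open>b\<^sub>k\<close> stands for a mode of index \<open>- k\<close>, hence the bracket is supported on \<open>n = k\<close>.\<close>

definition bracket_modes ::
    "(nat \<Rightarrow> 'v \<Rightarrow> 'v) \<Rightarrow> (nat \<Rightarrow> 'v \<Rightarrow> 'v) \<Rightarrow> (nat \<Rightarrow> complex) \<Rightarrow> bool"
  where "bracket_modes a b \<gamma> \<longleftrightarrow> (\<forall>n>0. \<forall>k>0. \<forall>v.
    a n (b k v) = b k (a n v) + (if n = k then \<gamma> n *s v else 0))"

lemma bracket_modesD:
  "bracket_modes a b \<gamma> \<Longrightarrow> n > 0 \<Longrightarrow> k > 0 \<Longrightarrow>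
    a n (b k v) = b k (a n v) + (if n = k then \<gamma> n *s v else 0)"
  by (simp add: bracket_modes_def)

text \<open>A mode with scalar brackets acts as a derivation, so its commutator with exp(b(t)) is
  \<gamma>_n t^n exp(b(t)). The induction on the degree runs through the logarithmic
  derivative.\<close>

lemma mode_exp_coeff_bracket:
  assumes la: "lin_modes a" and lb: "lin_modes b" and bb: "comm_modes b b"
    and ab: "bracket_modes a b \<gamma>" and n: "n > 0"
  shows "a n (exp_coeff_int b j v) = exp_coeff_int b j (a n v) + \<gamma> n *s exp_coeff_int b (j - int n) v"
proof -
  have *: "a n (ecoeff b k v) = ecoeff b k (a n v) + \<gamma> n *s exp_coeff_int b (int k - int n) v" for k
  proof (induction k rule: less_induct)
    case (less k)
    show ?case
    proof (cases "k = 0")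
      case True
      then show ?thesis using n by (simp add: exp_coeff_0)
    next
      case False
      have D: "of_nat k *s ecoeff b k u = (\<Sum>p=1..k. of_nat p *s b p (ecoeff b (k - p) u))" for u
        by (simp add: exp_coeff_derivative[OF lb bb] sum_atMost_mult_index)
      have "of_nat k *s a n (ecoeff b k v)
          = (\<Sum>p=1..k. of_nat p *s a n (b p (ecoeff b (k - p) v)))"
        using lin_modesD[OF la n] by (simp only: D lin_sum flip: lin_scale)
      also have "\<dots> = (\<Sum>p=1..k. of_nat p *s b p (ecoeff b (k - p) (a n v))
            + \<gamma> n *s (of_nat p *s b p (exp_coeff_int b (int k - int n - int p) v))
            + (if p = n then \<gamma> n *s (of_nat n *s exp_coeff_int b (int k - int n) v) else 0))"
      proof (intro sum.cong refl)
        fix p assume p: "p \<in> {1..k}"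
        then have "a n (ecoeff b (k - p) v) = ecoeff b (k - p) (a n v)
            + \<gamma> n *s exp_coeff_int b (int k - int n - int p) v"
          using less[of "k - p"] by (simp add: of_nat_diff algebra_simps)
        then show "of_nat p *s a n (b p (ecoeff b (k - p) v)) =
            of_nat p *s b p (ecoeff b (k - p) (a n v))
            + \<gamma> n *s (of_nat p *s b p (exp_coeff_int b (int k - int n - int p) v))
            + (if p = n then \<gamma> n *s (of_nat n *s exp_coeff_int b (int k - int n) v) else 0)"
          using p n lin_modesD[OF lb, of p]
          by (auto simp: bracket_modesD[OF ab] lin_add lin_scale scale_right_distrib mult.commute
              simp flip: of_nat_diff)
      qed
      also have "\<dots> = of_nat k *s ecoeff b k (a n v)
          + \<gamma> n *s ((\<Sum>p=1..k. of_nat p *s b p (exp_coeff_int b (int k - int n - int p) v))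
            + of_nat n *s exp_coeff_int b (int k - int n) v)"
        unfolding D sum.distrib
        using n by (auto simp: scale_sum_right scale_right_distrib sum.delta not_le)
      \<comment> \<open>The recursion in degree k - n gives the weight k - n; the summand p = n, the
        only one with a bracket, gives the missing n. Then k can be cancelled.\<close>
      also have "(\<Sum>p=1..k. of_nat p *s b p (exp_coeff_int b (int k - int n - int p) v))
          = of_int (int k - int n) *s exp_coeff_int b (int k - int n) v"
        by (rule exp_coeff_int_derivative[OF lb bb, symmetric]) simp
      also have "of_int (int k - int n) *s exp_coeff_int b (int k - int n) v
          + of_nat n *s exp_coeff_int b (int k - int n) v = of_nat k *s exp_coeff_int b (int k - int n) v"
        by (simp flip: scale_left_distrib)
      finally have "of_nat k *s a n (ecoeff b k v)
          = of_nat k *s (ecoeff b k (a n v) + \<gamma> n *s exp_coeff_int b (int k - int n) v)"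
        by (simp add: scale_right_distrib scale_left_commute)
      then show ?thesis using False by (simp add: scale_left_imp_eq)
    qed
  qed
  show ?thesis
  proof (cases "j < 0")
    case True
    then show ?thesis by (simp add: lin_zero[OF lin_modesD[OF la n]])
  next
    case False
    then show ?thesis using *[of "nat j"] by (simp add: exp_coeff_int_def)
  qed
qed

text \<open>\<open>\<Sum> g\<^sub>r t\<^sup>r = exp (\<Sum>\<^bsub>n>0\<^esub> \<gamma>\<^sub>n t\<^sup>n)\<close>, expressed by the logarithmic derivative.\<close>

definition exp_series :: "(nat \<Rightarrow> complex) \<Rightarrow> (nat \<Rightarrow> complex) \<Rightarrow> bool"
  where "exp_series \<gamma> g \<longleftrightarrow> g 0 = 1 \<and> (\<forall>r. of_nat r * g r = (\<Sum>n\<le>r. of_nat n * \<gamma> n * g (r - n)))"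

text \<open>Baker-Campbell-Hausdorff with central commutators: exp(a) exp(b) = g exp(b) exp(a). The
  right-hand side satisfies the recursion of exp(a) in the degree i, because g satisfies its
  own.\<close>

lemma exp_coeff_contraction:
  assumes la: "lin_modes a" and lb: "lin_modes b" and aa: "comm_modes a a" and bb: "comm_modes b b"
    and ab: "bracket_modes a b \<gamma>" and g: "exp_series \<gamma> g"
  shows "ecoeff a i (exp_coeff_int b j v)
    = (\<Sum>r\<le>i. g r *s exp_coeff_int b (j - int r) (ecoeff a (i - r) v))"
proof -
  let ?A = "ecoeff a" and ?B = "exp_coeff_int b"
  define H where "H i = (\<Sum>r\<le>i. g r *s ?B (j - int r) (?A (i - r) v))" for i
  have "H i = ?A i (?B j v)"
  proof (rule exp_coeff_unique[OF la aa])
    show "H 0 = ?B j v" using g by (simp add: H_def exp_series_def exp_coeff_0)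
    fix i
    have "(\<Sum>n\<le>i. of_nat n *s a n (H (i - n)))
      = (\<Sum>n=1..i. \<Sum>r\<le>i - n. of_nat n *s g r *s a n (?B (j - int r) (?A (i - n - r) v)))"
      unfolding sum_atMost_mult_index H_def scale_sum_right
      by (intro sum.cong refl) (simp add: lin_sum[OF lin_modesD[OF la]] lin_scale[OF lin_modesD[OF la]] scale_sum_right)
    also have "\<dots> = (\<Sum>n\<le>i. \<Sum>r\<le>i - n. of_nat n *s g r *s a n (?B (j - int r) (?A (i - n - r) v)))"
      unfolding scale_sum_right[symmetric] sum_atMost_mult_index ..
    also have "\<dots> = (\<Sum>n\<le>i. \<Sum>r\<le>i - n. g r *s ?B (j - int r) (of_nat n *s a n (?A (i - n - r) v))
        + (of_nat n * \<gamma> n * g r) *s ?B (j - int (n + r)) (?A (i - (n + r)) v))"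
    proof (intro sum.cong refl)
      fix n r assume "n \<in> {..i}" "r \<in> {..i - n}"
      show "of_nat n *s g r *s a n (?B (j - int r) (?A (i - n - r) v))
        = g r *s ?B (j - int r) (of_nat n *s a n (?A (i - n - r) v))
        + (of_nat n * \<gamma> n * g r) *s ?B (j - int (n + r)) (?A (i - (n + r)) v)"
        by (cases "n = 0")
           (auto simp: lin_zero[OF lin_exp_coeff_int[OF lb]] lin_scale[OF lin_exp_coeff_int[OF lb]]
              mode_exp_coeff_bracket[OF la lb bb ab] scale_right_distrib mult_ac diff_diff_eq add.commute)
    qed
    also have "\<dots> = (\<Sum>n\<le>i. \<Sum>r\<le>i - n. g r *s ?B (j - int r) (of_nat n *s a n (?A (i - n - r) v)))
        + (\<Sum>n\<le>i. \<Sum>r\<le>i - n. (of_nat n * \<gamma> n * g r) *s ?B (j - int (n + r)) (?A (i - (n + r)) v))"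
      by (simp only: sum.distrib)
    also have "(\<Sum>n\<le>i. \<Sum>r\<le>i - n. g r *s ?B (j - int r) (of_nat n *s a n (?A (i - n - r) v)))
        = (\<Sum>r\<le>i. \<Sum>n\<le>i - r. g r *s ?B (j - int r) (of_nat n *s a n (?A (i - n - r) v)))"
      by (rule triangle_sum_swap)
    also have "\<dots> = (\<Sum>r\<le>i. g r *s ?B (j - int r) (of_nat (i - r) *s ?A (i - r) v))"
      unfolding exp_coeff_derivative[OF la aa] lin_sum[OF lin_exp_coeff_int[OF lb]] scale_sum_right
      by (simp only: diff_commute)
    also have "\<dots> = (\<Sum>r\<le>i. of_nat (i - r) *s (g r *s ?B (j - int r) (?A (i - r) v)))"
      by (simp add: lin_scale[OF lin_exp_coeff_int[OF lb]] mult.commute)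
    \<comment> \<open>The bracket terms depend on n and r only through s = n + r and the
      coefficient; along each diagonal the coefficients add up to the derivative s g_s.\<close>
    also have "(\<Sum>n\<le>i. \<Sum>r\<le>i - n. (of_nat n * \<gamma> n * g r) *s ?B (j - int (n + r)) (?A (i - (n + r)) v))
        = (\<Sum>s\<le>i. of_nat s *s (g s *s ?B (j - int s) (?A (i - s) v)))"
      using g by (subst triangle_sum_diagonal) (simp add: exp_series_def flip: scale_sum_left)
    finally show "of_nat i *s H i = (\<Sum>n\<le>i. of_nat n *s a n (H (i - n)))"
      unfolding H_def scale_sum_right sum.distrib[symmetric]
      by (simp flip: scale_left_distrib of_nat_add distrib_right)
  qed
  then show ?thesis by (simp add: H_def)
qed

lemma exp_series_zero: "(\<And>n. n > 0 \<Longrightarrow> \<gamma> n = 0) \<Longrightarrow> exp_series \<gamma> (\<lambda>r. if r = 0 then 1 else 0)"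
  by (auto simp: exp_series_def intro!: sum.neutral)

text \<open>This is \<open>(1 - c y t) / (1 - y t)\<close>.\<close>

lemma exp_series_geometric:
  assumes "\<And>n. n > 0 \<Longrightarrow> of_nat n * \<gamma> n = (1 - c ^ n) * y ^ n"
  shows "exp_series \<gamma> (\<lambda>r. if r = 0 then 1 else (1 - c) * y ^ r)"
  unfolding exp_series_def
proof (intro conjI allI)
  let ?g = "\<lambda>r. if r = 0 then 1 else (1 - c) * y ^ r"
  fix r
  show "of_nat r * ?g r = (\<Sum>n\<le>r. of_nat n * \<gamma> n * ?g (r - n))"
  proof (cases r)
    case (Suc m)
    have "(\<Sum>n\<le>r. of_nat n * \<gamma> n * ?g (r - n)) = (\<Sum>n=1..r. (1 - c ^ n) * y ^ n * ?g (r - n))"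
      by (rule sum.mono_neutral_cong_right) (auto simp: not_le assms)
    \<comment> \<open>The summand n = r is split off, since there the other factor is the
      exceptional value \<open>?g 0\<close>, which is 1.\<close>
    also have "\<dots> = (1 - c ^ r) * y ^ r + (\<Sum>n=1..m. (1 - c ^ n) * y ^ n * ?g (r - n))"
      by (simp add: Suc add.commute)
    also have "(\<Sum>n=1..m. (1 - c ^ n) * y ^ n * ?g (r - n)) = (\<Sum>n=1..m. (1 - c) * y ^ r * (1 - c ^ n))"
      by (intro sum.cong refl) (auto simp: Suc power_add[symmetric] mult_ac simp flip: power_Suc)
    also have "\<dots> = (1 - c) * y ^ r * (of_nat r - (\<Sum>n\<le>m. c ^ n))"
    proof -
      have "(\<Sum>n\<le>m. c ^ n) = 1 + (\<Sum>n=1..m. c ^ n)"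
        by (simp add: atMost_atLeast0 sum.atLeast_Suc_atMost)
      then show ?thesis by (simp add: sum_distrib_left[symmetric] sum_subtractf Suc)
    qed
    also have "(1 - c) * y ^ r * (of_nat r - (\<Sum>n\<le>m. c ^ n)) = (1 - c) * y ^ r * of_nat r - y ^ r * (1 - c ^ r)"
    proof -
      have "(1 - c) * (\<Sum>n\<le>m. c ^ n) = 1 - c ^ r" using sum_gp_basic[of c m] by (simp add: Suc)
      then have "y ^ r * ((1 - c) * (\<Sum>n\<le>m. c ^ n)) = y ^ r * (1 - c ^ r)" by simp
      then show ?thesis by (simp add: algebra_simps)
    qed
    finally show ?thesis by (simp add: Suc algebra_simps)
  qed simp
qed simp

end

section \<open>Vertex operators with modes in a fixed family\<close>

definition pos_modes :: "(int \<Rightarrow> 'v \<Rightarrow> 'v) \<Rightarrow> nat \<Rightarrow> 'v \<Rightarrow> 'v"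
  where "pos_modes a n = a (int n)"

definition neg_modes :: "(int \<Rightarrow> 'v \<Rightarrow> 'v) \<Rightarrow> nat \<Rightarrow> 'v \<Rightarrow> 'v"
  where "neg_modes a n = a (- int n)"

text \<open>\<open>M\<close> holds the exponents of all vertex operators in play. Closure under sums
  and under n-dependent scalars covers normal ordering, rescaled arguments and the denominators of
  screening currents. Brackets between modes of opposite sign are left to the single lemmas.\<close>

locale mode_families = complex_vector_space scale
  for scale :: "complex \<Rightarrow> 'v \<Rightarrow> 'v::ab_group_add" (infixr "*s" 75) +
  fixes M :: "(int \<Rightarrow> 'v \<Rightarrow> 'v) set"
  assumes M_lin: "a \<in> M \<Longrightarrow> n \<noteq> 0 \<Longrightarrow> linear_op scale (a n)"
    and M_comm: "a \<in> M \<Longrightarrow> b \<in> M \<Longrightarrow> n * k > 0 \<Longrightarrow> a n (b k v) = b k (a n v)"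
    and M_finite: "a \<in> M \<Longrightarrow> \<exists>B. \<forall>i>B. ecoeff (pos_modes a) i v = 0"
    and M_add: "a \<in> M \<Longrightarrow> b \<in> M \<Longrightarrow> (\<lambda>n v. a n v + b n v) \<in> M"
    and M_scale: "a \<in> M \<Longrightarrow> (\<lambda>n v. c n *s a n v) \<in> M"
begin

lemma M_lin_modes: "a \<in> M \<Longrightarrow> lin_modes (pos_modes a)" "a \<in> M \<Longrightarrow> lin_modes (neg_modes a)"
  by (auto simp: lin_modes_def pos_modes_def neg_modes_def intro: M_lin)

lemma M_comm_modes:
  assumes "a \<in> M" "b \<in> M"
  shows "comm_modes (pos_modes a) (pos_modes b)" "comm_modes (neg_modes a) (neg_modes b)"
  using assms by (auto simp: comm_modes_def pos_modes_def neg_modes_def intro: M_comm)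

definition commutes_M :: "('v \<Rightarrow> 'v) \<Rightarrow> bool"
  where "commutes_M A \<longleftrightarrow> lin A \<and> (\<forall>a\<in>M. \<forall>n v. n \<noteq> 0 \<longrightarrow> A (a n v) = a n (A v))"

lemma commutes_M_lin: "commutes_M A \<Longrightarrow> lin A"
  by (simp add: commutes_M_def)

lemma commutes_M_id: "commutes_M id"
  by (simp add: commutes_M_def lin_id)

lemma commutes_M_comp: "commutes_M A \<Longrightarrow> commutes_M B \<Longrightarrow> commutes_M (A \<circ> B)"
  using lin_comp[of A B] by (auto simp: commutes_M_def comp_def)

definition vop_M :: "'v vop \<Rightarrow> bool"
  where "vop_M V \<longleftrightarrow> commutes_M (fst V) \<and> snd V \<in> M"

abbreviation neg_exp :: "'v vop \<Rightarrow> int \<Rightarrow> 'v \<Rightarrow> 'v"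
  where "neg_exp V \<equiv> exp_coeff_int (neg_modes (snd V))"

abbreviation pos_exp :: "'v vop \<Rightarrow> nat \<Rightarrow> 'v \<Rightarrow> 'v"
  where "pos_exp V \<equiv> ecoeff (pos_modes (snd V))"

lemma lin_neg_exp: "vop_M V \<Longrightarrow> lin (neg_exp V q)"
  and lin_pos_exp: "vop_M V \<Longrightarrow> lin (pos_exp V b)"
  and lin_fst_vop: "vop_M V \<Longrightarrow> lin (fst V)"
  by (auto simp: vop_M_def commutes_M_def intro: lin_exp_coeff_int lin_exp_coeff M_lin_modes)

lemma fst_neg_exp: "vop_M V \<Longrightarrow> vop_M W \<Longrightarrow> fst V (neg_exp W q v) = neg_exp W q (fst V v)"
  by (rule exp_coeff_int_commute) (auto simp: vop_M_def commutes_M_def neg_modes_def)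

lemma fst_pos_exp: "vop_M V \<Longrightarrow> vop_M W \<Longrightarrow> fst V (pos_exp W b v) = pos_exp W b (fst V v)"
  by (rule exp_coeff_commute) (auto simp: vop_M_def commutes_M_def pos_modes_def)

lemma pos_exp_finite: "vop_M V \<Longrightarrow> \<exists>B. \<forall>b>B. pos_exp V b v = 0"
  by (auto simp: vop_M_def intro: M_finite)

text \<open>The bound for b depends on c, but only finitely many c give a nonzero vector
  \<open>pos_exp W c v\<close>, so a maximum over these serves all.\<close>

lemma pos_exp_pair_finite:
  assumes V: "vop_M V" and W: "vop_M W"
  shows "\<exists>B. (\<forall>c>B. pos_exp W c v = 0) \<and> (\<forall>b c. b > B \<longrightarrow> pos_exp V b (pos_exp W c v) = 0)"
proof -
  obtain B where B: "\<forall>c>B. pos_exp W c v = 0" using pos_exp_finite[OF W] by blast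
  have "\<forall>c. \<exists>B. \<forall>b>B. pos_exp V b (pos_exp W c v) = 0"
    using pos_exp_finite[OF V] by blast
  then obtain B' where B': "\<forall>c. \<forall>b>B' c. pos_exp V b (pos_exp W c v) = 0"
    by (rule choice[THEN exE])
  define K where "K = max B (Max (B' ` {..B}))"
  have "pos_exp V b (pos_exp W c v) = 0" if "b > K" for b c
  proof (cases "c \<le> B")
    case True
    then have "b > B' c" using that by (auto simp: K_def)
    then show ?thesis using B' by blast
  next
    case False
    then show ?thesis using B by (simp add: lin_zero[OF lin_pos_exp[OF V]])
  qed
  moreover have "pos_exp W c v = 0" if "c > K" for c using that B by (simp add: K_def)
  ultimately show ?thesis by blast
qed

lemma exp_coeff_pos_commute:
  assumes "a \<in> M" "b \<in> M"
  shows "ecoeff (pos_modes a) i (ecoeff (pos_modes b) j v)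
    = ecoeff (pos_modes b) j (ecoeff (pos_modes a) i v)"
proof (rule exp_coeff_commute)
  fix n :: nat and v assume "n > 0"
  show "ecoeff (pos_modes a) i (pos_modes b n v) = pos_modes b n (ecoeff (pos_modes a) i v)"
    by (rule exp_coeff_commute[symmetric])
       (use assms \<open>n > 0\<close> M_comm_modes(1) in \<open>auto intro: lin_modesD[OF M_lin_modes(1)] dest: comm_modesD\<close>)
qed (use assms in \<open>auto intro: lin_exp_coeff M_lin_modes\<close>)

lemma neg_exp_commute:
  assumes V: "vop_M V" and W: "vop_M W"
  shows "neg_exp V i (neg_exp W j v) = neg_exp W j (neg_exp V i v)"
proof (rule exp_coeff_int_commute)
  fix n :: nat and v assume "n > 0"
  show "neg_exp V i (neg_modes (snd W) n v) = neg_modes (snd W) n (neg_exp V i v)"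
    by (rule exp_coeff_int_commute[symmetric])
       (use V W \<open>n > 0\<close> M_comm_modes(2) in \<open>auto simp: vop_M_def intro: lin_modesD[OF M_lin_modes(2)] dest: comm_modesD\<close>)
qed (rule lin_neg_exp[OF V])

lemma pos_exp_commute:
  "vop_M V \<Longrightarrow> vop_M W \<Longrightarrow> pos_exp V i (pos_exp W j v) = pos_exp W j (pos_exp V i v)"
  by (auto simp: vop_M_def intro: exp_coeff_pos_commute)

section \<open>Modes of vertex operators and of normally ordered pairs\<close>

lemma vop_current_eq: "vcur V m v = Sum_any (\<lambda>b. fst V (neg_exp V (m + int b) (pos_exp V b v)))"
  if "vop_M V"
proof -
  have "fst V 0 = 0" using that by (simp add: lin_zero lin_fst_vop)
  then show ?thesis unfolding vop_current_def exp_coeff_int_def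
    by (auto simp: not_less pos_modes_def[abs_def] neg_modes_def[abs_def] intro!: arg_cong[of _ _ Sum_any])
qed

lemma vop_current_box:
  assumes V: "vop_M V" and B: "\<forall>b>B. pos_exp V b v = 0"
  shows "vcur V m v = (\<Sum>b\<le>B. fst V (neg_exp V (m + int b) (pos_exp V b v)))"
  unfolding vop_current_eq[OF V]
  by (rule Sum_any.expand_superset)
     (use B in \<open>auto simp: lin_zero[OF lin_fst_vop[OF V]] lin_zero[OF lin_neg_exp[OF V]] intro: leI\<close>)

lemma lin_vop_current:
  assumes V: "vop_M V"
  shows "lin (vcur V m)"
proof -
  have "lin (\<lambda>v. Sum_any (\<lambda>b. fst V (neg_exp V (m + int b) (pos_exp V b v))))"
  proof (rule lin_Sum_any_op)
    show "lin (\<lambda>v. fst V (neg_exp V (m + int b) (pos_exp V b v)))" for b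
      by (intro lin_comp[OF lin_fst_vop[OF V]] lin_comp[OF lin_neg_exp[OF V]] lin_pos_exp[OF V])
    fix v
    obtain B where B: "\<forall>b>B. pos_exp V b v = 0" using pos_exp_finite[OF V] by blast
    have "{b. fst V (neg_exp V (m + int b) (pos_exp V b v)) \<noteq> 0} \<subseteq> {..B}"
      using B by (auto simp: lin_zero[OF lin_fst_vop[OF V]] lin_zero[OF lin_neg_exp[OF V]] intro: leI)
    then show "finite {b. fst V (neg_exp V (m + int b) (pos_exp V b v)) \<noteq> 0}" by (rule finite_subset) simp
  qed
  then show ?thesis by (simp add: vop_current_eq[OF V, abs_def])
qed

text \<open>An intertwiner need only commute with the modes of the vertex operator at hand.\<close>

lemma vop_current_intertwine:
  assumes V: "vop_M V" and f: "lin f"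
    and modes: "\<And>n v. n \<noteq> 0 \<Longrightarrow> f (snd V n v) = snd V n (f v)"
    and fst: "\<And>v. f (fst V v) = c *s fst V (f v)"
  shows "f (vcur V m v) = c *s vcur V m (f v)"
proof -
  obtain B1 where B1: "\<forall>b>B1. pos_exp V b v = 0" using pos_exp_finite[OF V] by blast
  obtain B2 where B2: "\<forall>b>B2. pos_exp V b (f v) = 0" using pos_exp_finite[OF V] by blast
  have B: "\<forall>b>max B1 B2. pos_exp V b v = 0" "\<forall>b>max B1 B2. pos_exp V b (f v) = 0" using B1 B2 by auto
  have n: "f (neg_exp V q u) = neg_exp V q (f u)" for q u
    by (rule exp_coeff_int_commute) (auto simp: f modes neg_modes_def)
  have p: "f (pos_exp V q u) = pos_exp V q (f u)" for q u
    by (rule exp_coeff_commute) (auto simp: f modes pos_modes_def)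
  show ?thesis
    unfolding vop_current_box[OF V B(1)] vop_current_box[OF V B(2)] lin_sum[OF f] scale_sum_right
    by (simp add: n p fst)
qed

text \<open>The mode of \<open>:V(w) W(z):\<close> at \<open>w\<^sup>i z\<^sup>j\<close>.\<close>

definition nord_modes :: "'v vop \<Rightarrow> 'v vop \<Rightarrow> int \<Rightarrow> int \<Rightarrow> 'v \<Rightarrow> 'v"
  where "nord_modes V W i j v = Sum_any (\<lambda>(b, c).
    fst V (fst W (neg_exp V (i + int b) (neg_exp W (j + int c) (pos_exp V b (pos_exp W c v))))))"

context
  fixes V W :: "'v vop"
  assumes V: "vop_M V" and W: "vop_M W"
begin

private abbreviation "nterm i j b c v \<equiv>
  fst V (fst W (neg_exp V (i + int b) (neg_exp W (j + int c) (pos_exp V b (pos_exp W c v)))))"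

private lemma lins: "lin (fst V)" "lin (fst W)" "lin (neg_exp V q)" "lin (neg_exp W q)" "lin (pos_exp V b)" "lin (pos_exp W b)"
  using V W by (simp_all add: lin_fst_vop lin_neg_exp lin_pos_exp)

private lemmas zeros = lins[THEN lin_zero]

lemma nord_modes_box:
  assumes B: "\<forall>c>B. pos_exp W c v = 0" "\<forall>b c. b > B \<longrightarrow> pos_exp V b (pos_exp W c v) = 0"
  shows "nord_modes V W i j v = (\<Sum>b\<le>B. \<Sum>c\<le>B. nterm i j b c v)"
proof -
  have "nord_modes V W i j v = (\<Sum>(b, c)\<in>{..B} \<times> {..B}. nterm i j b c v)"
    unfolding nord_modes_def
  proof (rule Sum_any.expand_superset)
    have "nterm i j b c v = 0" if "b > B \<or> c > B" for b c
      using that B by (auto simp: zeros)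
    then show "{bc. (case bc of (b, c) \<Rightarrow> nterm i j b c v) \<noteq> 0} \<subseteq> {..B} \<times> {..B}"
      by (auto intro: leI)
  qed simp
  then show ?thesis by (simp add: sum.cartesian_product)
qed

lemma nord_modes_bounded_below: "\<exists>B. \<forall>i j. i < - B \<or> j < - B \<longrightarrow> nord_modes V W i j v = 0"
proof -
  obtain B where B: "\<forall>c>B. pos_exp W c v = 0" "\<forall>b c. b > B \<longrightarrow> pos_exp V b (pos_exp W c v) = 0"
    using pos_exp_pair_finite[OF V W] by blast
  have "\<forall>i j. i < - int B \<or> j < - int B \<longrightarrow> nord_modes V W i j v = 0"
    by (auto simp: nord_modes_box[OF B] zeros intro!: sum.neutral)
  then show ?thesis by blast
qed

lemma nord_modes_antidiagonal_finite: "finite {r. nord_modes V W (m + r) (l - r) v \<noteq> 0}"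
proof -
  obtain B where B: "\<And>i j. i < - B \<or> j < - B \<Longrightarrow> nord_modes V W i j v = 0"
    using nord_modes_bounded_below by metis
  have "{r. nord_modes V W (m + r) (l - r) v \<noteq> 0} \<subseteq> {- B - m..l + B}"
    using B by force
  then show ?thesis by (rule finite_subset) simp
qed

text \<open>Only the positive modes of V and the negative modes of W are out of order. Exchanging
  them produces g(z/w), whose r-th coefficient moves the degree r from z to w.\<close>

lemma vop_current_product:
  assumes br: "bracket_modes (pos_modes (snd V)) (neg_modes (snd W)) \<gamma>" and g: "exp_series \<gamma> g"
  shows "vcur V m (vcur W l v)
    = Sum_any (\<lambda>r::nat. g r *s nord_modes V W (m + int r) (l - int r) v)"
proof -
  obtain B where B: "\<forall>c>B. pos_exp W c v = 0" "\<forall>b c. b > B \<longrightarrow> pos_exp V b (pos_exp W c v) = 0"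
    using pos_exp_pair_finite[OF V W] by blast
  \<comment> \<open>For r > l + B and c \<le> B the negative exponential of W has degree l - r + c <
    0 and vanishes.\<close>
  define R where "R = nat (l + int B)"
  define f where "f c b r = g r *s nterm (m + int r) (l - int r) b c v" for c b r
  have f0: "f c b r = 0" if "b > B \<or> c > B \<or> r > R" for b c r
    using that
  proof (elim disjE)
    assume r: "r > R"
    show ?thesis
    proof (cases "c > B")
      case False
      then have "l - int r + int c < 0" using r unfolding R_def by linarith
      then show ?thesis by (simp add: f_def zeros)
    qed (simp add: f_def B zeros)
  qed (simp_all add: f_def B zeros)
  have contr: "pos_exp V b (neg_exp W q u) = (\<Sum>r\<le>b. g r *s neg_exp W (q - int r) (pos_exp V (b - r) u))" for b q u
    using V W
    by (intro exp_coeff_contraction[OF _ _ _ _ br g]) (auto simp: vop_M_def intro: M_lin_modes M_comm_modes)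
  have big: "pos_exp V b (vcur W l v) = (\<Sum>c\<le>B. \<Sum>r\<le>b. g r *s
      fst W (neg_exp W (l + int c - int r) (pos_exp V (b - r) (pos_exp W c v))))" for b
    unfolding vop_current_box[OF W B(1)] lin_sum[OF lins(5)]
    by (simp add: fst_pos_exp[OF W V, symmetric] contr lin_sum[OF lins(2)] lin_scale[OF lins(2)])
  have trm: "fst V (neg_exp V (m + int b) (pos_exp V b (vcur W l v)))
    = (\<Sum>c\<le>B. \<Sum>r\<le>b. f c (b - r) r)" for b
    unfolding big lin_sum[OF lins(1)] lin_sum[OF lins(3)]
    by (intro sum.cong refl)
       (auto simp: lin_scale[OF lins(1)] lin_scale[OF lins(3)] f_def of_nat_diff algebra_simps fst_neg_exp[OF W V])
  \<comment> \<open>A nonzero term has r \<le> R and b - r \<le> B.\<close>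
  have "\<forall>b>B + R. pos_exp V b (vcur W l v) = 0"
  proof (intro allI impI)
    fix b assume b: "b > B + R"
    show "pos_exp V b (vcur W l v) = 0"
      unfolding big
    proof (intro sum.neutral ballI)
      fix c r assume "c \<in> {..B}" "r \<in> {..b}"
      show "g r *s fst W (neg_exp W (l + int c - int r) (pos_exp V (b - r) (pos_exp W c v))) = 0"
      proof (cases "r > R")
        case True
        then have "l + int c - int r < 0" using \<open>c \<in> _\<close> unfolding R_def by auto
        then show ?thesis by (simp add: zeros)
      next
        case False
        then have "b - r > B" using b by simp
        then show ?thesis by (simp add: B zeros)
      qed
    qed
  qed
  from vop_current_box[OF V this, of m]
  have "vcur V m (vcur W l v) = (\<Sum>b\<le>B + R. \<Sum>c\<le>B. \<Sum>r\<le>b. f c (b - r) r)"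
    by (simp only: trm)
  also have "\<dots> = (\<Sum>c\<le>B. \<Sum>b\<le>B + R. \<Sum>r\<le>b. f c (b - r) r)"
    by (rule sum.swap)
  also have "\<dots> = (\<Sum>c\<le>B. \<Sum>r\<le>B + R. \<Sum>b\<le>B + R - r. f c b r)"
    by (intro sum.cong refl triangle_sum_diagonal[symmetric])
  also have "\<dots> = (\<Sum>c\<le>B. \<Sum>r\<le>R. \<Sum>b\<le>B. f c b r)"
  proof (rule sum.cong[OF refl])
    fix c
    have "(\<Sum>r\<le>B + R. \<Sum>b\<le>B + R - r. f c b r) = (\<Sum>r\<le>R. \<Sum>b\<le>B + R - r. f c b r)"
      by (rule sum.mono_neutral_right) (auto simp: f0 not_le intro!: sum.neutral)
    also have "\<dots> = (\<Sum>r\<le>R. \<Sum>b\<le>B. f c b r)"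
      by (intro sum.cong refl sum.mono_neutral_right) (auto simp: f0 not_le)
    finally show "(\<Sum>r\<le>B + R. \<Sum>b\<le>B + R - r. f c b r) = (\<Sum>r\<le>R. \<Sum>b\<le>B. f c b r)" .
  qed
  also have "\<dots> = (\<Sum>r\<le>R. \<Sum>b\<le>B. \<Sum>c\<le>B. f c b r)"
    by (subst sum.swap, intro sum.cong refl sum.swap)
  also have "\<dots> = (\<Sum>r\<le>R. g r *s nord_modes V W (m + int r) (l - int r) v)"
    unfolding nord_modes_box[OF B] f_def scale_sum_right ..
  also have "\<dots> = Sum_any (\<lambda>r::nat. g r *s nord_modes V W (m + int r) (l - int r) v)"
  proof (rule Sum_any.expand_superset[symmetric])
    have "g r *s nord_modes V W (m + int r) (l - int r) v = 0" if "r > R" for r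
      unfolding nord_modes_box[OF B] scale_sum_right
      using f0 that unfolding f_def by (intro sum.neutral ballI) auto
    then show "{r. g r *s nord_modes V W (m + int r) (l - int r) v \<noteq> 0} \<subseteq> {..R}" by (auto intro: leI)
  qed simp
  finally show ?thesis .
qed

lemma vop_M_nord: "vop_M (nord [V, W])"
  using V W M_add[of "snd V" "snd W"] commutes_M_comp[of "fst V" "fst W"]
  by (simp add: vop_M_def nord_def)

text \<open>Putting w = z collects all w^i z^j with i + j = p, and exponentials of commuting modes
  multiply by adding exponents, separately for the positive and the negative ones.\<close>

lemma sum_nord_modes_antidiagonal:
  "Sum_any (\<lambda>j::int. nord_modes V W (p - j) j v) = vcur (nord [V, W]) p v"
proof -
  let ?U = "nord [V, W]"
  have VM: "snd V \<in> M" "snd W \<in> M" using V W by (simp_all add: vop_M_def)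
  have modes: "pos_modes (snd ?U) = (\<lambda>n v. pos_modes (snd V) n v + pos_modes (snd W) n v)"
    "neg_modes (snd ?U) = (\<lambda>n v. neg_modes (snd V) n v + neg_modes (snd W) n v)"
    by (auto simp: pos_modes_def neg_modes_def nord_def fun_eq_iff)
  have pos: "pos_exp ?U b u = (\<Sum>c\<le>b. pos_exp V (b - c) (pos_exp W c u))" for b u
    unfolding modes using VM by (intro exp_coeff_add M_lin_modes M_comm_modes)
  have nn0: "neg_exp V i (neg_exp W j u) = 0" if "i < 0 \<or> j < 0" for i j u
    using that by (auto simp: zeros)
  have neg: "neg_exp ?U q u = Sum_any (\<lambda>j. neg_exp V (q - j) (neg_exp W j u))" for q u
  proof (cases "q < 0")
    case True
    then have "neg_exp V (q - j) (neg_exp W j u) = 0" for j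
      by (cases "j < 0") (simp_all add: zeros)
    then show ?thesis using True by simp
  next
    case False
    then obtain k where k: "q = int k" using nonneg_eq_int by (metis not_less)
    have "neg_exp ?U q u = (\<Sum>j\<le>k. neg_exp V (q - int j) (neg_exp W (int j) u))"
      unfolding modes k exp_coeff_int_of_nat using VM
      by (subst exp_coeff_add) (auto intro: M_lin_modes M_comm_modes simp flip: of_nat_diff)
    also have "\<dots> = (\<Sum>j\<in>int ` {..k}. neg_exp V (q - j) (neg_exp W j u))"
      by (simp add: sum.reindex)
    also have "\<dots> = Sum_any (\<lambda>j. neg_exp V (q - j) (neg_exp W j u))"
    proof (rule Sum_any.expand_superset[symmetric])
      have "j \<in> int ` {..k}" if "neg_exp V (q - j) (neg_exp W j u) \<noteq> 0" for j
      proof -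
        have "0 \<le> j" "j \<le> int k" using that nn0[of "q - j" j u] k by linarith+
        then show ?thesis by (intro image_eqI[of _ _ "nat j"]) auto
      qed
      then show "{j. neg_exp V (q - j) (neg_exp W j u) \<noteq> 0} \<subseteq> int ` {..k}" by blast
    qed simp
    finally show ?thesis .
  qed
  have fin: "finite {j. neg_exp V (q - j) (neg_exp W j u) \<noteq> 0}" for q u
  proof (rule finite_subset)
    have "0 \<le> j \<and> j \<le> q" if "neg_exp V (q - j) (neg_exp W j u) \<noteq> 0" for j
      using that nn0[of "q - j" j u] by linarith
    then show "{j. neg_exp V (q - j) (neg_exp W j u) \<noteq> 0} \<subseteq> {0..q}" by auto
  qed simp
  obtain B where B: "\<forall>c>B. pos_exp W c v = 0" "\<forall>b c. b > B \<longrightarrow> pos_exp V b (pos_exp W c v) = 0"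
    using pos_exp_pair_finite[OF V W] by blast
  have pp0: "pos_exp V b (pos_exp W c v) = 0" if "b > B \<or> c > B" for b c
    using that B by (auto simp: zeros)
  define F where "F b c = fst V (fst W (neg_exp ?U (p + int b + int c) (pos_exp V b (pos_exp W c v))))" for b c
  have linU: "lin (neg_exp ?U q)" for q using vop_M_nord by (rule lin_neg_exp)
  have F0: "F b c = 0" if "b > B \<or> c > B" for b c
    using pp0[OF that] by (simp add: F_def zeros lin_zero[OF linU])
  have F: "F b c = Sum_any (\<lambda>j. nterm (p - j) j b c v)" for b c
  proof -
    have "F b c = Sum_any (\<lambda>j. fst V (fst W (neg_exp V (p + int b + int c - j) (neg_exp W j (pos_exp V b (pos_exp W c v))))))"
      unfolding F_def neg
      by (rule lin_Sum_any[OF lin_comp[OF lins(1,2)] fin])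
    \<comment> \<open>Here j counts the degree of the negative exponential of W alone; the shift by
      c turns it into the total degree of W.\<close>
    also have "\<dots> = Sum_any (\<lambda>j. nterm (p - j) j b c v)"
      by (rule Sum_any.reindex_cong[of "\<lambda>j. j + int c"])
         (auto simp: bij_betw_def fun_eq_iff algebra_simps inj_def intro!: image_eqI[of _ _ "_ - int c"])
    finally show ?thesis .
  qed
  have finF: "finite {j. nterm (p - j) j b c v \<noteq> 0}" for b c
  proof (rule finite_subset)
    have "nterm (p - j) j b c v = 0" if "j < - int c \<or> j > p + int b" for j
      by (subst nn0) (use that in \<open>auto simp: zeros\<close>)
    then have "- int c \<le> j \<and> j \<le> p + int b" if "nterm (p - j) j b c v \<noteq> 0" for j
      using that by (metis not_le)
    then show "{j. nterm (p - j) j b c v \<noteq> 0} \<subseteq> {- int c..p + int b}"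
      unfolding subset_iff mem_Collect_eq atLeastAtMost_iff by blast
  qed simp
  have "vcur ?U p v = (\<Sum>b\<le>B + B. fst ?U (neg_exp ?U (p + int b) (pos_exp ?U b v)))"
  proof (rule vop_current_box[OF vop_M_nord], intro allI impI)
    fix b assume "b > B + B"
    then show "pos_exp ?U b v = 0"
      unfolding pos by (intro sum.neutral ballI pp0) auto
  qed
  also have "\<dots> = (\<Sum>b\<le>B + B. \<Sum>c\<le>b. F (b - c) c)"
    unfolding pos lin_sum[OF linU]
    by (simp add: nord_def lin_sum[OF lins(1)] lin_sum[OF lins(2)] F_def of_nat_diff)
  also have "\<dots> = (\<Sum>c\<le>B + B. \<Sum>b\<le>B + B - c. F b c)"
    by (rule triangle_sum_diagonal[symmetric])
  also have "\<dots> = (\<Sum>c\<le>B. \<Sum>b\<le>B + B - c. F b c)"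
    by (rule sum.mono_neutral_right) (auto simp: F0 not_le intro!: sum.neutral)
  also have "\<dots> = (\<Sum>c\<le>B. \<Sum>b\<le>B. F b c)"
    by (intro sum.cong refl sum.mono_neutral_right) (auto simp: F0 not_le)
  also have "\<dots> = (\<Sum>b\<le>B. \<Sum>c\<le>B. F b c)" by (rule sum.swap)
  also have "\<dots> = Sum_any (\<lambda>j. \<Sum>b\<le>B. \<Sum>c\<le>B. nterm (p - j) j b c v)"
  proof -
    let ?J = "\<Union>b\<in>{..B}. \<Union>c\<in>{..B}. {j. nterm (p - j) j b c v \<noteq> 0}"
    have J: "finite ?J" using finF by auto
    have "(\<Sum>b\<le>B. \<Sum>c\<le>B. F b c) = (\<Sum>b\<le>B. \<Sum>c\<le>B. \<Sum>j\<in>?J. nterm (p - j) j b c v)"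
      unfolding F by (intro sum.cong refl Sum_any.expand_superset[OF J]) auto
    also have "\<dots> = (\<Sum>j\<in>?J. \<Sum>b\<le>B. \<Sum>c\<le>B. nterm (p - j) j b c v)"
      by (simp only: sum.swap[of _ ?J])
    also have "\<dots> = Sum_any (\<lambda>j. \<Sum>b\<le>B. \<Sum>c\<le>B. nterm (p - j) j b c v)"
    proof (rule Sum_any.expand_superset[OF J, symmetric])
      show "{j. (\<Sum>b\<le>B. \<Sum>c\<le>B. nterm (p - j) j b c v) \<noteq> 0} \<subseteq> ?J"
      proof
        fix j assume "j \<in> {j. (\<Sum>b\<le>B. \<Sum>c\<le>B. nterm (p - j) j b c v) \<noteq> 0}"
        then obtain b where "b \<in> {..B}" "(\<Sum>c\<le>B. nterm (p - j) j b c v) \<noteq> 0"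
          by (auto elim: sum.not_neutral_contains_not_neutral)
        moreover then obtain c where "c \<in> {..B}" "nterm (p - j) j b c v \<noteq> 0"
          by (auto elim: sum.not_neutral_contains_not_neutral)
        ultimately show "j \<in> ?J" by blast
      qed
    qed
    finally show ?thesis .
  qed
  finally show ?thesis by (simp only: nord_modes_box[OF B])
qed

end

end

section \<open>Commutators as delta functions\<close>

text \<open>Expansions in z/w and in w/z are one-sided in opposite directions; as sums over all
  integers they can be subtracted.\<close>

lemma Sum_any_nat_int: "Sum_any (\<lambda>r::nat. f (int r)) = Sum_any (\<lambda>r::int. if r \<ge> 0 then f r else 0)"
proof -
  have "bij_betw int {r. f (int r) \<noteq> 0} {r. (if r \<ge> 0 then f r else 0) \<noteq> 0}"
    by (auto simp: bij_betw_def inj_on_def image_iff split: if_splits intro!: exI[of _ "nat _"])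
  from sum.reindex_bij_betw[OF this, of f] show ?thesis
    by (auto simp: Sum_any.expand_set split: if_splits intro!: sum.cong)
qed

lemma Sum_any_nat_int_neg: "Sum_any (\<lambda>r::nat. f (- int r)) = Sum_any (\<lambda>r::int. if r \<le> 0 then f r else 0)"
proof -
  have "Sum_any (\<lambda>r::nat. f (- int r)) = Sum_any (\<lambda>r::int. if r \<ge> 0 then f (- r) else 0)"
    by (rule Sum_any_nat_int)
  also have "\<dots> = Sum_any (\<lambda>r::int. if r \<le> 0 then f r else 0)"
    by (rule Sum_any.reindex_cong[of uminus]) (auto simp: fun_eq_iff bij_uminus)
  finally show ?thesis .
qed

context complex_vector_space
begin

lemma snd_vop_arg: "snd (vop_arg scale c V) n v = c powi (- n) *s snd V n v"
  and fst_vop_arg: "fst (vop_arg scale c V) = fst V"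
  by (simp_all add: vop_arg_def)

lemma snd_nord: "snd (nord Vs) n v = (\<Sum>V\<leftarrow>Vs. snd V n v)"
  by (simp add: nord_def)

text \<open>Identities of currents are reduced to identities of zero mode factors and of nonzero
  modes.\<close>

lemma vop_current_cong:
  assumes "fst V = fst W" "\<And>n v. n \<noteq> 0 \<Longrightarrow> snd V n v = snd W n v"
  shows "vcur V = vcur W"
proof -
  have 1: "ecoeff (\<lambda>n. snd V (int n)) = ecoeff (\<lambda>n. snd W (int n))"
    by (intro ext exp_coeff_cong) (auto simp: assms)
  have 2: "ecoeff (\<lambda>n. snd V (- int n)) = ecoeff (\<lambda>n. snd W (- int n))"
    by (intro ext exp_coeff_cong) (auto simp: assms)
  show ?thesis by (simp only: vop_current_def[abs_def] assms(1) 1 2)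
qed

end

context mode_families
begin

abbreviation varg :: "complex \<Rightarrow> 'v vop \<Rightarrow> 'v vop" where "varg \<equiv> vop_arg scale"

lemma vop_M_arg: "vop_M V \<Longrightarrow> vop_M (varg c V)"
  by (auto simp: vop_M_def vop_arg_def intro: M_scale)

lemma vop_M_nord_list:
  assumes "Vs \<noteq> []" "\<And>V. V \<in> set Vs \<Longrightarrow> vop_M V"
  shows "vop_M (nord Vs)"
  using assms
proof (induction Vs)
  case (Cons V Vs)
  then show ?case
  proof (cases "Vs = []")
    case True
    then show ?thesis using Cons by (auto simp: nord_def)
  next
    case False
    then have "vop_M (nord Vs)" "vop_M V" using Cons by auto
    from vop_M_nord[OF this(2,1)] show ?thesis by (simp add: nord_def)
  qed
qed simp

lemma vop_arg_exp:
  assumes "vop_M V" "c \<noteq> 0"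
  shows "neg_exp (varg c V) q v = c powi q *s neg_exp V q v"
    and "pos_exp (varg c V) b v = c powi (- int b) *s pos_exp V b v"
proof -
  have m: "neg_modes (snd (varg c V)) = (\<lambda>n v. c ^ n *s neg_modes (snd V) n v)"
    "pos_modes (snd (varg c V)) = (\<lambda>n v. inverse c ^ n *s pos_modes (snd V) n v)"
    using assms(2)
    by (auto simp: neg_modes_def pos_modes_def vop_arg_def fun_eq_iff power_int_minus power_inverse)
  have l: "lin_modes (neg_modes (snd V))" "lin_modes (pos_modes (snd V))"
    using assms(1) by (auto simp: vop_M_def intro: M_lin_modes)
  show "neg_exp (varg c V) q v = c powi q *s neg_exp V q v"
    by (auto simp: m exp_coeff_int_def exp_coeff_arg[OF l(1)] power_int_def)
  show "pos_exp (varg c V) b v = c powi (- int b) *s pos_exp V b v"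
    unfolding m exp_coeff_arg[OF l(2)] by (simp add: power_int_minus power_inverse)
qed

lemma nord_modes_arg:
  assumes V: "vop_M V" and W: "vop_M W" and c: "c \<noteq> 0"
  shows "nord_modes V (varg c W) i j v = c powi j *s nord_modes V W i j v"
proof -
  obtain B where B: "\<forall>c>B. pos_exp W c v = 0" "\<forall>b c. b > B \<longrightarrow> pos_exp V b (pos_exp W c v) = 0"
    using pos_exp_pair_finite[OF V W] by blast
  have B': "\<forall>b>B. pos_exp (varg c W) b v = 0"
    "\<forall>b b'. b > B \<longrightarrow> pos_exp V b (pos_exp (varg c W) b' v) = 0"
    using B by (auto simp: vop_arg_exp[OF W c] lin_scale[OF lin_pos_exp[OF V]])
  show ?thesis
    unfolding nord_modes_box[OF V W B] nord_modes_box[OF V vop_M_arg[OF W] B'] scale_sum_right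
    using c
    by (intro sum.cong refl)
      (simp add: vop_arg_exp[OF W c] fst_vop_arg lin_scale[OF lin_pos_exp[OF V]] lin_scale[OF lin_neg_exp[OF V]]
        lin_scale[OF lin_neg_exp[OF W]] lin_scale[OF lin_fst_vop[OF V]] lin_scale[OF lin_fst_vop[OF W]]
        power_int_add[symmetric] add.commute flip: power_int_minus)
qed

lemma vop_current_arg:
  assumes V: "vop_M V" and c: "c \<noteq> 0"
  shows "vcur (varg c V) = cur_arg scale c (vcur V)"
proof (intro ext)
  fix m v
  obtain B where B: "\<forall>b>B. pos_exp V b v = 0" using pos_exp_finite[OF V] by blast
  have B': "\<forall>b>B. pos_exp (varg c V) b v = 0" using B by (auto simp: vop_arg_exp[OF V c])
  show "vcur (varg c V) m v = cur_arg scale c (vcur V) m v"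
    unfolding cur_arg_def vop_current_box[OF V B] vop_current_box[OF vop_M_arg[OF V] B'] scale_sum_right
    using c
    by (intro sum.cong refl)
      (simp add: vop_arg_exp[OF V c] fst_vop_arg lin_scale[OF lin_neg_exp[OF V]] lin_scale[OF lin_fst_vop[OF V]]
        power_int_add[symmetric] add.commute flip: power_int_minus)
qed

context
  fixes V W :: "'v vop"
  assumes V: "vop_M V" and W: "vop_M W"
begin

lemma vop_current_product_no_contraction:
  assumes "bracket_modes (pos_modes (snd V)) (neg_modes (snd W)) (\<lambda>n. 0)"
  shows "vcur V m (vcur W l v) = nord_modes V W m l v"
proof -
  have "vcur V m (vcur W l v)
    = Sum_any (\<lambda>r::nat. (if r = 0 then 1 else 0) *s nord_modes V W (m + int r) (l - int r) v)"
    by (rule vop_current_product[OF V W assms exp_series_zero]) simp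
  also have "\<dots> = (\<Sum>r\<in>{0::nat}. nord_modes V W (m + int r) (l - int r) v)"
    by (subst Sum_any.expand_superset[of "{0}"]) auto
  finally show ?thesis by simp
qed

lemma cur_mult_vop_current:
  assumes "bracket_modes (pos_modes (snd V)) (neg_modes (snd W)) (\<lambda>n. 0)"
  shows "cur_mult (vcur V) (vcur W) = vcur (nord [V, W])"
  by (simp add: cur_mult_def fun_eq_iff vop_current_product_no_contraction[OF assms]
      sum_nord_modes_antidiagonal[OF V W])

lemma nord_modes_swap:
  assumes "\<And>v. fst V (fst W v) = fst W (fst V v)"
  shows "nord_modes W V j i v = nord_modes V W i j v"
  unfolding nord_modes_def
  by (rule Sum_any.reindex_cong[of prod.swap])
     (auto simp: fun_eq_iff assms neg_exp_commute[OF V W] pos_exp_commute[OF V W]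
       fst_neg_exp[OF V W] fst_neg_exp[OF W V])

text \<open>
  The two expansions of a contraction with a simple pole differ by a delta function, which
  identifies the arguments of the two vertex operators.
\<close>

lemma vop_commutator_delta:
  assumes br: "bracket_modes (pos_modes (snd V)) (neg_modes (snd W)) \<gamma>"
      "bracket_modes (pos_modes (snd W)) (neg_modes (snd V)) \<gamma>'"
    and fst: "\<And>v. fst V (fst W v) = fst W (fst V v)"
    and y: "y \<noteq> 0" and b: "b \<noteq> 0"
    and \<gamma>: "\<And>n. n > 0 \<Longrightarrow> of_nat n * \<gamma> n = (1 - inverse b ^ n) * y ^ n"
    and \<gamma>': "\<And>n. n > 0 \<Longrightarrow> of_nat n * \<gamma>' n = (1 - b ^ n) * inverse y ^ n"
  shows "b *s vcur V m (vcur W l v) - vcur W l (vcur V m v)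
    = ((b - 1) * y powi l) *s vcur (nord [V, varg (inverse y) W]) (m + l) v"
proof -
  define G where "G r = nord_modes V W (m + r) (l - r) v" for r
  have finG: "finite {r. G r \<noteq> 0}" unfolding G_def by (rule nord_modes_antidiagonal_finite[OF V W])
  have fin: "finite {r. (if P r then h r *s G r else 0) \<noteq> 0}" for P h
    by (rule finite_subset[OF _ finG]) auto
  \<comment> \<open>Let t = z/w. The first product carries (b - y t)/(1 - y t) expanded in t, after
    multiplication by b; the second carries the same function expanded in 1/t. \<open>h\<close> and
    \<open>h'\<close> are the coefficients, and their extensions by zero differ by (b - 1) y^r for
    every integer r.\<close>
  define h where "h r = (if r = 0 then b else (b - 1) * y powi r)" for r
  define h' where "h' r = (if r = 0 then 1 else (1 - b) * y powi r)" for r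
  have "b *s vcur V m (vcur W l v)
    = b *s Sum_any (\<lambda>r::nat. (if r = 0 then 1 else (1 - inverse b) * y ^ r) *s G (int r))"
    unfolding G_def by (subst vop_current_product[OF V W br(1) exp_series_geometric[OF \<gamma>]]) simp_all
  also have "\<dots> = Sum_any (\<lambda>r::nat. b *s (if r = 0 then 1 else (1 - inverse b) * y ^ r) *s G (int r))"
  proof (rule lin_Sum_any[OF lin_cmult[OF lin_id(2)]])
    have "finite (int -` {r. G r \<noteq> 0})" by (rule finite_vimageI[OF finG]) simp
    then show "finite {r. (if r = 0 then 1 else (1 - inverse b) * y ^ r) *s G (int r) \<noteq> 0}"
      by (rule rev_finite_subset) auto
  qed
  also have "\<dots> = Sum_any (\<lambda>r::nat. h (int r) *s G (int r))"
    using b by (intro arg_cong[of _ _ Sum_any]) (auto simp: h_def fun_eq_iff algebra_simps)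
  also have "\<dots> = Sum_any (\<lambda>r. if r \<ge> 0 then h r *s G r else 0)"
    by (rule Sum_any_nat_int)
  finally have 1: "b *s vcur V m (vcur W l v) = \<dots>" .
  have "vcur W l (vcur V m v)
    = Sum_any (\<lambda>r::nat. (if r = 0 then 1 else (1 - b) * inverse y ^ r) *s G (- int r))"
    unfolding G_def
    by (subst vop_current_product[OF W V br(2) exp_series_geometric[OF \<gamma>']])
       (simp_all add: nord_modes_swap[OF fst])
  also have "\<dots> = Sum_any (\<lambda>r::nat. h' (- int r) *s G (- int r))"
    by (intro arg_cong[of _ _ Sum_any]) (auto simp: h'_def fun_eq_iff power_int_minus power_inverse)
  also have "\<dots> = Sum_any (\<lambda>r. if r \<le> 0 then h' r *s G r else 0)"
    by (rule Sum_any_nat_int_neg)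
  finally have 2: "vcur W l (vcur V m v) = \<dots>" .
  have "Sum_any (\<lambda>r. if r \<ge> 0 then h r *s G r else 0)
    = Sum_any (\<lambda>r. (if r \<le> 0 then h' r *s G r else 0) + (if True then ((b - 1) * y powi r) *s G r else 0))"
    by (intro arg_cong[of _ _ Sum_any])
       (auto simp: h_def h'_def fun_eq_iff scale_left_distrib scale_left_diff_distrib algebra_simps)
  also have "\<dots> = Sum_any (\<lambda>r. if r \<le> 0 then h' r *s G r else 0) + Sum_any (\<lambda>r. ((b - 1) * y powi r) *s G r)"
    by (subst Sum_any.distrib[OF fin fin]) simp
  finally have "b *s vcur V m (vcur W l v) - vcur W l (vcur V m v)
    = Sum_any (\<lambda>r. ((b - 1) * y powi r) *s G r)"
    by (simp add: 1 2)
  also have "\<dots> = Sum_any (\<lambda>j. ((b - 1) * y powi (l - j)) *s G (l - j))"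
    by (rule Sum_any.reindex_cong[of "\<lambda>j. l - j"])
       (auto simp: fun_eq_iff bij_def inj_def surj_def intro!: exI[of _ "l - _"])
  \<comment> \<open>In y^(l-j) the part y^-j rescales the argument of W, that is, the delta function
    sets z = w/y.\<close>
  also have "\<dots> = Sum_any (\<lambda>j. ((b - 1) * y powi l) *s nord_modes V (varg (inverse y) W) (m + l - j) j v)"
    using y unfolding G_def
    by (intro arg_cong[of _ _ Sum_any])
       (auto simp: fun_eq_iff nord_modes_arg[OF V W] power_int_diff power_int_inverse field_simps)
  also have "\<dots> = ((b - 1) * y powi l) *s Sum_any (\<lambda>j. nord_modes V (varg (inverse y) W) (m + l - j) j v)"
  proof (rule lin_Sum_any[OF lin_cmult[OF lin_id(2)], symmetric])
    have "finite {r. nord_modes V (varg (inverse y) W) (m + l + r) (0 - r) v \<noteq> 0}"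
      by (rule nord_modes_antidiagonal_finite[OF V vop_M_arg[OF W]])
    then have "finite (uminus -` {r. nord_modes V (varg (inverse y) W) (m + l + r) (0 - r) v \<noteq> 0})"
      by (rule finite_vimageI) simp
    then show "finite {j. nord_modes V (varg (inverse y) W) (m + l - j) j v \<noteq> 0}"
      by (rule rev_finite_subset) auto
  qed
  also have "Sum_any (\<lambda>j. nord_modes V (varg (inverse y) W) (m + l - j) j v)
    = vcur (nord [V, varg (inverse y) W]) (m + l) v"
    by (rule sum_nord_modes_antidiagonal[OF V vop_M_arg[OF W]])
  finally show ?thesis .
qed

end

lemma vop_current_commute:
  assumes V: "vop_M V" and W: "vop_M W"
    and br: "bracket_modes (pos_modes (snd V)) (neg_modes (snd W)) (\<lambda>n. 0)"
      "bracket_modes (pos_modes (snd W)) (neg_modes (snd V)) (\<lambda>n. 0)"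
    and fst: "\<And>v. fst V (fst W v) = fst W (fst V v)"
  shows "vcur V m (vcur W l v) = vcur W l (vcur V m v)"
  by (simp add: vop_current_product_no_contraction[OF V W br(1)]
      vop_current_product_no_contraction[OF W V br(2)] nord_modes_swap[OF V W fst])

end

section \<open>Functions of diagonalizable operators\<close>

context complex_vector_space
begin

lemma diagonalizable_lin: "diagonalizable_op scale D \<Longrightarrow> lin D"
  by (simp add: diagonalizable_op_def)

lemma eq_on_spanning_set:
  assumes "lin F" "lin G" "v \<in> span S" "\<And>u. u \<in> S \<Longrightarrow> F u = G u"
  shows "F v = G v"
  using assms(3)
proof (induction rule: span_induct_alt)
  case base
  then show ?case by (simp add: lin_zero assms)
next
  case (step c x y)
  then show ?case by (simp add: lin_add lin_scale assms)
qed

lemma diagonalizable_eqI: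
  assumes "diagonalizable_op scale D" "lin F" "lin G" "\<And>\<mu> u. D u = \<mu> *s u \<Longrightarrow> F u = G u"
  shows "F v = G v"
  by (rule eq_on_spanning_set[OF assms(2,3), of v "{u. \<exists>\<mu>. D u = \<mu> *s u}"])
     (use assms(1,4) in \<open>auto simp: diagonalizable_op_def\<close>)

text \<open>On a basis of eigenvectors every function of the eigenvalue defines an operator.\<close>

lemma fun_op_exists:
  assumes D: "diagonalizable_op scale D"
  shows "\<exists>F. lin F \<and> (\<forall>\<mu> u. D u = \<mu> *s u \<longrightarrow> F u = f \<mu> *s u)"
proof -
  interpret vector_space_pair scale scale by unfold_locales
  let ?E = "{u. \<exists>\<mu>. D u = \<mu> *s u}"
  obtain B where B: "B \<subseteq> ?E" "independent B" "?E \<subseteq> span B"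
    using maximal_independent_subset[of ?E] by blast
  have spanB: "v \<in> span B" for v
    using D span_mono[OF B(3)] by (auto simp: diagonalizable_op_def span_span)
  have "\<forall>b\<in>B. \<exists>\<mu>. D b = \<mu> *s b" using B(1) by blast
  then obtain e where e: "\<forall>b\<in>B. D b = e b *s b" by (rule bchoice[THEN exE])
  define F where "F = construct B (\<lambda>b. f (e b) *s b)"
  have F: "lin F" and FB: "\<And>b. b \<in> B \<Longrightarrow> F b = f (e b) *s b"
    using linear_construct[OF B(2)] construct_basis[OF B(2)] by (auto simp: F_def)
  have "F u = f \<mu> *s u" if u: "D u = \<mu> *s u" for \<mu> u
  proof -
    obtain t r where t: "finite t" "t \<subseteq> B" "u = (\<Sum>a\<in>t. r a *s a)"
      using spanB[of u] by (auto simp: span_explicit)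
    \<comment> \<open>By independence of the basis, an eigenvector of eigenvalue \<mu> involves only
      basis vectors of this eigenvalue, so the construction on the basis is correct on all
      eigenvectors.\<close>
    have "(\<Sum>a\<in>t. (r a * (e a - \<mu>)) *s a) = D u - \<mu> *s u"
      using t(2) unfolding t(3) lin_sum[OF diagonalizable_lin[OF D]] scale_sum_right sum_subtractf[symmetric]
      by (intro sum.cong refl)
         (auto simp: lin_scale[OF diagonalizable_lin[OF D]] e subset_iff algebra_simps scale_left_diff_distrib)
    also have "\<dots> = 0" using u by simp
    finally have sum0: "(\<Sum>a\<in>t. (r a * (e a - \<mu>)) *s a) = 0" .
    have re: "r a * (e a - \<mu>) = 0" if "a \<in> t" for a
      by (rule independentD[OF B(2) t(1,2) sum0 that])
    have "r a *s F a = r a *s (f \<mu> *s a)" if "a \<in> t" for a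
    proof -
      have "F a = f (e a) *s a" using FB t(2) that by blast
      then show ?thesis using re[OF that] by (cases "r a = 0") simp_all
    qed
    then have "F u = (\<Sum>a\<in>t. r a *s (f \<mu> *s a))"
      unfolding t(3) by (simp add: lin_sum[OF F] lin_scale[OF F] cong: sum.cong)
    then show ?thesis by (simp add: t(3) scale_sum_right mult.commute)
  qed
  with F show ?thesis by blast
qed

lemma fun_op_spec:
  assumes D: "diagonalizable_op scale D"
  shows "lin (fun_op scale f D) \<and> (\<forall>\<mu> u. D u = \<mu> *s u \<longrightarrow> fun_op scale f D u = f \<mu> *s u)"
proof -
  let ?P = "\<lambda>F. lin F \<and> (\<forall>\<mu> u. D u = \<mu> *s u \<longrightarrow> F u = f \<mu> *s u)"
  have "\<exists>!F. ?P F"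
  proof (rule ex_ex1I[OF fun_op_exists[OF D]])
    fix F G assume F: "?P F" and G: "?P G"
    show "F = G"
    proof
      fix v
      have "F u = G u" if u: "D u = \<mu> *s u" for \<mu> u
        using conjunct2[OF F, THEN spec, THEN spec, THEN mp, OF u]
          conjunct2[OF G, THEN spec, THEN spec, THEN mp, OF u] by simp
      then show "F v = G v"
        by (rule diagonalizable_eqI[OF D conjunct1[OF F] conjunct1[OF G]])
    qed
  qed
  from theI'[OF this] show ?thesis unfolding fun_op_def .
qed

lemma lin_fun_op: "diagonalizable_op scale D \<Longrightarrow> lin (fun_op scale f D)"
  by (rule conjunct1[OF fun_op_spec])

lemma fun_op_eigen:
  assumes "diagonalizable_op scale D" "D u = \<mu> *s u"
  shows "fun_op scale f D u = f \<mu> *s u"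
  by (rule conjunct2[OF fun_op_spec[OF assms(1)], THEN spec, THEN spec, THEN mp, OF assms(2)])

lemma fun_op_commute:
  assumes D: "diagonalizable_op scale D" and G: "lin G" and GD: "\<And>v. G (D v) = D (G v)"
  shows "G (fun_op scale f D v) = fun_op scale f D (G v)"
proof (rule diagonalizable_eqI[OF D, where F = "\<lambda>v. G (fun_op scale f D v)" and G = "\<lambda>v. fun_op scale f D (G v)"])
  fix \<mu> u assume u: "D u = \<mu> *s u"
  then have Gu: "D (G u) = \<mu> *s G u" by (simp add: lin_scale[OF G] flip: GD)
  show "G (fun_op scale f D u) = fun_op scale f D (G u)"
    by (simp add: fun_op_eigen[OF D u] fun_op_eigen[OF D Gu] lin_scale[OF G])
qed (rule lin_comp[OF G lin_fun_op[OF D]] lin_comp[OF lin_fun_op[OF D] G])+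

lemma fun_op_mult:
  assumes D: "diagonalizable_op scale D"
  shows "fun_op scale f D (fun_op scale g D v) = fun_op scale (\<lambda>\<mu>. f \<mu> * g \<mu>) D v"
proof (rule diagonalizable_eqI[OF D, where F = "\<lambda>v. fun_op scale f D (fun_op scale g D v)"])
  fix \<mu> u assume u: "D u = \<mu> *s u"
  show "fun_op scale f D (fun_op scale g D u) = fun_op scale (\<lambda>\<mu>. f \<mu> * g \<mu>) D u"
    by (simp add: fun_op_eigen[OF D u] lin_scale[OF lin_fun_op[OF D]] mult.commute)
qed (rule lin_comp[OF lin_fun_op[OF D] lin_fun_op[OF D]] lin_fun_op[OF D])+

lemma fun_op_one:
  assumes D: "diagonalizable_op scale D"
  shows "fun_op scale (\<lambda>\<mu>. 1) D v = v"
proof (rule diagonalizable_eqI[OF D lin_fun_op[OF D] lin_id(2)])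
  fix \<mu> u assume u: "D u = \<mu> *s u"
  show "fun_op scale (\<lambda>\<mu>. 1) D u = u" by (simp add: fun_op_eigen[OF D u])
qed

definition eigen_proj :: "('v \<Rightarrow> 'v) \<Rightarrow> complex \<Rightarrow> 'v \<Rightarrow> 'v"
  where "eigen_proj D \<mu> = fun_op scale (\<lambda>x. if x = \<mu> then 1 else 0) D"

context
  fixes D assumes D: "diagonalizable_op scale D"
begin

lemma lin_eigen_proj: "lin (eigen_proj D \<mu>)"
  by (simp add: eigen_proj_def lin_fun_op[OF D])

lemma eigen_proj_eigen:
  assumes "D u = \<mu> *s u"
  shows "eigen_proj D \<nu> u = (if \<mu> = \<nu> then u else 0)"
  by (simp add: eigen_proj_def fun_op_eigen[OF D assms])

lemma eigen_eigen_proj: "D (eigen_proj D \<mu> v) = \<mu> *s eigen_proj D \<mu> v"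
proof (rule diagonalizable_eqI[OF D, where F = "\<lambda>v. D (eigen_proj D \<mu> v)"])
  fix \<nu> u assume u: "D u = \<nu> *s u"
  show "D (eigen_proj D \<mu> u) = \<mu> *s eigen_proj D \<mu> u"
    by (cases "\<nu> = \<mu>") (simp_all add: eigen_proj_eigen[OF u] u lin_zero[OF diagonalizable_lin[OF D]])
qed (rule lin_comp[OF diagonalizable_lin[OF D] lin_eigen_proj] lin_cmult[OF lin_eigen_proj])+

lemma eigen_proj_finite_sum: "finite {\<mu>. eigen_proj D \<mu> v \<noteq> 0}"
  and eigen_proj_sum: "Sum_any (\<lambda>\<mu>. eigen_proj D \<mu> v) = v"
proof -
  have "v \<in> span {u. \<exists>\<mu>. D u = \<mu> *s u}" using D by (simp add: diagonalizable_op_def)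
  then have "finite {\<mu>. eigen_proj D \<mu> v \<noteq> 0} \<and> Sum_any (\<lambda>\<mu>. eigen_proj D \<mu> v) = v"
  proof (induction rule: span_induct_alt)
    case base
    then show ?case by (simp add: lin_zero[OF lin_eigen_proj])
  next
    case (step c x y)
    then obtain \<mu> where x: "D x = \<mu> *s x" by auto
    have e: "eigen_proj D \<nu> (c *s x + y) = (if \<nu> = \<mu> then c *s x else 0) + eigen_proj D \<nu> y" for \<nu>
      by (auto simp: lin_add[OF lin_eigen_proj] lin_scale[OF lin_eigen_proj] eigen_proj_eigen[OF x])
    have "finite {\<nu>. (if \<nu> = \<mu> then c *s x else 0) \<noteq> 0}"
      by (rule finite_subset[of _ "{\<mu>}"]) auto
    moreover have "Sum_any (\<lambda>\<nu>. if \<nu> = \<mu> then c *s x else 0) = c *s x"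
      by (subst Sum_any.expand_superset[of "{\<mu>}"]) auto
    moreover have "finite {\<nu>. (if \<nu> = \<mu> then c *s x else 0) + eigen_proj D \<nu> y \<noteq> 0}"
      by (rule finite_subset[of _ "insert \<mu> {\<nu>. eigen_proj D \<nu> y \<noteq> 0}"]) (use step.IH in auto)
    ultimately show ?case using step.IH by (simp add: e Sum_any.distrib)
  qed
  then show "finite {\<mu>. eigen_proj D \<mu> v \<noteq> 0}" "Sum_any (\<lambda>\<mu>. eigen_proj D \<mu> v) = v" by auto
qed

lemma eigen_proj_commute:
  "lin G \<Longrightarrow> (\<And>v. G (D v) = D (G v)) \<Longrightarrow> G (eigen_proj D \<mu> v) = eigen_proj D \<mu> (G v)"
  unfolding eigen_proj_def by (rule fun_op_commute[OF D, of G])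

end

text \<open>An eigenprojection of one operator commutes with all the others and therefore preserves
  their eigenvectors. Splitting a vector by one operator after the other ends in joint
  eigenvectors.\<close>

lemma joint_eigenvectors_span:
  assumes "finite I" and D: "\<And>i. i \<in> I \<Longrightarrow> diagonalizable_op scale (D i)"
    and comm: "\<And>i j v. i \<in> I \<Longrightarrow> j \<in> I \<Longrightarrow> D i (D j v) = D j (D i v)"
  shows "v \<in> span {u. \<forall>i\<in>I. \<exists>\<mu>. D i u = \<mu> *s u}"
proof -
  define J where "J K = {u. \<forall>i\<in>K. \<exists>\<mu>. D i u = \<mu> *s u}" for K
  have "v \<in> span (J K)" if "finite K" "K \<subseteq> I" for K v
    using that
  proof (induction K arbitrary: v rule: finite_induct)
    case empty
    show ?case by (simp add: J_def span_UNIV)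
  next
    case (insert i K)
    then have i: "i \<in> I" and K: "K \<subseteq> I" by auto
    note Di = D[OF i]
    have "J K \<subseteq> span (J (insert i K))"
    proof
      fix u assume u: "u \<in> J K"
      have "eigen_proj (D i) \<mu> u \<in> J (insert i K)" for \<mu>
      proof -
        have "\<exists>\<nu>. D j (eigen_proj (D i) \<mu> u) = \<nu> *s eigen_proj (D i) \<mu> u" if j: "j \<in> K" for j
        proof -
          have jI: "j \<in> I" using j K by blast
          from u j obtain \<nu> where "D j u = \<nu> *s u" unfolding J_def by blast
          moreover have "D j (eigen_proj (D i) \<mu> u) = eigen_proj (D i) \<mu> (D j u)"
            by (rule eigen_proj_commute[OF Di, of "D j"]) (rule diagonalizable_lin[OF D[OF jI]], rule comm[OF jI i])
          ultimately show ?thesis by (auto simp: lin_scale[OF lin_eigen_proj[OF Di]])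
        qed
        then show ?thesis using eigen_eigen_proj[OF Di] by (auto simp: J_def)
      qed
      then have "(\<Sum>\<mu> | eigen_proj (D i) \<mu> u \<noteq> 0. eigen_proj (D i) \<mu> u) \<in> span (J (insert i K))"
        by (intro span_sum span_base)
      then show "u \<in> span (J (insert i K))"
        using eigen_proj_sum[OF Di, of u] by (simp add: Sum_any.expand_set)
    qed
    then have "span (J K) \<subseteq> span (J (insert i K))" by (metis span_mono span_span)
    with insert.IH[OF K] show ?case by blast
  qed
  then show ?thesis using assms(1) by (simp add: J_def)
qed

end

section \<open>The quiver and the free fields\<close>

lemma concat_map_unique:
  assumes "\<And>k. Q k \<Longrightarrow> k = i"
  shows "concat (map (\<lambda>k. if Q k then f k else []) [a..<b]) = (if a \<le> i \<and> i < b \<and> Q i then f i else [])"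
proof (induction b)
  case (Suc b)
  then show ?case using assms[of b] by (auto simp: less_Suc_eq)
qed auto

lemma labels_akos:
  assumes "i \<le> N" "j \<le> N"
  shows "labels (akos_quiver N a b) i j =
    (if i = j \<and> 0 < i \<and> i < N then [a] else if j = Suc i then [1] else if i = Suc j then [b] else [])"
proof -
  have "concat (map (\<lambda>k. if k = i \<and> k = j then [a] else []) [1..<N]) = (if 1 \<le> i \<and> i < N \<and> i = j then [a] else [])"
    by (subst concat_map_unique[where i = i]) auto
  moreover have "concat (map (\<lambda>k. if k = i \<and> Suc k = j then [1] else []) [0..<N]) = (if i < N \<and> Suc i = j then [1 :: complex] else [])"
    by (subst concat_map_unique[where i = i]) auto
  moreover have "concat (map (\<lambda>k. if Suc k = i \<and> k = j then [b] else []) [0..<N]) = (if j < N \<and> i = Suc j then [b] else [])"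
    by (subst concat_map_unique[where i = j]) auto
  ultimately show ?thesis
    using assms unfolding labels_def akos_quiver_def by (auto simp: comp_def)
qed

lemma dashed_labels_akos:
  "0 < N \<Longrightarrow> dashed_labels (akos_quiver N a b) i = (if i = 0 \<or> i = N then [a] else [])"
  by (auto simp: dashed_labels_def akos_quiver_def)

lemma quiver_pow_akos: "quiver_pow n (akos_quiver N a b) = akos_quiver N (a ^ n) (b ^ n)"
  by (simp add: quiver_pow_def akos_quiver_def comp_def)

lemma quiver_eps_akos: "i \<le> N \<Longrightarrow> j \<le> N \<Longrightarrow> quiver_eps (akos_quiver N a b) i j = 0"
  by (simp add: quiver_eps_def labels_akos)

text \<open>The matrix \<open>C\<^sub>i\<^sub>j\<close> of the quiver, with \<open>g = (1 - q\<^sub>1) (1 - q\<^sub>2)\<close> and \<open>p = q\<^sub>3\<close>.\<close>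

definition akos_matrix :: "nat \<Rightarrow> complex \<Rightarrow> complex \<Rightarrow> nat \<Rightarrow> nat \<Rightarrow> complex"
  where "akos_matrix N g p i j =
    (if i = j then (if i = 0 then - g else if i = N then - g * p else - g * (1 + p))
     else if j = Suc i then g * p else if i = Suc j then g else 0)"

lemma quiver_C_akos:
  assumes "i \<le> N" "j \<le> N" "0 < N" "q \<noteq> 0" "a \<noteq> 0" "a * q\<^sup>2 * b = 1"
  shows "quiver_C (akos_quiver N a b) q i j = akos_matrix N ((1 - a) * (1 - q\<^sup>2)) b i j"
proof -
  have b: "b = inverse (a * q\<^sup>2)" using assms(6) by (metis inverse_unique)
  have vt: "vtype (akos_quiver N a b) i = (if i = 0 then FrozenMinus else if i = N then FrozenPlus else Unfrozen)" for i
    by (simp add: akos_quiver_def)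
  have c: "quiver_c (akos_quiver N a b) q i j =
    (if i = j then (if i = 0 then q - q * a else if i = N then - inverse q + inverse q * inverse a
       else (q - inverse q) - (q * a - inverse q * inverse a))
     else if j = Suc i then inverse q - q * b else if i = Suc j then inverse q * inverse b - q else 0)"
    using assms(1-3) by (auto simp: quiver_c_def labels_akos dashed_labels_akos vt)
  show ?thesis
    unfolding quiver_C_def c unfolding akos_matrix_def b using assms(4,5)
    by (simp add: field_simps power2_eq_square)
qed

section \<open>Local finiteness of exponentials of positive modes\<close>

context complex_vector_space
begin

lemma foldr_commute:
  assumes "comm_modes h h" "0 \<notin> set ns" "n > 0"
  shows "foldr h ns (h n v) = h n (foldr h ns v)"
  using assms(2) by (induction ns) (auto simp: comm_modesD[OF assms(1)] assms(3))

text \<open>Gathering all copies of one mode next to v is what makes its local nilpotency at v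
  applicable.\<close>

lemma foldr_collect:
  assumes h: "comm_modes h h" and n: "n > 0" and "0 \<notin> set ns"
  shows "foldr h ns v = foldr h (filter (\<lambda>k. k \<noteq> n) ns) ((h n ^^ count_list ns n) v)"
  using assms(3)
proof (induction ns)
  case (Cons k ns)
  then have "0 \<notin> set (filter (\<lambda>k. k \<noteq> n) ns)" by auto
  from foldr_commute[OF h this n] show ?case using Cons by auto
qed simp

text \<open>Pigeonhole. Let R n be an exponent with which \<open>h n\<close> kills v, equal to 1 for
  n > K. If each n occurs fewer than R n times in a composition, its parts are at most K and its sum
  is at most B. A larger composition has some n at least R n times and gives 0.\<close>

lemma exp_coeff_locally_finite:
  assumes l: "lin_modes h" and c: "comm_modes h h"
    and K: "\<And>n. n > K \<Longrightarrow> h n v = 0" and nil: "\<And>n. n > 0 \<Longrightarrow> \<exists>r. (h n ^^ r) v = 0"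
  shows "\<exists>B. \<forall>i>B. ecoeff (\<lambda>n u. d n *s h n u) i v = 0"
proof -
  have "\<forall>n. \<exists>r. n > 0 \<longrightarrow> (h n ^^ r) v = 0 \<and> (n > K \<longrightarrow> r = 1)"
  proof
    fix n
    show "\<exists>r. n > 0 \<longrightarrow> (h n ^^ r) v = 0 \<and> (n > K \<longrightarrow> r = 1)"
      using K[of n] nil[of n] by (cases "n > K") auto
  qed
  then obtain R where R: "\<forall>n. n > 0 \<longrightarrow> (h n ^^ R n) v = 0 \<and> (n > K \<longrightarrow> R n = 1)"
    by (rule choice[THEN exE])
  define B where "B = (\<Sum>n=1..K. R n * n)"
  have zero: "foldr h ns v = 0" if ns: "0 \<notin> set ns" "sum_list ns > B" for ns
  proof -
    have "\<exists>n\<in>set ns. count_list ns n \<ge> R n"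
    proof (rule ccontr)
      assume "\<not> (\<exists>n\<in>set ns. count_list ns n \<ge> R n)"
      then have less: "count_list ns n < R n" if "n \<in> set ns" for n using that by (simp add: not_le)
      have "set ns \<subseteq> {1..K}"
      proof
        fix n assume n: "n \<in> set ns"
        then have "n > 0" using ns(1) by (auto intro: gr0I)
        moreover have "n \<le> K"
        proof (rule ccontr)
          assume "\<not> n \<le> K"
          then have "R n = 1" using R \<open>n > 0\<close> by simp
          then show False using less[OF n] n by (simp add: count_list_0_iff)
        qed
        ultimately show "n \<in> {1..K}" by simp
      qed
      then have "(\<Sum>n\<in>set ns. R n * n) \<le> B" unfolding B_def by (intro sum_mono2) auto
      moreover have "sum_list ns \<le> (\<Sum>n\<in>set ns. R n * n)"
      proof -
        have "sum_list ns = (\<Sum>n\<in>set ns. count_list ns n * n)"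
          using sum_list_map_eq_sum_count[of "\<lambda>n. n" ns] by simp
        also have "\<dots> \<le> (\<Sum>n\<in>set ns. R n * n)"
          by (intro sum_mono mult_right_mono less_imp_le[OF less]) auto
        finally show ?thesis .
      qed
      ultimately show False using ns(2) by simp
    qed
    then obtain n where n: "n \<in> set ns" "count_list ns n \<ge> R n" by blast
    then have n0: "n > 0" using ns(1) by (auto intro: gr0I)
    have lp: "lin (h n ^^ r)" for r
    proof (induction r)
      case (Suc r)
      from lin_comp[OF lin_modesD[OF l n0] this] show ?case by (simp add: comp_def)
    qed (simp add: lin_id)
    have "(h n ^^ count_list ns n) v = (h n ^^ (count_list ns n - R n)) ((h n ^^ R n) v)"
      using n(2) by (metis comp_apply funpow_add le_add_diff_inverse2)
    also have "\<dots> = 0" using R n0 by (simp add: lin_zero[OF lp])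
    finally have c0: "(h n ^^ count_list ns n) v = 0" .
    have "lin (foldr h (filter (\<lambda>k. k \<noteq> n) ns))" using ns(1) by (intro lin_foldr[OF l]) auto
    then show ?thesis by (simp add: foldr_collect[OF c n0 ns(1)] c0 lin_zero)
  qed
  have scaled: "foldr (\<lambda>n u. d n *s h n u) ns v = prod_list (map d ns) *s foldr h ns v" if "0 \<notin> set ns" for ns
    using that by (induction ns) (auto simp: lin_scale[OF lin_modesD[OF l]])
  have "\<forall>i>B. ecoeff (\<lambda>n u. d n *s h n u) i v = 0"
    unfolding exp_coeff_def by (auto intro!: sum.neutral simp: scaled zero)
  then show ?thesis by blast
qed

text \<open>By the product formula: exp(b) gives finitely many nonzero vectors out of v, and each is
  killed by the high coefficients of exp(a).\<close>

lemma exp_coeff_add_finite: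
  assumes l: "lin_modes a" "lin_modes b"
    and c: "comm_modes a a" "comm_modes b b" "comm_modes a b"
    and fin: "\<And>v. \<exists>B. \<forall>i>B. ecoeff a i v = 0" "\<And>v. \<exists>B. \<forall>i>B. ecoeff b i v = 0"
  shows "\<exists>B. \<forall>i>B. ecoeff (\<lambda>n v. a n v + b n v) i v = 0"
proof -
  obtain B where B: "\<forall>i>B. ecoeff b i v = 0" using fin(2) by blast
  have "\<forall>j. \<exists>B. \<forall>i>B. ecoeff a i (ecoeff b j v) = 0" using fin(1) by blast
  then obtain B' where B': "\<forall>j. \<forall>i>B' j. ecoeff a i (ecoeff b j v) = 0"
    by (rule choice[THEN exE])
  define K where "K = B + Max (B' ` {..B})"
  have "ecoeff (\<lambda>n v. a n v + b n v) m v = 0" if m: "m > K" for m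
  proof -
    have "ecoeff a (m - i) (ecoeff b i v) = 0" for i
    proof (cases "i \<le> B")
      case True
      then have "B' i \<le> Max (B' ` {..B})" by (intro Max_ge) auto
      with m True have "m - i > B' i" unfolding K_def by linarith
      then show ?thesis using B' by blast
    next
      case False
      then show ?thesis using B by (simp add: lin_zero[OF lin_exp_coeff[OF l(1)]])
    qed
    then show ?thesis by (simp add: exp_coeff_add[OF l c])
  qed
  then show ?thesis by blast
qed

end

context mode_families
begin

section \<open>Scalar brackets between positive and negative modes\<close>

definition bracket :: "(int \<Rightarrow> 'v \<Rightarrow> 'v) \<Rightarrow> (int \<Rightarrow> 'v \<Rightarrow> 'v) \<Rightarrow> (nat \<Rightarrow> complex) \<Rightarrow> bool"
  where "bracket a b \<gamma> \<longleftrightarrow> bracket_modes (pos_modes a) (neg_modes b) \<gamma>"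

lemma bracketI:
  assumes "\<And>n k v. n > 0 \<Longrightarrow> k < 0 \<Longrightarrow> n + k \<noteq> 0 \<Longrightarrow> a n (b k v) = b k (a n v)"
    and "\<And>n v. n > 0 \<Longrightarrow> a (int n) (b (- int n) v) - b (- int n) (a (int n) v) = \<gamma> n *s v"
  shows "bracket a b \<gamma>"
  unfolding bracket_def bracket_modes_def pos_modes_def neg_modes_def
proof (intro allI impI)
  fix n k :: nat and v assume nk: "n > 0" "k > 0"
  show "a (int n) (b (- int k) v) = b (- int k) (a (int n) v) + (if n = k then \<gamma> n *s v else 0)"
  proof (cases "n = k")
    case True
    then show ?thesis using assms(2)[OF nk(1), of v] by (simp add: algebra_simps)
  next
    case False
    then show ?thesis using assms(1)[of "int n" "- int k" v] nk by simp
  qed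
qed

lemma bracket_eq:
  "bracket a b \<gamma> \<Longrightarrow> n > 0 \<Longrightarrow> a (int n) (b (- int n) v) - b (- int n) (a (int n) v) = \<gamma> n *s v"
  using bracket_modesD[of "pos_modes a" "neg_modes b" \<gamma> n n v]
  by (simp add: bracket_def pos_modes_def neg_modes_def)

lemma bracket_comm: "bracket a b \<gamma> \<Longrightarrow> n > 0 \<Longrightarrow> k > 0 \<Longrightarrow> n \<noteq> k \<Longrightarrow> a (int n) (b (- int k) v) = b (- int k) (a (int n) v)"
  using bracket_modesD[of "pos_modes a" "neg_modes b" \<gamma> n k v]
  by (simp add: bracket_def pos_modes_def neg_modes_def)

lemma bracket_cong:
  "bracket a b \<gamma> \<Longrightarrow> (\<And>n. n > 0 \<Longrightarrow> \<gamma> n = \<delta> n) \<Longrightarrow> bracket a b \<delta>"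
  by (auto simp: bracket_def bracket_modes_def)

lemma bracket_cong_modes:
  assumes "bracket a b \<gamma>" "\<And>n v. n \<noteq> 0 \<Longrightarrow> a' n v = a n v" "\<And>n v. n \<noteq> 0 \<Longrightarrow> b' n v = b n v"
  shows "bracket a' b' \<gamma>"
  using assms(1) by (auto simp: bracket_def bracket_modes_def pos_modes_def neg_modes_def assms(2,3))

lemma bracket_add_left:
  assumes "b \<in> M" "bracket a b \<gamma>" "bracket a' b \<gamma>'"
  shows "bracket (\<lambda>n v. a n v + a' n v) b (\<lambda>n. \<gamma> n + \<gamma>' n)"
  using assms
  by (auto simp: bracket_def bracket_modes_def pos_modes_def neg_modes_def lin_add[OF M_lin] scale_left_distrib)

lemma bracket_add_right:
  assumes "a \<in> M" "bracket a b \<gamma>" "bracket a b' \<gamma>'"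
  shows "bracket a (\<lambda>n v. b n v + b' n v) (\<lambda>n. \<gamma> n + \<gamma>' n)"
  using assms
  by (auto simp: bracket_def bracket_modes_def pos_modes_def neg_modes_def lin_add[OF M_lin] scale_left_distrib)

lemma bracket_scale_left:
  assumes "b \<in> M" "bracket a b \<gamma>"
  shows "bracket (\<lambda>n v. c n *s a n v) b (\<lambda>n. c (int n) * \<gamma> n)"
  using assms
  by (auto simp: bracket_def bracket_modes_def pos_modes_def neg_modes_def lin_scale[OF M_lin] scale_right_distrib)

lemma bracket_scale_right:
  assumes "a \<in> M" "bracket a b \<gamma>"
  shows "bracket a (\<lambda>n v. c n *s b n v) (\<lambda>n. c (- int n) * \<gamma> n)"
  using assms
  by (auto simp: bracket_def bracket_modes_def pos_modes_def neg_modes_def lin_scale[OF M_lin] scale_right_distrib)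

end

section \<open>The module of free fields at generic parameters\<close>

locale akos = free_field_module scale N q1 q2 q3 lam beta
  for scale :: "complex \<Rightarrow> 'v \<Rightarrow> 'v::ab_group_add" (infixr "*s" 75)
    and N :: nat and q1 q2 q3 :: complex and lam beta +
  fixes l1 l2 l3 tau :: complex
  assumes N2: "N \<ge> 2"
    and q_exp: "q1 = exp l1" "q2 = exp l2" "q3 = exp l3"
    and q123: "q1 * q2 * q3 = 1"
    and generic: "\<And>a b :: int. q1 powi a * q2 powi b = 1 \<Longrightarrow> a = 0 \<and> b = 0"
begin

sublocale complex_vector_space scale by unfold_locales

lemma q_nonzero: "q1 \<noteq> 0" "q2 \<noteq> 0" "q3 \<noteq> 0"
  by (simp_all add: q_exp)

lemma q_pow_neq_1:
  assumes "n > 0"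
  shows "q1 ^ n \<noteq> 1" "q2 ^ n \<noteq> 1" "q3 ^ n \<noteq> 1"
proof -
  show "q1 ^ n \<noteq> 1" using generic[of "int n" 0] assms by auto
  show "q2 ^ n \<noteq> 1" using generic[of 0 "int n"] assms by auto
  have "q1 ^ n * q2 ^ n * q3 ^ n = 1" using q123 by (metis power_mult_distrib power_one)
  then show "q3 ^ n \<noteq> 1" using generic[of "int n" "int n"] assms by auto
qed

lemma qpow_add: "qpow l (x + y) = qpow l x * qpow l y"
  by (simp add: qpow_def exp_add distrib_right)

lemma qpow_minus: "qpow l (- x) = inverse (qpow l x)"
  by (simp add: qpow_def exp_minus)

lemma qpow_nonzero: "qpow l x \<noteq> 0"
  by (simp add: qpow_def)

lemma qpow_of_nat: "qpow l3 (of_nat k) = q3 ^ k"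
  by (simp add: qpow_def q_exp exp_of_nat_mult)

text \<open>The coefficients may vary with n, so that rescaling an argument and dividing by
  \<sigma>^n - \<sigma>^-n stay inside the set.\<close>

definition free_modes :: "(int \<Rightarrow> 'v \<Rightarrow> 'v) set"
  where "free_modes = {a. \<exists>c d. \<forall>n. n \<noteq> 0 \<longrightarrow>
    a n = (\<lambda>v. (\<Sum>j=1..N. c j n *s lam j n v) + d n *s beta n v)}"

lemma free_modes_lin:
  assumes "a \<in> free_modes" "n \<noteq> 0"
  shows "lin (a n)"
proof -
  from assms obtain c d where a: "a n = (\<lambda>v. (\<Sum>j=1..N. c j n *s lam j n v) + d n *s beta n v)"
    unfolding free_modes_def by blast
  show ?thesis unfolding a
    by (intro lin_plus lin_sum_op lin_cmult lam_linear beta_linear assms(2))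
qed

lemma free_modes_commute_op:
  assumes a: "a \<in> free_modes" and n: "n \<noteq> 0" and f: "lin f"
    and lam: "\<And>j v. j \<in> {1..N} \<Longrightarrow> f (lam j n v) = lam j n (f v)"
    and beta: "\<And>v. f (beta n v) = beta n (f v)"
  shows "f (a n v) = a n (f v)"
proof -
  from a n obtain c d where a: "a n = (\<lambda>v. (\<Sum>j=1..N. c j n *s lam j n v) + d n *s beta n v)"
    unfolding free_modes_def by blast
  have "(\<Sum>j=1..N. f (c j n *s lam j n v)) = (\<Sum>j=1..N. c j n *s lam j n (f v))"
    by (intro sum.cong refl) (simp add: lin_scale[OF f] lam)
  then show ?thesis unfolding a by (simp add: lin_add[OF f] lin_sum[OF f] lin_scale[OF f] beta)
qed

lemma free_modes_commute:
  assumes a: "a \<in> free_modes" and b: "b \<in> free_modes" and nk: "n * k > 0"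
  shows "a n (b k v) = b k (a n v)"
proof -
  have n: "n \<noteq> 0" "k \<noteq> 0" and s: "n + k \<noteq> 0"
    using nk by (auto simp: zero_less_mult_iff)
  have s': "k + n \<noteq> 0" using s by (simp add: add.commute)
  have l: "a n (lam j k v) = lam j k (a n v)" if j: "j \<in> {1..N}" for j v
    by (rule free_modes_commute_op[OF a n(1) lam_linear[OF j], symmetric])
       (rule lam_comm[OF j _ n(2,1) s'], assumption, rule beta_lam[OF j n(1), symmetric])
  have be: "a n (beta k v) = beta k (a n v)" for v
    by (rule free_modes_commute_op[OF a n(1) beta_linear[OF n(2)], symmetric])
       (rule beta_lam[OF _ n(2)], assumption, rule beta_comm[OF n(2,1) s'])
  show ?thesis
    by (rule free_modes_commute_op[OF b n(2) free_modes_lin[OF a n(1)]]) (rule l, assumption, rule be)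
qed

lemma free_modes_add:
  assumes "a \<in> free_modes" "b \<in> free_modes"
  shows "(\<lambda>n v. a n v + b n v) \<in> free_modes"
proof -
  from assms obtain c d c' d' where
    "\<forall>n. n \<noteq> 0 \<longrightarrow> a n = (\<lambda>v. (\<Sum>j=1..N. c j n *s lam j n v) + d n *s beta n v)"
    "\<forall>n. n \<noteq> 0 \<longrightarrow> b n = (\<lambda>v. (\<Sum>j=1..N. c' j n *s lam j n v) + d' n *s beta n v)"
    unfolding free_modes_def by blast
  then show ?thesis unfolding free_modes_def
    by (intro CollectI exI[of _ "\<lambda>j n. c j n + c' j n"] exI[of _ "\<lambda>n. d n + d' n"])
       (auto simp: fun_eq_iff scale_left_distrib sum.distrib algebra_simps)
qed

lemma free_modes_scale:
  assumes "a \<in> free_modes"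
  shows "(\<lambda>n v. e n *s a n v) \<in> free_modes"
proof -
  from assms obtain c d where
    "\<forall>n. n \<noteq> 0 \<longrightarrow> a n = (\<lambda>v. (\<Sum>j=1..N. c j n *s lam j n v) + d n *s beta n v)"
    unfolding free_modes_def by blast
  then show ?thesis unfolding free_modes_def
    by (intro CollectI exI[of _ "\<lambda>j n. e n * c j n"] exI[of _ "\<lambda>n. e n * d n"])
       (auto simp: fun_eq_iff scale_right_distrib scale_sum_right)
qed

lemma free_modes_lam: "(\<lambda>n v. \<Sum>j=1..J. c j n *s lam j n v) \<in> free_modes" if "J \<le> N"
proof -
  have "(\<Sum>j=1..J. c j n *s lam j n v) = (\<Sum>j=1..N. (if j \<le> J then c j n else 0) *s lam j n v)" for n v
    using that by (intro sum.mono_neutral_cong_left) auto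
  then show ?thesis unfolding free_modes_def
    by (intro CollectI exI[of _ "\<lambda>j n. if j \<le> J then c j n else 0"] exI[of _ "\<lambda>n. 0"]) auto
qed

lemma free_modes_beta: "beta \<in> free_modes"
  unfolding free_modes_def
  by (intro CollectI exI[of _ "\<lambda>j n. 0"] exI[of _ "\<lambda>n. 1"]) auto

lemma free_modes_pos:
  assumes "a \<in> free_modes" "b \<in> free_modes"
  shows "lin_modes (pos_modes a)" "comm_modes (pos_modes a) (pos_modes b)"
  using assms by (auto simp: lin_modes_def comm_modes_def pos_modes_def intro: free_modes_lin free_modes_commute)

text \<open>The hypotheses give nilpotency for each \<open>lam j\<close> and \<open>beta\<close>
  separately, not for linear combinations. The fields are therefore added one at a time, starting
  from \<open>beta\<close>.\<close>

lemma free_modes_finite: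
  assumes "a \<in> free_modes"
  shows "\<exists>B. \<forall>i>B. ecoeff (pos_modes a) i v = 0"
proof -
  from assms obtain c d where
    a: "\<And>n. n \<noteq> 0 \<Longrightarrow> a n = (\<lambda>v. (\<Sum>j=1..N. c j n *s lam j n v) + d n *s beta n v)"
    unfolding free_modes_def by blast
  have K: "\<exists>K. \<forall>n>K. (\<forall>i\<in>{1..N}. lam i (int n) v = 0) \<and> beta (int n) v = 0" for v
  proof -
    obtain K where "\<forall>k>K. (\<forall>i\<in>{1..N}. lam i k v = 0) \<and> beta k v = 0" using smooth by blast
    then show ?thesis by (intro exI[of _ "nat K"]) (auto simp: nat_less_iff)
  qed
  have lam1: "lam j \<in> free_modes" if "j \<in> {1..N}" for j
  proof -
    have "lam j n v = (\<Sum>i=1..N. (if i = j then 1 else 0) *s lam i n v)" for n v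
      using that by (simp add: if_distrib[of "\<lambda>x. x *s _"] cong: if_cong)
    then show ?thesis using free_modes_lam[of N "\<lambda>i n. if i = j then 1 else 0"]
      by (metis (no_types, lifting) ext order_refl)
  qed
  have one: "\<exists>B. \<forall>i>B. ecoeff (\<lambda>n v. e n *s h (int n) v) i v = 0"
    if h: "h \<in> free_modes" and sm: "\<exists>K. \<forall>n>K. h (int n) v = 0" and nil: "\<And>n. n > 0 \<Longrightarrow> \<exists>r. (h (int n) ^^ r) v = 0" for h e v
  proof -
    obtain K where "\<forall>n>K. h (int n) v = 0" using sm by blast
    then show ?thesis
      using exp_coeff_locally_finite[OF free_modes_pos[OF h h], of K v e] nil
      by (simp add: pos_modes_def)
  qed
  have fin: "\<exists>B. \<forall>i>B. ecoeff (\<lambda>n v. (\<Sum>j=1..J. c j (int n) *s lam j (int n) v) + d (int n) *s beta (int n) v) i v = 0"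
    if "J \<le> N" for J v
    using that
  proof (induction J arbitrary: v)
    case 0
    have "\<exists>K. \<forall>n>K. beta (int n) v = 0" using K[of v] by blast
    from one[OF free_modes_beta this] show ?case by (simp add: beta_nilpotent)
  next
    case (Suc J)
    let ?a = "\<lambda>n v. (\<Sum>j=1..J. c j n *s lam j n v) + d n *s beta n v"
    let ?b = "\<lambda>n v. c (Suc J) n *s lam (Suc J) n v"
    have J: "Suc J \<in> {1..N}" "J \<le> N" using Suc by auto
    have ab: "?a \<in> free_modes" "?b \<in> free_modes"
      by (intro free_modes_add free_modes_lam free_modes_scale free_modes_beta lam1 J)+
    have b: "\<exists>B. \<forall>i>B. ecoeff (pos_modes ?b) i v = 0" for v
    proof -
      have "\<exists>K. \<forall>n>K. lam (Suc J) (int n) v = 0" using K[of v] J(1) by blast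
      from one[OF lam1[OF J(1)] this] show ?thesis using J(1) by (simp add: lam_nilpotent pos_modes_def[abs_def])
    qed
    have "\<exists>B. \<forall>i>B. ecoeff (\<lambda>n v. pos_modes ?a n v + pos_modes ?b n v) i v = 0"
    proof (rule exp_coeff_add_finite)
      show "\<exists>B. \<forall>i>B. ecoeff (pos_modes ?a) i v = 0" for v
        using Suc.IH[OF J(2), of v] by (simp add: pos_modes_def[abs_def])
    qed (rule free_modes_pos[OF ab(1) ab(1)] free_modes_pos[OF ab(2) ab(2)] free_modes_pos[OF ab] b)+
    then show ?case by (simp add: pos_modes_def[abs_def] add_ac)
  qed
  have "ecoeff (pos_modes a) i v
    = ecoeff (\<lambda>n v. (\<Sum>j=1..N. c j (int n) *s lam j (int n) v) + d (int n) *s beta (int n) v) i v" for i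
    by (rule exp_coeff_cong) (simp add: pos_modes_def a)
  then show ?thesis using fin[of N v] by simp
qed

sublocale mode_families scale free_modes
  by unfold_locales
     (auto simp: lin_add[OF free_modes_lin] lin_scale[OF free_modes_lin]
       intro: free_modes_commute free_modes_finite free_modes_add free_modes_scale)

text \<open>With \<open>\<lambda>\<^sub>0 = \<lambda>\<^bsub>N+1\<^esub> = 0\<close>, and below \<open>\<Lambda>\<^sub>0 = \<Lambda>\<^bsub>N+1\<^esub> = 1\<close>, the ends of the quiver need no separate treatment.\<close>

definition lamx :: "nat \<Rightarrow> int \<Rightarrow> 'v \<Rightarrow> 'v"
  where "lamx j n v = (if 1 \<le> j \<and> j \<le> N then lam j n v else 0)"

lemma lamx_sum: "lamx i n v = (\<Sum>j=1..N. (if j = i then 1 else 0) *s lam j n v)"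
  by (auto simp: lamx_def if_distrib[of "\<lambda>x. x *s _"] cong: if_cong)

lemma lamx_free_modes: "lamx i \<in> free_modes"
  using free_modes_lam[of N "\<lambda>j n. if j = i then 1 else 0"] unfolding lamx_sum[abs_def] by simp

definition gn :: "nat \<Rightarrow> complex" where "gn n = (1 - q1 ^ n) * (1 - q2 ^ n)"

definition Pn :: "nat \<Rightarrow> complex" where "Pn n = q3 ^ (N * n)"

text \<open>\<open>tln\<close> is \<open>\<theta>\<^sub>i\<^sub>j\<close> for \<open>i < j\<close>; only the differences \<open>1\<close> and \<open>1 - q\<^sub>3\<^sup>n\<close> of the other two values to it matter.\<close>

definition tln :: "nat \<Rightarrow> complex" where "tln n = (1 - q3 ^ n) / (Pn n - 1)"

definition thx :: "nat \<Rightarrow> nat \<Rightarrow> nat \<Rightarrow> complex"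
  where "thx n a b = (if a \<in> {1..N} \<and> b \<in> {1..N} then
    (if a < b then tln n else if a = b then tln n + 1 else tln n + 1 - q3 ^ n) else 0)"

lemma Pn_neq: "n > 0 \<Longrightarrow> Pn n \<noteq> 1" "Pn n \<noteq> 0"
  using q_pow_neq_1(3)[of "N * n"] N2 q_nonzero by (auto simp: Pn_def)

lemma theta_thx:
  assumes "n > 0" "a \<in> {1..N}" "b \<in> {1..N}"
  shows "theta q3 N (int n) a b = thx n a b"
proof -
  have P: "q3 powi (- (int n * int N)) = inverse (Pn n)"
    by (simp add: Pn_def power_int_minus mult.commute flip: of_nat_mult)
  have e: "- (int n * (int N - 1)) = int n + - (int n * int N)" by (simp add: algebra_simps)
  have Pp: "q3 powi (- (int n * (int N - 1))) = q3 ^ n * inverse (Pn n)"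
    unfolding e by (subst power_int_add) (simp_all add: q_nonzero P)
  show ?thesis
    using assms Pn_neq[of n] unfolding theta_def thx_def tln_def
    by (auto simp: P Pp divide_simps) (auto simp: algebra_simps)
qed

lemma bracket_lamx: "bracket (lamx a) (lamx b) (\<lambda>n. - gn n / of_nat n * thx n a b)"
proof (rule bracketI)
  fix n k :: int and v assume "n > 0" "k < 0" "n + k \<noteq> 0"
  then show "lamx a n (lamx b k v) = lamx b k (lamx a n v)"
    using lam_comm[of a b n k v] by (auto simp: lamx_def lin_zero[OF lam_linear])
next
  fix n :: nat and v assume n: "n > 0"
  show "lamx a (int n) (lamx b (- int n) v) - lamx b (- int n) (lamx a (int n) v)
    = (- gn n / of_nat n * thx n a b) *s v"
  proof (cases "a \<in> {1..N} \<and> b \<in> {1..N}")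
    case True
    then show ?thesis using lam_bracket[of a b "int n" v] n theta_thx[OF n, of a b]
      by (simp add: lamx_def gn_def)
  next
    case False
    then have "thx n a b = 0" "(\<forall>m w. lamx a m w = 0) \<or> (\<forall>m w. lamx b m w = 0)"
      unfolding thx_def lamx_def by auto
    moreover have "lamx a m 0 = 0" "lamx b m 0 = 0" if "m \<noteq> 0" for m
      using lin_zero[OF free_modes_lin[OF lamx_free_modes that]] by auto
    ultimately show ?thesis using n by auto
  qed
qed

lemma bracket_beta: "bracket beta beta (\<lambda>n. - gn n / of_nat n * (1 - q3 ^ n) * (1 - Pn n))"
proof (rule bracketI)
  fix n :: nat and v assume n: "n > 0"
  show "beta (int n) (beta (- int n) v) - beta (- int n) (beta (int n) v)
    = (- gn n / of_nat n * (1 - q3 ^ n) * (1 - Pn n)) *s v"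
    using beta_bracket[of "int n" v] n by (simp add: gn_def Pn_def flip: of_nat_mult)
qed (use beta_comm in auto)

lemma bracket_lamx_beta: "bracket (lamx a) beta (\<lambda>n. 0)"
  by (rule bracketI) (auto simp: lamx_def beta_lam lin_zero[OF beta_linear])

lemma bracket_beta_lamx: "bracket beta (lamx a) (\<lambda>n. 0)"
  by (rule bracketI) (auto simp: lamx_def beta_lam lin_zero[OF beta_linear])

text \<open>The exponent of \<Lambda>_a / \<Lambda>_b with a Heisenberg part: the common shape of
  all vertices of the quiver, so that one bracket formula serves for all of them.\<close>

definition comb :: "nat \<Rightarrow> nat \<Rightarrow> (int \<Rightarrow> complex) \<Rightarrow> int \<Rightarrow> 'v \<Rightarrow> 'v"
  where "comb a b d n v = (lamx a n v + (- 1) *s lamx b n v) + d n *s beta n v"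

lemma comb_free_modes: "comb a b d \<in> free_modes"
  unfolding comb_def[abs_def]
  by (intro free_modes_add free_modes_scale lamx_free_modes free_modes_beta)

lemma bracket_comb:
  "bracket (comb a b d) (comb a' b' d')
    (\<lambda>n. - gn n / of_nat n * (thx n a a' - thx n a b' - thx n b a' + thx n b b'
        + d (int n) * d' (- int n) * (1 - q3 ^ n) * (1 - Pn n)))"
proof -
  have 1: "bracket (lamx a) (comb a' b' d') (\<lambda>n. ((- gn n / of_nat n * thx n a a') + (- 1) * (- gn n / of_nat n * thx n a b')) + d' (- int n) * 0)" for a
    unfolding comb_def[abs_def]
    by (intro bracket_add_right bracket_scale_right lamx_free_modes bracket_lamx bracket_lamx_beta)
  have 2: "bracket beta (comb a' b' d') (\<lambda>n. (0 + (- 1) * 0) + d' (- int n) * (- gn n / of_nat n * (1 - q3 ^ n) * (1 - Pn n)))"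
    unfolding comb_def[abs_def]
    by (intro bracket_add_right bracket_scale_right free_modes_beta bracket_beta bracket_beta_lamx)
  have "bracket (comb a b d) (comb a' b' d') (\<lambda>n.
      (((- gn n / of_nat n * thx n a a') + (- 1) * (- gn n / of_nat n * thx n a b')) + d' (- int n) * 0
      + (- 1) * (((- gn n / of_nat n * thx n b a') + (- 1) * (- gn n / of_nat n * thx n b b')) + d' (- int n) * 0))
      + d (int n) * ((0 + (- 1) * 0) + d' (- int n) * (- gn n / of_nat n * (1 - q3 ^ n) * (1 - Pn n))))"
    unfolding comb_def[of a b d, abs_def]
    by (intro bracket_add_left bracket_scale_left comb_free_modes 1 2)
  then show ?thesis
    by (rule bracket_cong) (simp add: algebra_simps add_divide_distrib diff_divide_distrib)
qed

text \<open>The coefficients of \<open>\<beta>\<^sub>n\<close> in \<open>\<Upsilon>\<^sub>1(z)\<close> and \<open>\<Upsilon>\<^bsub>N-1\<^esub>(q\<^sub>3\<^bsup>N/2\<^esup> z)\<close>.\<close>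

definition dU :: "int \<Rightarrow> complex" where "dU n = 1 / (Pn (nat \<bar>n\<bar>) - 1)"

definition dW :: "int \<Rightarrow> complex"
  where "dW n = (if n > 0 then - 1 / (Pn (nat \<bar>n\<bar>) - 1) else - Pn (nat \<bar>n\<bar>) / (Pn (nat \<bar>n\<bar>) - 1))"

definition dx :: "nat \<Rightarrow> int \<Rightarrow> complex"
  where "dx i = (if i = 0 then dU else if i = N then dW else (\<lambda>_. 0))"

definition xs :: "nat \<Rightarrow> int \<Rightarrow> 'v \<Rightarrow> 'v"
  where "xs i = comb (N - i) (Suc N - i) (dx i)"

lemma xs_free_modes: "xs i \<in> free_modes"
  by (simp add: xs_def comb_free_modes)

abbreviation cmat :: "nat \<Rightarrow> nat \<Rightarrow> nat \<Rightarrow> complex" where "cmat n \<equiv> akos_matrix N (gn n) (q3 ^ n)"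

text \<open>The \<lambda>-part is a second difference of \<theta>, which is constant on either side
  of the diagonal; hence it vanishes away from the diagonal and its neighbours. The constant
  \<open>tln\<close> cancels as well, except when i and j are both ends 0 or N, where terms of the
  difference are missing. There the bracket of \<open>beta\<close> makes up for them.\<close>

lemma xs_bracket:
  assumes i: "i \<le> N" and j: "j \<le> N"
  shows "bracket (xs i) (xs j) (\<lambda>n. cmat n i j / of_nat n)"
  unfolding xs_def
proof (rule bracket_cong[OF bracket_comb])
  fix n :: nat assume n: "n > 0"
  have T1: "thx n (N - i) (N - j) = (if i < N \<and> j < N then
      (if j < i then tln n else if i = j then tln n + 1 else tln n + 1 - q3 ^ n) else 0)"
    using i j by (auto simp: thx_def)
  have T2: "thx n (N - i) (Suc N - j) = (if i < N \<and> 0 < j then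
      (if j < Suc i then tln n else if j = Suc i then tln n + 1 else tln n + 1 - q3 ^ n) else 0)"
    using i j by (auto simp: thx_def)
  have T3: "thx n (Suc N - i) (N - j) = (if 0 < i \<and> j < N then
      (if Suc j < i then tln n else if i = Suc j then tln n + 1 else tln n + 1 - q3 ^ n) else 0)"
    using i j by (auto simp: thx_def)
  have T4: "thx n (Suc N - i) (Suc N - j) = (if 0 < i \<and> 0 < j then
      (if j < i then tln n else if i = j then tln n + 1 else tln n + 1 - q3 ^ n) else 0)"
    using i j by (auto simp: thx_def)
  have P: "Pn n - 1 \<noteq> 0" using Pn_neq(1)[OF n] by simp
  \<comment> \<open>The value of \<theta> for i > j is q3^(Nn) times the one for i < j. The same
    factor distinguishes the negative from the positive modes in \<open>dW\<close>, so the
    Heisenberg part fits both mixed corners.\<close>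
  have tP: "tln n * Pn n = tln n + 1 - q3 ^ n" using P by (simp add: tln_def field_simps)
  have E: "dx i (int n) * dx j (- int n) * (1 - q3 ^ n) * (1 - Pn n) =
     (if i = 0 then (if j = 0 then - tln n else if j = N then tln n + 1 - q3 ^ n else 0)
      else if i = N then (if j = 0 then tln n else if j = N then - (tln n + 1 - q3 ^ n) else 0) else 0)"
    unfolding tP[symmetric] using n N2 P by (auto simp: dx_def dU_def dW_def tln_def divide_simps) (auto simp: algebra_simps)
  have "thx n (N - i) (N - j) - thx n (N - i) (Suc N - j) - thx n (Suc N - i) (N - j) + thx n (Suc N - i) (Suc N - j)
        + dx i (int n) * dx j (- int n) * (1 - q3 ^ n) * (1 - Pn n)
    = - akos_matrix N 1 (q3 ^ n) i j"
    unfolding T1 T2 T3 T4 E akos_matrix_def using i j N2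
    by (cases i j rule: linorder_cases) (auto simp: algebra_simps)
  moreover have "cmat n i j = gn n * akos_matrix N 1 (q3 ^ n) i j"
    by (simp add: akos_matrix_def algebra_simps)
  ultimately show "- gn n / of_nat n * (thx n (N - i) (N - j) - thx n (N - i) (Suc N - j) - thx n (Suc N - i) (N - j)
        + thx n (Suc N - i) (Suc N - j) + dx i (int n) * dx j (- int n) * (1 - q3 ^ n) * (1 - Pn n))
      = cmat n i j / of_nat n"
    by (simp only: mult_minus_left mult_minus_right minus_divide_left[symmetric] minus_minus times_divide_eq_left)
qed

lemma quiver_relation_scalar:
  assumes "i \<le> N" "j \<le> N"
  shows "quiver_Cn (akos_quiver N q1 q3) (exp (l2 / 2)) n i j = cmat n i j"
proof -
  have q: "(exp (l2 / 2))\<^sup>2 = q2" by (simp add: q_exp power2_eq_square flip: exp_add)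
  then have qn: "(exp (l2 / 2) ^ n)\<^sup>2 = q2 ^ n" by (metis mult.commute power_mult)
  have "q1 ^ n * (exp (l2 / 2) ^ n)\<^sup>2 * q3 ^ n = 1"
    unfolding qn using q123 by (metis power_mult_distrib power_one)
  with assms N2 show ?thesis
    by (simp add: quiver_Cn_def quiver_pow_akos quiver_C_akos q_nonzero gn_def qn)
qed

section \<open>Zero modes\<close>

definition Ez :: "complex \<Rightarrow> nat \<Rightarrow> 'v \<Rightarrow> 'v"
  where "Ez s j = fun_op scale (\<lambda>\<mu>. exp (s * tau * \<mu>)) (lam j 0)"

lemma lin_Ez: "j \<in> {1..N} \<Longrightarrow> lin (Ez s j)"
  unfolding Ez_def by (rule lin_fun_op[OF lam_zero_diag])

lemma Ez_commute:
  assumes "j \<in> {1..N}" "lin G" "\<And>v. G (lam j 0 v) = lam j 0 (G v)"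
  shows "G (Ez s j v) = Ez s j (G v)"
  unfolding Ez_def by (rule fun_op_commute[OF lam_zero_diag[OF assms(1)], of G]) (fact assms)+

lemma Ez_commutes_M:
  assumes j: "j \<in> {1..N}"
  shows "commutes_M (Ez s j)"
  unfolding commutes_M_def
proof (intro conjI ballI allI impI lin_Ez[OF j])
  fix a n v assume a: "a \<in> free_modes" and n: "n \<noteq> (0 :: int)"
  show "Ez s j (a n v) = a n (Ez s j v)"
  proof (rule free_modes_commute_op[OF a n lin_Ez[OF j]])
    fix i v assume i: "i \<in> {1..N}"
    show "Ez s j (lam i n v) = lam i n (Ez s j v)"
      by (rule Ez_commute[OF j lam_linear[OF i], symmetric]) (rule lam_zero_central[OF j i, symmetric])
  next
    fix v
    show "Ez s j (beta n v) = beta n (Ez s j v)"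
      by (rule Ez_commute[OF j beta_linear[OF n], symmetric]) (rule beta_lam[OF j n])
  qed
qed

lemma Ez_Ez_commute:
  assumes i: "i \<in> {1..N}" and j: "j \<in> {1..N}"
  shows "Ez s i (Ez t j v) = Ez t j (Ez s i v)"
proof (rule Ez_commute[OF j lin_Ez[OF i]])
  fix v
  show "Ez s i (lam j 0 v) = lam j 0 (Ez s i v)"
    by (rule Ez_commute[OF i lam_linear[OF j], symmetric]) (rule lam_zero_central[OF i j, symmetric])
qed

lemma Ez_inverse:
  assumes j: "j \<in> {1..N}" and st: "s + t = 0"
  shows "Ez s j (Ez t j v) = v"
proof -
  have "s * tau * x + t * tau * x = 0" for x
    using st by (metis distrib_right mult_zero_left)
  then have "exp (s * tau * x) * exp (t * tau * x) = 1" for x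
    by (simp flip: exp_add)
  then show ?thesis
    unfolding Ez_def by (simp add: fun_op_mult[OF lam_zero_diag[OF j]] fun_op_one[OF lam_zero_diag[OF j]])
qed

definition zexp :: "nat \<Rightarrow> complex" where "zexp j = of_nat j - (of_nat N + 1) / 2"

definition Lz :: "nat \<Rightarrow> 'v \<Rightarrow> 'v"
  where "Lz j v = (if 1 \<le> j \<and> j \<le> N then qpow l3 (zexp j) *s Ez 1 j v else v)"

definition Lzi :: "nat \<Rightarrow> 'v \<Rightarrow> 'v"
  where "Lzi j v = (if 1 \<le> j \<and> j \<le> N then qpow l3 (- zexp j) *s Ez (- 1) j v else v)"

lemma lin_Lz: "lin (Lz j)" and lin_Lzi: "lin (Lzi j)"
  unfolding Lz_def Lzi_def by (auto intro!: linI simp: lin_add[OF lin_Ez] lin_scale[OF lin_Ez] scale_right_distrib mult.commute)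

lemma commutes_M_Lz: "commutes_M (Lz j)" "commutes_M (Lzi j)"
  using Ez_commutes_M[of j] lin_Lz[of j] lin_Lzi[of j]
  by (auto simp: commutes_M_def Lz_def Lzi_def lin_scale[OF free_modes_lin])

lemma Lz_commute: "Lz i (Lz j v) = Lz j (Lz i v)" "Lz i (Lzi j v) = Lzi j (Lz i v)" "Lzi i (Lzi j v) = Lzi j (Lzi i v)"
  using Ez_Ez_commute[of i j]
  by (auto simp: Lz_def Lzi_def lin_scale[OF lin_Ez] mult.commute)

lemma Lz_Lzi: "Lz j (Lzi j v) = v" "Lzi j (Lz j v) = v"
  using Ez_inverse[of j 1 "-1"] Ez_inverse[of j "-1" 1]
  by (auto simp: Lz_def Lzi_def lin_scale[OF lin_Ez] qpow_minus qpow_nonzero)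

lemma Lz_outside: "\<not> (1 \<le> j \<and> j \<le> N) \<Longrightarrow> Lz j = id" "\<not> (1 \<le> j \<and> j \<le> N) \<Longrightarrow> Lzi j = id"
  by (auto simp: Lz_def Lzi_def fun_eq_iff)

definition Xs :: "nat \<Rightarrow> 'v \<Rightarrow> 'v"
  where "Xs i = Lz (N - i) \<circ> Lzi (Suc N - i)"

lemma commutes_M_Xs: "commutes_M (Xs i)"
  unfolding Xs_def by (intro commutes_M_comp commutes_M_Lz)

lemma Xs_commute: "Xs i (Xs j v) = Xs j (Xs i v)"
  by (simp add: Xs_def Lz_commute)

lemma Xs_inverse: "Xs i (Lz (Suc N - i) (Lzi (N - i) v)) = v" "Lz (Suc N - i) (Lzi (N - i) (Xs i v)) = v"
  by (simp_all add: Xs_def Lz_Lzi Lz_commute(2)[symmetric])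

lemma inv_Xs: "inv (Xs i) = Lz (Suc N - i) \<circ> Lzi (N - i)"
  by (rule inv_unique_comp) (auto simp: fun_eq_iff Xs_inverse)

lemma bij_Xs: "bij (Xs i)"
  by (rule o_bij[of "Lz (Suc N - i) \<circ> Lzi (N - i)"]) (auto simp: fun_eq_iff Xs_inverse)

lemma quiver_relations_akos: "quiver_relations scale (akos_quiver N q1 q3) (exp (l2 / 2)) Xs xs"
proof -
  have v: "verts (akos_quiver N q1 q3) = {0..N}" by (simp add: akos_quiver_def)
  have X: "lin (Xs i) \<and> bij (Xs i)" for i using commutes_M_lin[OF commutes_M_Xs] bij_Xs by blast
  have comm: "xs i n (xs j m v) = xs j m (xs i n v)"
    if "i \<le> N" "j \<le> N" "n \<noteq> 0" "m \<noteq> 0" "n + m \<noteq> 0" for i j n m v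
  proof -
    consider "n * m > 0" | "n > 0" "m < 0" | "n < 0" "m > 0"
      using \<open>n \<noteq> 0\<close> \<open>m \<noteq> 0\<close>
      by (cases n "0 :: int" rule: linorder_cases; cases m "0 :: int" rule: linorder_cases)
         (auto simp: mult_pos_pos mult_neg_neg)
    then show ?thesis
    proof cases
      case 1
      then show ?thesis by (rule free_modes_commute[OF xs_free_modes xs_free_modes])
    next
      case 2
      then show ?thesis using bracket_comm[OF xs_bracket[OF that(1,2)], of "nat n" "nat (- m)"] that(5) by simp
    next
      case 3
      then show ?thesis using bracket_comm[OF xs_bracket[OF that(2,1)], of "nat m" "nat (- n)"] that(5) by simp
    qed
  qed
  show ?thesis unfolding quiver_relations_def v
  proof (intro conjI ballI allI impI)
    fix i j :: nat and w assume "i \<in> {0..N}" "j \<in> {0..N}"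
    then show "Xs i (Xs j w) = exp (l2 / 2) powi (2 * quiver_eps (akos_quiver N q1 q3) i j) *s Xs j (Xs i w)"
      using Xs_commute by (simp add: quiver_eps_akos)
  next
    fix i j :: nat and n :: int and w assume "n \<noteq> 0"
    then show "Xs i (xs j n w) = xs j n (Xs i w)"
      using commutes_M_Xs[of i] xs_free_modes[of j] by (simp add: commutes_M_def)
  next
    fix i j n :: nat and w assume "i \<in> {0..N}" "j \<in> {0..N}" "n > 0"
    then show "xs i (int n) (xs j (- int n) w) - xs j (- int n) (xs i (int n) w)
      = (quiver_Cn (akos_quiver N q1 q3) (exp (l2 / 2)) n i j / of_nat n) *s w"
      using bracket_eq[OF xs_bracket] by (simp add: quiver_relation_scalar)
  qed (use X comm free_modes_lin[OF xs_free_modes] in auto)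
qed

lemma free_field_vops_akos: "free_field_vops scale N tau lam beta {0..N} Xs xs"
proof -
  let ?Z = "gen_alg scale {fun_op scale (\<lambda>\<mu>. exp (c * tau * \<mu>)) (lam j 0) | c j. c \<in> {1, - 1} \<and> j \<in> {1..N}}"
  have E: "Ez s j \<in> ?Z" if "s \<in> {1, - 1}" "j \<in> {1..N}" for s j
    using that unfolding Ez_def by (intro gen_alg.gen) blast
  have L: "Lz j \<in> ?Z" "Lzi j \<in> ?Z" for j
  proof -
    show "Lz j \<in> ?Z"
    proof (cases "1 \<le> j \<and> j \<le> N")
      case True
      then have "Lz j = (\<lambda>v. qpow l3 (zexp j) *s Ez 1 j v)" by (simp add: Lz_def fun_eq_iff)
      then show ?thesis using gen_alg.smult[OF E[of 1 j]] True by simp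
    qed (simp add: Lz_outside gen_alg.one)
    show "Lzi j \<in> ?Z"
    proof (cases "1 \<le> j \<and> j \<le> N")
      case True
      then have "Lzi j = (\<lambda>v. qpow l3 (- zexp j) *s Ez (- 1) j v)" by (simp add: Lzi_def fun_eq_iff)
      then show ?thesis using gen_alg.smult[OF E[of "-1" j]] True by simp
    qed (simp add: Lz_outside gen_alg.one)
  qed
  have "Xs i \<in> ?Z" "inv (Xs i) \<in> ?Z" for i
    unfolding inv_Xs unfolding Xs_def by (intro gen_alg.mult L)+
  moreover have "\<exists>a b. xs i n = (\<lambda>v. (\<Sum>j=1..N. a j *s lam j n v) + b *s beta n v)" for i n
  proof (intro exI ext)
    fix v
    show "xs i n v = (\<Sum>j=1..N. ((if j = N - i then 1 else 0) - (if j = Suc N - i then 1 else 0)) *s lam j n v)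
      + dx i n *s beta n v"
      by (simp add: xs_def comb_def lamx_sum scale_left_diff_distrib sum_subtractf)
  qed
  ultimately show ?thesis by (simp add: free_field_vops_def Let_def)
qed

text \<open>On joint eigenvectors the product of the zero modes of all \<open>\<Lambda>\<^sub>j\<close> is the exponential of \<open>\<tau> \<Sum> \<lambda>\<^bsub>j,0\<^esub> = 0\<close>.\<close>

lemma Lz_prod_except:
  assumes i: "i \<in> {1..N}" and js: "distinct js" "set js = {1..N} - {i}"
  shows "foldr (\<circ>) (map Lz js) id v = Lzi i v"
proof (rule eq_on_spanning_set[where F = "foldr (\<circ>) (map Lz js) id" and G = "Lzi i"])
  show "lin (foldr (\<circ>) (map Lz js) id)"
  proof (induction js)
    case (Cons j js)
    from lin_comp[OF lin_Lz this] show ?case by (simp add: comp_def)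
  qed (simp add: lin_id)
  show "lin (Lzi i)" by (rule lin_Lzi)
  show "v \<in> span {u. \<forall>j\<in>{1..N}. \<exists>\<mu>. lam j 0 u = \<mu> *s u}"
    by (rule joint_eigenvectors_span[where D = "\<lambda>j. lam j 0"]) (auto intro: lam_zero_diag lam_zero_central)
  fix u assume "u \<in> {u. \<forall>j\<in>{1..N}. \<exists>\<mu>. lam j 0 u = \<mu> *s u}"
  then have "\<forall>j\<in>{1..N}. \<exists>\<mu>. lam j 0 u = \<mu> *s u" by simp
  then obtain \<mu> where \<mu>: "\<forall>j\<in>{1..N}. lam j 0 u = \<mu> j *s u" by (rule bchoice[THEN exE])
  define z where "z j = exp (zexp j * l3 + tau * \<mu> j)" for j
  have E: "Ez s j u = exp (s * tau * \<mu> j) *s u" if "j \<in> {1..N}" for s j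
    unfolding Ez_def using \<mu> that by (intro fun_op_eigen lam_zero_diag) auto
  have Lz: "Lz j u = z j *s u" if "j \<in> {1..N}" for j
    using that E[OF that, of 1] by (simp add: Lz_def z_def qpow_def exp_add)
  have Lzi: "Lzi i u = inverse (z i) *s u"
    using i E[OF i, of "-1"] by (simp add: Lzi_def z_def qpow_def flip: exp_add exp_minus)
  have fold: "foldr (\<circ>) (map Lz js) id u = prod_list (map z js) *s u" if "set js \<subseteq> {1..N}" for js
    using that by (induction js) (auto simp: lin_scale[OF lin_Lz] Lz mult.commute)
  have p: "prod_list (map z js) = (\<Prod>j\<in>{1..N} - {i}. z j)"
    using js by (simp add: prod.distinct_set_conv_list[symmetric])
  show "foldr (\<circ>) (map Lz js) id u = Lzi i u"
  \<comment> \<open>Only a nonzero u forces the sum of its eigenvalues to vanish.\<close>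
  proof (cases "u = 0")
    case True
    then show ?thesis using fold[of js] js Lzi by auto
  next
    case False
    have "(\<Sum>j=1..N. \<mu> j) *s u = (\<Sum>j=1..N. lam j 0 u)"
      unfolding scale_sum_left using \<mu> by (intro sum.cong refl) auto
    also have "\<dots> = 0" using lam_relation[of 0 u] by simp
    finally have s0: "(\<Sum>j=1..N. \<mu> j) = 0" using False by simp
    \<comment> \<open>The exponents j - (N+1)/2 of q3 are centred at 0, so the scalar prefactors of
      the \<Lambda>_j multiply to 1 too.\<close>
    have "2 * (\<Sum>j=1..N. complex_of_nat j) = of_nat N * (of_nat N + 1)"
      using double_gauss_sum_from_Suc_0[of N, where 'a = complex] by simp
    moreover have "2 * (\<Sum>j=1..N. zexp j) = 2 * (\<Sum>j=1..N. complex_of_nat j) - of_nat N * (of_nat N + 1)"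
      by (simp add: zexp_def sum_subtractf right_diff_distrib)
    ultimately have "(\<Sum>j=1..N. zexp j) = 0" by simp
    then have "(\<Prod>j=1..N. z j) = 1"
      using s0 by (simp add: z_def exp_sum[symmetric] sum.distrib sum_distrib_right[symmetric] sum_distrib_left[symmetric])
    then have "z i * (\<Prod>j\<in>{1..N} - {i}. z j) = 1" using i by (simp add: prod.remove)
    then have "(\<Prod>j\<in>{1..N} - {i}. z j) = inverse (z i)" by (rule inverse_unique[symmetric])
    then show ?thesis using fold[of js] js Lzi p by auto
  qed
qed

end

section \<open>Products of currents without contraction\<close>

lemma Sum_any_sum_swap:
  assumes "finite I" "\<And>i. i \<in> I \<Longrightarrow> finite {b. g i b \<noteq> 0}"
  shows "Sum_any (\<lambda>b. \<Sum>i\<in>I. g i b) = (\<Sum>i\<in>I. Sum_any (g i))"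
  using assms
proof (induction I rule: finite_induct)
  case (insert i I)
  have "finite {b. (\<Sum>i\<in>I. g i b) \<noteq> 0}"
  proof (rule finite_subset)
    show "{b. (\<Sum>i\<in>I. g i b) \<noteq> 0} \<subseteq> (\<Union>i\<in>I. {b. g i b \<noteq> 0})"
      by (auto elim: sum.not_neutral_contains_not_neutral)
    show "finite (\<Union>i\<in>I. {b. g i b \<noteq> 0})" using insert by auto
  qed
  then show ?case using insert by (simp add: Sum_any.distrib)
qed simp

context complex_vector_space
begin

lemma scale_Sum_any:
  assumes "k \<noteq> 0"
  shows "k *s Sum_any f = Sum_any (\<lambda>i. k *s f i)"
  using assms by (simp add: Sum_any.expand_set scale_sum_right)

lemma cur_arg_cur_mult:
  assumes "c \<noteq> 0" "\<And>m. lin (F m)"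
  shows "cur_arg scale c (cur_mult F G) = cur_mult (cur_arg scale c F) (cur_arg scale c G)"
proof (intro ext)
  fix m v
  have "c powi m = c powi (m - b) * c powi b" for b
    using assms(1) by (simp flip: power_int_add)
  then show "cur_arg scale c (cur_mult F G) m v = cur_mult (cur_arg scale c F) (cur_arg scale c G) m v"
    using assms(1) by (simp add: cur_arg_def cur_mult_def scale_Sum_any lin_scale[OF assms(2)])
qed

lemma cur_arg_cur_arg: "cur_arg scale c (cur_arg scale d F) = cur_arg scale (c * d) F"
  by (simp add: cur_arg_def fun_eq_iff power_int_mult_distrib)

lemma cur_arg_sum: "cur_arg scale c (\<lambda>m v. \<Sum>i\<in>I. F i m v) = (\<lambda>m v. \<Sum>i\<in>I. cur_arg scale c (F i) m v)"
  by (simp add: cur_arg_def fun_eq_iff scale_sum_right)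

lemma snd_nord_snoc: "snd (nord (Vs @ [V])) n v = snd (nord Vs) n v + snd V n v"
  by (simp add: nord_def)

lemma fst_nord_snoc: "fst (nord (Vs @ [V :: 'v vop])) = fst (nord Vs) \<circ> fst V"
proof -
  have *: "foldr (\<circ>) fs g = foldr (\<circ>) fs id \<circ> g" for fs and g :: "'v \<Rightarrow> 'v"
    by (induction fs) (auto simp: fun_eq_iff)
  show ?thesis by (simp add: nord_def) (rule *)
qed

end

context mode_families
begin

lemma bracket_zero_nord:
  assumes a: "a \<in> M" and Vs: "\<And>V. V \<in> set Vs \<Longrightarrow> bracket a (snd V) (\<lambda>n. 0)"
  shows "bracket a (snd (nord Vs)) (\<lambda>n. 0)"
  using Vs
proof (induction Vs)
  case Nil
  show ?case using M_lin[OF a] by (intro bracketI) (auto simp: nord_def lin_zero)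
next
  case (Cons V Vs)
  have "bracket a (\<lambda>n v. snd V n v + snd (nord Vs) n v) (\<lambda>n. 0 + 0)"
    by (rule bracket_add_right[OF a]) (use Cons in auto)
  then show ?case by (simp add: nord_def)
qed

lemma cur_mult_vop_sum:
  assumes V: "vop_M V" and I: "finite I" and W: "\<And>i. i \<in> I \<Longrightarrow> vop_M (W i)"
    and br: "\<And>i. i \<in> I \<Longrightarrow> bracket (snd V) (snd (W i)) (\<lambda>n. 0)"
  shows "cur_mult (vcur V) (\<lambda>m v. \<Sum>i\<in>I. vcur (W i) m v)
    = (\<lambda>m v. \<Sum>i\<in>I. vcur (nord [V, W i]) m v)"
proof (intro ext)
  fix m v
  have fin: "finite {b. vcur V (m - b) (vcur (W i) b v) \<noteq> 0}" if i: "i \<in> I" for i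
  proof -
    have "finite {r. nord_modes V (W i) (m + r) (0 - r) v \<noteq> 0}"
      by (rule nord_modes_antidiagonal_finite[OF V W[OF i]])
    then have "finite (uminus -` {r. nord_modes V (W i) (m + r) (0 - r) v \<noteq> 0})"
      by (rule finite_vimageI) simp
    then show ?thesis
      by (rule rev_finite_subset)
         (auto simp: vop_current_product_no_contraction[OF V W[OF i] br[OF i, unfolded bracket_def]])
  qed
  have "cur_mult (vcur V) (\<lambda>m v. \<Sum>i\<in>I. vcur (W i) m v) m v
    = (\<Sum>i\<in>I. cur_mult (vcur V) (vcur (W i)) m v)"
    by (simp add: cur_mult_def lin_sum[OF lin_vop_current[OF V]] Sum_any_sum_swap[OF I fin])
  also have "\<dots> = (\<Sum>i\<in>I. vcur (nord [V, W i]) m v)"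
    by (intro sum.cong refl) (simp add: cur_mult_vop_current[OF V W br[unfolded bracket_def]])
  finally show "cur_mult (vcur V) (\<lambda>m v. \<Sum>i\<in>I. vcur (W i) m v) m v
    = (\<Sum>i\<in>I. vcur (nord [V, W i]) m v)" .
qed

end

context akos
begin

section \<open>Partial products along the paths\<close>

abbreviation Zs :: "nat \<Rightarrow> 'v vop" where "Zs \<equiv> \<lambda>j. (Xs j, xs j)"

text \<open>The partial product of a path visiting \<open>s i\<close> at the argument
  \<open>c i\<close>. With both sequences as parameters, the two paths share one analysis of the
  screening charges.\<close>

definition Tv :: "(nat \<Rightarrow> complex) \<Rightarrow> (nat \<Rightarrow> nat) \<Rightarrow> nat \<Rightarrow> 'v vop"
  where "Tv c s j = nord (map (\<lambda>i. varg (c i) (Zs (s i))) [0..<Suc j])"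

abbreviation Tplus :: "nat \<Rightarrow> 'v vop" where "Tplus \<equiv> Tv (\<lambda>_. 1) (\<lambda>i. i)"

abbreviation Tminus :: "nat \<Rightarrow> 'v vop" where "Tminus \<equiv> Tv (\<lambda>i. q3 ^ i) (\<lambda>i. N - i)"

lemma vop_M_Zs: "vop_M (Zs j)"
  by (simp add: vop_M_def commutes_M_Xs xs_free_modes)

lemma vop_M_Tv: "vop_M (Tv c s j)"
  unfolding Tv_def
proof (rule vop_M_nord_list)
  fix V assume "V \<in> set (map (\<lambda>i. varg (c i) (Zs (s i))) [0..<Suc j])"
  then obtain i where V: "V = varg (c i) (Zs (s i))" unfolding set_map by blast
  show "vop_M V" unfolding V by (rule vop_M_arg[OF vop_M_Zs])
qed simp

lemma fst_Tv_0: "fst (Tv c s 0) = Xs (s 0)"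
  and fst_Tv_Suc: "fst (Tv c s (Suc j)) = fst (Tv c s j) \<circ> Xs (s (Suc j))"
  and snd_Tv_0: "snd (Tv c s 0) n v = c 0 powi (- n) *s xs (s 0) n v"
  and snd_Tv_Suc: "snd (Tv c s (Suc j)) n v = snd (Tv c s j) n v + c (Suc j) powi (- n) *s xs (s (Suc j)) n v"
proof -
  have S: "Tv c s (Suc j) = nord (map (\<lambda>i. varg (c i) (Zs (s i))) [0..<Suc j] @ [varg (c (Suc j)) (Zs (s (Suc j)))])"
    by (simp add: Tv_def)
  show "fst (Tv c s (Suc j)) = fst (Tv c s j) \<circ> Xs (s (Suc j))"
    by (subst S, subst fst_nord_snoc) (simp add: Tv_def fst_vop_arg del: upt_Suc)
  show "snd (Tv c s (Suc j)) n v = snd (Tv c s j) n v + c (Suc j) powi (- n) *s xs (s (Suc j)) n v"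
    by (subst S, subst snd_nord_snoc) (simp add: Tv_def snd_vop_arg del: upt_Suc)
qed (simp_all add: Tv_def nord_def vop_arg_def)

lemma path_vops_plus:
  "path_vops scale Zs 1 a (map (\<lambda>j. (j, 1, Suc j)) [a..<a + d])
    = map (\<lambda>i. varg 1 (Zs i)) [a..<Suc (a + d)]"
proof (induction d arbitrary: a)
  case (Suc d)
  have "[a..<a + Suc d] = a # [Suc a..<Suc a + d]" "[a..<Suc (a + Suc d)] = a # [Suc a..<Suc (Suc a + d)]"
    by (simp_all add: upt_conv_Cons del: upt_Suc)
  then show ?case using Suc[of "Suc a"] by (simp del: upt_Suc)
qed simp

lemma path_vops_minus:
  "path_vops scale Zs c (N - a) (map (\<lambda>i. (N - i, q3, N - Suc i)) [a..<a + d])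
    = map (\<lambda>i. varg (c * q3 ^ (i - a)) (Zs (N - i))) [a..<Suc (a + d)]"
proof (induction d arbitrary: a c)
  case (Suc d)
  have e: "[a..<a + Suc d] = a # [Suc a..<Suc a + d]" "[a..<Suc (a + Suc d)] = a # [Suc a..<Suc (Suc a + d)]"
    by (simp_all add: upt_conv_Cons del: upt_Suc)
  have "map (\<lambda>i. varg (c * q3 * q3 ^ (i - Suc a)) (Zs (N - i))) [Suc a..<Suc (Suc a + d)]
    = map (\<lambda>i. varg (c * q3 ^ (i - a)) (Zs (N - i))) [Suc a..<Suc (Suc a + d)]"
  proof (rule map_cong[OF refl])
    fix i assume "i \<in> set [Suc a..<Suc (Suc a + d)]"
    then have "i - a = Suc (i - Suc a)" by auto
    then show "varg (c * q3 * q3 ^ (i - Suc a)) (Zs (N - i)) = varg (c * q3 ^ (i - a)) (Zs (N - i))"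
      by (simp add: mult.assoc)
  qed
  then show ?case using Suc[of "c * q3" "Suc a"] unfolding e by (simp del: upt_Suc)
qed simp

lemma path_plus_vop:
  assumes "j \<le> N"
  shows "nord (path_vops scale Zs 1 (fst (path_plus N)) (take j (snd (path_plus N)))) = Tplus j"
proof -
  have "take j (snd (path_plus N)) = map (\<lambda>j. (j, 1, Suc j)) [0..<0 + j]"
    using assms by (simp add: path_plus_def take_map)
  then show ?thesis using path_vops_plus[of 0 j] by (simp add: path_plus_def Tv_def del: upt_Suc)
qed

lemma path_minus_arrows: "snd (path_minus N q3) = map (\<lambda>i. (N - i, q3, N - Suc i)) [0..<N]"
  unfolding path_minus_def by (rule nth_equalityI) (auto simp: rev_nth)

lemma path_minus_vop:
  assumes "j \<le> N"
  shows "nord (path_vops scale Zs 1 (fst (path_minus N q3)) (take j (snd (path_minus N q3))))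
    = Tminus j"
proof -
  have "take j (snd (path_minus N q3)) = map (\<lambda>i. (N - i, q3, N - Suc i)) [0..<0 + j]"
    using assms by (simp add: path_minus_arrows take_map)
  then show ?thesis using path_vops_minus[of 1 0 j] by (simp add: path_minus_def Tv_def del: upt_Suc)
qed

lemma path_Sigma_plus:
  "path_Sigma scale Zs (path_plus N) = (\<lambda>m v. \<Sum>j<N. vcur (Tplus j) m v)"
proof -
  have "length (snd (path_plus N)) = N" by (simp add: path_plus_def)
  then show ?thesis by (intro ext) (simp add: path_Sigma_def path_plus_vop)
qed

lemma path_Sigma_minus:
  "path_Sigma scale Zs (path_minus N q3) = (\<lambda>m v. \<Sum>j<N. vcur (Tminus j) m v)"
proof -
  have "length (snd (path_minus N q3)) = N" by (simp add: path_minus_arrows)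
  then show ?thesis by (intro ext) (simp add: path_Sigma_def path_minus_vop)
qed

lemma path_Psi_plus: "path_Psi scale Zs (path_plus N) = vcur (Tplus N)"
  using path_plus_vop[of N] by (simp add: path_Psi_def path_plus_def)

lemma path_Psi_minus: "path_Psi scale Zs (path_minus N q3) = vcur (Tminus N)"
  using path_minus_vop[of N] by (simp add: path_Psi_def path_minus_arrows)

lemma lamx_ends: "lamx 0 n v = 0" "lamx (Suc N) n v = 0"
  by (simp_all add: lamx_def)

lemma fst_Tv_plus: "j \<le> N \<Longrightarrow> fst (Tplus j) = Lz (N - j)"
proof (induction j)
  case 0
  then show ?case by (simp add: fst_Tv_0 Xs_def Lz_outside)
next
  case (Suc j)
  then have "Suc N - Suc j = N - j" by simp
  with Suc show ?case by (auto simp: fst_Tv_Suc Xs_def fun_eq_iff Lz_commute Lz_Lzi)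
qed

lemma snd_Tv_plus:
  assumes "j \<le> N"
  shows "snd (Tplus j) n v = lamx (N - j) n v + (dU n + (if j = N then dW n else 0)) *s beta n v"
  using assms
proof (induction j)
  case 0
  then show ?case using N2 by (simp add: snd_Tv_0 xs_def comb_def dx_def lamx_ends)
next
  case (Suc j)
  then have "Suc N - Suc j = N - j" "j \<noteq> N" by simp_all
  with Suc show ?case by (auto simp: snd_Tv_Suc xs_def comb_def dx_def scale_left_distrib)
qed

lemma fst_Tv_minus: "j \<le> N \<Longrightarrow> fst (Tminus j) = Lzi (Suc j)"
proof (induction j)
  case 0
  then show ?case by (simp add: fst_Tv_0 Xs_def Lz_outside)
next
  case (Suc j)
  then have "N - (N - Suc j) = Suc j" "Suc N - (N - Suc j) = Suc (Suc j)" by simp_all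
  with Suc show ?case by (auto simp: fst_Tv_Suc Xs_def fun_eq_iff Lz_Lzi)
qed

text \<open>Along this path \<lambda>_i enters twice with different arguments: in X_(N-i) at q3^i,
  and with opposite sign in X_(N-i+1) at q3^(i-1). The sum therefore does not telescope but leaves
  differences of consecutive powers.\<close>

lemma snd_Tv_minus:
  assumes "j \<le> N"
  defines "r \<equiv> \<lambda>n. q3 powi (- n)"
  shows "snd (Tminus j) n v =
    (\<Sum>i=1..j. (r n ^ i - r n ^ (i - 1)) *s lamx i n v) - r n ^ j *s lamx (Suc j) n v
    + (dW n + (if j = N then r n ^ N * dU n else 0)) *s beta n v"
  using assms(1)
proof (induction j)
  case 0
  then show ?case using N2 by (simp add: snd_Tv_0 xs_def comb_def dx_def lamx_ends)
next
  case (Suc j)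
  then have e: "N - (N - Suc j) = Suc j" "Suc N - (N - Suc j) = Suc (Suc j)" "j \<noteq> N" "N - Suc j \<noteq> N" by simp_all
  have "(q3 ^ Suc j) powi (- n) = r n ^ Suc j"
    unfolding r_def by (metis mult.commute power_int_mult power_int_of_nat)
  with Suc e show ?case
    by (auto simp: snd_Tv_Suc xs_def comb_def dx_def scale_left_distrib scale_right_distrib
        scale_left_diff_distrib scale_right_diff_distrib)
qed

lemma lamx_relation: "(\<Sum>i=1..N. (q3 powi (- n)) ^ i *s lamx i n v) = 0"
proof -
  have "(\<Sum>i=1..N. (q3 powi (- n)) ^ i *s lamx i n v) = (\<Sum>i=1..N. (q3 powi (- int i * n)) *s lam i n v)"
  proof (intro sum.cong refl)
    fix i assume "i \<in> {1..N}"
    moreover have "q3 powi (- int i * n) = q3 powi ((- n) * int i)" by (simp add: mult.commute)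
    ultimately show "(q3 powi (- n)) ^ i *s lamx i n v = (q3 powi (- int i * n)) *s lam i n v"
      by (simp only: power_int_mult power_int_of_nat) (simp add: lamx_def)
  qed
  then show ?thesis using lam_relation[of n v] by simp
qed

text \<open>Together with the unshifted relation this kills both halves of the sum of differences at
  the end of the backward path, so that only Heisenberg modes survive there.\<close>

lemma lamx_relation_shifted: "(\<Sum>i=1..N. (q3 powi (- n)) ^ (i - 1) *s lamx i n v) = 0"
proof -
  let ?r = "q3 powi (- n)"
  have "?r *s (\<Sum>i=1..N. ?r ^ (i - 1) *s lamx i n v) = (\<Sum>i=1..N. ?r ^ i *s lamx i n v)"
    unfolding scale_sum_right by (intro sum.cong refl) (auto simp flip: power_Suc)
  then show ?thesis using lamx_relation[of n v] q_nonzero by simp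
qed

section \<open>The currents of the W-algebra\<close>

definition Lam :: "nat \<Rightarrow> 'v vop" where "Lam i = Lambda scale N l3 tau lam i"

definition Lam_list :: "nat list \<Rightarrow> 'v vop"
  where "Lam_list js = nord (map (\<lambda>s. varg (qpow l3 (of_nat s)) (Lam (js ! s))) [0..<length js])"

lemma fst_Lam: "i \<in> {1..N} \<Longrightarrow> fst (Lam i) = Lz i"
  by (auto simp: Lam_def Lambda_def Lz_def Ez_def zexp_def fun_eq_iff)

lemma snd_Lam: "i \<in> {1..N} \<Longrightarrow> snd (Lam i) = lamx i"
  by (auto simp: Lam_def Lambda_def lamx_def fun_eq_iff)

lemma vop_M_Lam: "i \<in> {1..N} \<Longrightarrow> vop_M (Lam i)"
  by (simp add: vop_M_def fst_Lam snd_Lam commutes_M_Lz lamx_free_modes)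

lemma vop_M_Lam_list:
  assumes "js \<noteq> []" "set js \<subseteq> {1..N}"
  shows "vop_M (Lam_list js)"
  unfolding Lam_list_def
proof (rule vop_M_nord_list)
  fix V assume "V \<in> set (map (\<lambda>s. varg (qpow l3 (of_nat s)) (Lam (js ! s))) [0..<length js])"
  then obtain s where s: "s < length js" and V: "V = varg (qpow l3 (of_nat s)) (Lam (js ! s))"
    by (auto simp del: vop_arg_def)
  have "js ! s \<in> {1..N}" using assms(2) s nth_mem by blast
  then show "vop_M V" unfolding V by (intro vop_M_arg vop_M_Lam)
qed (use assms in simp)

lemma fst_Lam_list:
  assumes "set js \<subseteq> {1..N}"
  shows "fst (Lam_list js) = foldr (\<circ>) (map Lz js) id"
proof -
  have "map (\<lambda>s. fst (varg (qpow l3 (of_nat s)) (Lam (js ! s)))) [0..<length js] = map Lz js"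
    using assms by (intro nth_equalityI) (auto simp: fst_vop_arg fst_Lam[OF subsetD[OF assms nth_mem]])
  then show ?thesis by (simp add: Lam_list_def nord_def comp_def)
qed

lemma snd_Lam_list:
  assumes "set js \<subseteq> {1..N}"
  shows "snd (Lam_list js) n v = (\<Sum>s<length js. (q3 powi (- n)) ^ s *s lamx (js ! s) n v)"
proof -
  have "(qpow l3 (of_nat s)) powi (- n) = (q3 powi (- n)) ^ s" for s
    unfolding qpow_of_nat by (metis mult.commute power_int_mult power_int_of_nat)
  then have "snd (Lam_list js) n v = (\<Sum>s\<leftarrow>[0..<length js]. (q3 powi (- n)) ^ s *s snd (Lam (js ! s)) n v)"
    by (simp add: Lam_list_def snd_nord snd_vop_arg comp_def)
  also have "\<dots> = (\<Sum>s<length js. (q3 powi (- n)) ^ s *s snd (Lam (js ! s)) n v)"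
    by (simp add: interv_sum_list_conv_sum_set_nat atLeast0LessThan)
  also have "\<dots> = (\<Sum>s<length js. (q3 powi (- n)) ^ s *s lamx (js ! s) n v)"
    using assms by (intro sum.cong refl) (auto simp: snd_Lam[OF subsetD[OF assms nth_mem]])
  finally show ?thesis .
qed

lemma bracket_beta_Lam_list:
  assumes "set js \<subseteq> {1..N}"
  shows "bracket (\<lambda>n v. e n *s beta n v) (snd (Lam_list js)) (\<lambda>n. 0)"
  unfolding Lam_list_def
proof (rule bracket_zero_nord)
  show M: "(\<lambda>n v. e n *s beta n v) \<in> free_modes" by (intro free_modes_scale free_modes_beta)
  fix V assume "V \<in> set (map (\<lambda>s. varg (qpow l3 (of_nat s)) (Lam (js ! s))) [0..<length js])"
  then obtain s where s: "s < length js" and V: "V = varg (qpow l3 (of_nat s)) (Lam (js ! s))"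
    by auto
  have js: "js ! s \<in> {1..N}" using assms s nth_mem by blast
  have "bracket (\<lambda>n v. e n *s beta n v) (\<lambda>n v. (qpow l3 (of_nat s) powi (- n)) *s lamx (js ! s) n v)
      (\<lambda>n. e (int n) * ((qpow l3 (of_nat s) powi (- (- int n))) * 0))"
    by (intro bracket_scale_left bracket_scale_right free_modes_beta free_modes_scale lamx_free_modes bracket_beta_lamx)
  then show "bracket (\<lambda>n v. e n *s beta n v) (snd V) (\<lambda>n. 0)"
    by (simp add: V vop_arg_def snd_Lam[OF js])
qed

section \<open>The Heisenberg currents\<close>

definition U1 :: "'v vop" where "U1 = Upsilon_first scale N l3 beta"

definition UN1 :: "'v vop"
  where "UN1 = varg (qpow l3 (of_nat N / 2)) (Upsilon_last scale N l3 beta)"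

text \<open>With h = q3^(N|n|/2) one has h^2 = \<open>Pn\<close>, so expanding the fractions by h
  removes half-integral powers. The rescaling by q3^(N/2) contributes 1/h for n > 0 and h for n < 0,
  whence the two cases of \<open>dW\<close>.\<close>

lemma Upsilon_exponents:
  defines "h \<equiv> \<lambda>n. qpow l3 (of_nat N * of_int \<bar>n\<bar> / 2)"
  assumes n: "n \<noteq> 0"
  shows "inverse (h n) / (h n - inverse (h n)) = dU n"
    and "qpow l3 (of_nat N / 2) powi (- n) * (- 1 / (h n - inverse (h n))) = dW n"
proof -
  have hh: "h n * h n = Pn (nat \<bar>n\<bar>)"
  proof -
    have "h n * h n = qpow l3 (of_nat (N * nat \<bar>n\<bar>))"
      unfolding h_def qpow_add[symmetric] by (simp add: field_simps)
    then show ?thesis by (simp only: qpow_of_nat Pn_def)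
  qed
  have P: "Pn (nat \<bar>n\<bar>) \<noteq> 1" using n by (intro Pn_neq) simp
  have h0: "h n \<noteq> 0" by (simp add: h_def qpow_nonzero)
  have d: "h n - inverse (h n) = (Pn (nat \<bar>n\<bar>) - 1) / h n" using h0 by (simp add: field_simps flip: hh)
  show "inverse (h n) / (h n - inverse (h n)) = dU n"
    unfolding d dU_def using h0 P by (simp add: field_simps)
  have pw: "qpow l3 (of_nat N / 2) powi (- n) = (if n > 0 then inverse (h n) else h n)"
  proof -
    have e: "qpow l3 (of_nat N / 2) ^ k = qpow l3 (of_nat N * of_nat k / 2)" for k
      by (simp add: qpow_def exp_of_nat_mult[symmetric] field_simps)
    show ?thesis
      using n by (auto simp: power_int_def e h_def power_inverse)
  qed
  show "qpow l3 (of_nat N / 2) powi (- n) * (- 1 / (h n - inverse (h n))) = dW n"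
    unfolding d dW_def pw using h0 P n by (auto simp: field_simps hh)
qed

lemma fst_Upsilon: "fst U1 = id" "fst UN1 = id"
  by (simp_all add: U1_def UN1_def Upsilon_first_def Upsilon_last_def fst_vop_arg)

lemma snd_Upsilon:
  assumes "n \<noteq> 0"
  shows "snd U1 n v = dU n *s beta n v" "snd UN1 n v = dW n *s beta n v"
  using Upsilon_exponents[OF assms]
  by (simp_all add: U1_def UN1_def Upsilon_first_def Upsilon_last_def snd_vop_arg Let_def qpow_minus
      del: scale_minus_left)

text \<open>The \<open>0\<close>-th entry of a mode family is junk, so membership of \<open>free_modes\<close> only concerns the others.\<close>

lemma free_modes_cong: "a \<in> free_modes \<Longrightarrow> (\<And>n v. n \<noteq> 0 \<Longrightarrow> b n v = a n v) \<Longrightarrow> b \<in> free_modes"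
  by (fastforce simp: free_modes_def fun_eq_iff)

lemma vop_M_Upsilon: "vop_M U1" "vop_M UN1"
  using free_modes_cong[OF free_modes_scale[OF free_modes_beta, of dU], of "snd U1"]
    free_modes_cong[OF free_modes_scale[OF free_modes_beta, of dW], of "snd UN1"]
  by (simp_all add: vop_M_def fst_Upsilon commutes_M_id snd_Upsilon)

lemma bracket_Upsilon_Lam_list:
  assumes "set js \<subseteq> {1..N}"
  shows "bracket (snd U1) (snd (Lam_list js)) (\<lambda>n. 0)" "bracket (snd UN1) (snd (Lam_list js)) (\<lambda>n. 0)"
  using bracket_cong_modes[OF bracket_beta_Lam_list[OF assms, of dU], of "snd U1" "snd (Lam_list js)"]
    bracket_cong_modes[OF bracket_beta_Lam_list[OF assms, of dW], of "snd UN1" "snd (Lam_list js)"]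
  by (simp_all add: snd_Upsilon)

lemma W_shifted_Lam_list:
  "W_shifted scale N l3 tau lam i m v
    = (\<Sum>J | J \<subseteq> {1..N} \<and> card J = i. vcur (Lam_list (sorted_list_of_set J)) m v)"
  unfolding W_shifted_def Lam_list_def Lam_def
  by (intro sum.cong refl) (auto simp: length_sorted_list_of_set)

lemma W_shifted_first:
  "W_shifted scale N l3 tau lam 1 = (\<lambda>m v. \<Sum>i\<in>{1..N}. vcur (Lam_list [i]) m v)"
proof (intro ext)
  fix m v
  have "{J. J \<subseteq> {1..N} \<and> card J = 1} = (\<lambda>i. {i}) ` {1..N}"
    by (auto simp: card_1_singleton_iff)
  then show "W_shifted scale N l3 tau lam 1 m v = (\<Sum>i\<in>{1..N}. vcur (Lam_list [i]) m v)"
    unfolding W_shifted_Lam_list by (simp add: sum.reindex)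
qed

definition omit :: "nat \<Rightarrow> nat list" where "omit i = [1..<i] @ [Suc i..<Suc N]"

lemma omit:
  assumes "i \<in> {1..N}"
  shows "set (omit i) = {1..N} - {i}" "distinct (omit i)" "length (omit i) = N - 1" "omit i \<noteq> []"
    "sorted_list_of_set ({1..N} - {i}) = omit i"
proof -
  show s: "set (omit i) = {1..N} - {i}" and d: "distinct (omit i)" and l: "length (omit i) = N - 1"
    using assms by (auto simp: omit_def simp del: upt_Suc)
  show "omit i \<noteq> []" using l N2 by auto
  have "sorted (omit i)" using assms by (auto simp: omit_def sorted_append simp del: upt_Suc)
  then show "sorted_list_of_set ({1..N} - {i}) = omit i"
    using s d by (metis sorted_list_of_set.idem_if_sorted_distinct)
qed

lemma W_shifted_last:
  "W_shifted scale N l3 tau lam (N - 1) = (\<lambda>m v. \<Sum>i\<in>{1..N}. vcur (Lam_list (omit i)) m v)"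
proof (intro ext)
  fix m v
  have "{J. J \<subseteq> {1..N} \<and> card J = N - 1} = (\<lambda>i. {1..N} - {i}) ` {1..N}"
  proof (intro equalityI subsetI)
    fix J assume "J \<in> {J. J \<subseteq> {1..N} \<and> card J = N - 1}"
    then have J: "J \<subseteq> {1..N}" "card J = N - 1" by auto
    then have "card ({1..N} - J) = 1" using N2 by (simp add: card_Diff_subset finite_subset)
    then obtain i where "{1..N} - J = {i}" by (auto simp: card_1_singleton_iff)
    then have "i \<in> {1..N}" "J = {1..N} - {i}" using J(1) by auto
    then show "J \<in> (\<lambda>i. {1..N} - {i}) ` {1..N}" by blast
  qed auto
  moreover have "inj_on (\<lambda>i. {1..N} - {i}) {1..N}" by (auto simp: inj_on_def)
  ultimately have "W_shifted scale N l3 tau lam (N - 1) m v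
      = (\<Sum>i\<in>{1..N}. vcur (Lam_list (sorted_list_of_set ({1..N} - {i}))) m v)"
    unfolding W_shifted_Lam_list by (simp add: sum.reindex)
  also have "\<dots> = (\<Sum>i\<in>{1..N}. vcur (Lam_list (omit i)) m v)"
    by (intro sum.cong refl) (simp only: omit(5))
  finally show "W_shifted scale N l3 tau lam (N - 1) m v
      = (\<Sum>i\<in>{1..N}. vcur (Lam_list (omit i)) m v)" .
qed

lemma snd_nord_pair: "snd (nord [V, W]) n v = snd V n v + snd W n v"
  and fst_nord_pair: "fst (nord [V, W]) = fst V \<circ> fst W"
  by (simp_all add: nord_def)

lemma Wbar_first_eq: "Wbar_first scale N l3 tau lam beta = path_Sigma scale Zs (path_plus N)"
proof -
  have W: "W_current scale N l3 tau lam 1 = (\<lambda>m v. \<Sum>i\<in>{1..N}. vcur (Lam_list [i]) m v)"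
    unfolding W_current_def W_shifted_first by (simp add: cur_arg_def qpow_def fun_eq_iff)
  have "Wbar_first scale N l3 tau lam beta
    = (\<lambda>m v. \<Sum>i\<in>{1..N}. vcur (nord [U1, Lam_list [i]]) m v)"
    unfolding Wbar_first_def W U1_def[symmetric]
    by (rule cur_mult_vop_sum) (auto intro: vop_M_Upsilon vop_M_Lam_list bracket_Upsilon_Lam_list)
  also have "\<dots> = (\<lambda>m v. \<Sum>j<N. vcur (nord [U1, Lam_list [N - j]]) m v)"
    by (intro ext sum.reindex_bij_witness[of _ "\<lambda>j. N - j" "\<lambda>j. N - j"]) auto
  also have "\<dots> = (\<lambda>m v. \<Sum>j<N. vcur (Tplus j) m v)"
  proof (intro ext sum.cong refl)
    fix m v j assume "j \<in> {..<N}"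
    then have j: "j < N" "set [N - j] \<subseteq> {1..N}" by auto
    have "vcur (nord [U1, Lam_list [N - j]]) = vcur (Tplus j)"
    proof (rule vop_current_cong)
      show "fst (nord [U1, Lam_list [N - j]]) = fst (Tplus j)"
        unfolding fst_nord_pair fst_Lam_list[OF j(2)] using j by (simp add: fst_Upsilon fst_Tv_plus)
      show "snd (nord [U1, Lam_list [N - j]]) n v = snd (Tplus j) n v" if "n \<noteq> 0" for n v
        unfolding snd_nord_pair snd_Lam_list[OF j(2)] using j that by (simp add: snd_Upsilon snd_Tv_plus)
    qed
    then show "vcur (nord [U1, Lam_list [N - j]]) m v
      = vcur (Tplus j) m v" by simp
  qed
  finally show ?thesis by (simp only: path_Sigma_plus)
qed

lemma Psi_plus_eq: "vcur (nord [U1, UN1]) = path_Psi scale Zs (path_plus N)"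
  unfolding path_Psi_plus
proof (rule vop_current_cong)
  show "fst (nord [U1, UN1]) = fst (Tplus N)"
    unfolding fst_nord_pair by (simp add: fst_Upsilon fst_Tv_plus Lz_outside)
  show "snd (nord [U1, UN1]) n v = snd (Tplus N) n v" if "n \<noteq> 0" for n v
    unfolding snd_nord_pair using that by (simp add: snd_Upsilon snd_Tv_plus lamx_ends scale_left_distrib)
qed

lemma q3_pow_powi: "(q3 ^ k) powi (- n) = (q3 powi (- n)) ^ k"
  by (metis mult.commute power_int_mult power_int_of_nat)

lemma sum_diff_lamx:
  "(\<Sum>i=1..j. (r ^ i - r ^ (i - 1)) *s F i) = (\<Sum>i=1..j. r ^ i *s F i) - (\<Sum>i=1..j. r ^ (i - 1) *s F i)"
  by (simp add: scale_left_diff_distrib sum_subtractf)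

lemma Psi_minus_eq:
  "vcur (nord [varg (qpow l3 (of_nat N)) U1, UN1]) = path_Psi scale Zs (path_minus N q3)"
  unfolding path_Psi_minus
proof (rule vop_current_cong)
  show "fst (nord [varg (qpow l3 (of_nat N)) U1, UN1]) = fst (Tminus N)"
    unfolding fst_nord_pair by (simp add: fst_vop_arg fst_Upsilon fst_Tv_minus Lz_outside)
  show "snd (nord [varg (qpow l3 (of_nat N)) U1, UN1]) n v = snd (Tminus N) n v"
    if "n \<noteq> 0" for n v
    unfolding snd_nord_pair snd_Tv_minus[OF order_refl] sum_diff_lamx lamx_relation lamx_relation_shifted
    using that by (simp add: snd_vop_arg snd_Upsilon lamx_ends qpow_of_nat q3_pow_powi scale_left_distrib add.commute)
qed

text \<open>The entry k stands at position k - 1 before the gap and at k - 2 after it.\<close>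

lemma sum_omit:
  assumes i: "i \<in> {1..N}"
  shows "(\<Sum>s<length (omit i). r ^ s *s F (omit i ! s))
    = (\<Sum>k\<in>{1..<i}. r ^ (k - 1) *s F k) + (\<Sum>k\<in>{i<..N}. r ^ (k - 2) *s F k)"
proof -
  have len: "length (omit i) = (i - 1) + (N - i)" using i by (auto simp: omit_def simp del: upt_Suc)
  have "(\<Sum>s<length (omit i). r ^ s *s F (omit i ! s))
    = (\<Sum>s\<in>{..<i - 1}. r ^ s *s F (omit i ! s)) + (\<Sum>s\<in>{i - 1..<(i - 1) + (N - i)}. r ^ s *s F (omit i ! s))"
    unfolding len by (metis (no_types, lifting) atLeast0LessThan le_add1 sum.atLeastLessThan_concat zero_le)
  also have "(\<Sum>s\<in>{..<i - 1}. r ^ s *s F (omit i ! s)) = (\<Sum>k\<in>{1..<i}. r ^ (k - 1) *s F k)"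
    by (rule sum.reindex_bij_witness[of _ "\<lambda>k. k - 1" Suc])
       (auto simp: omit_def nth_append simp del: upt_Suc)
  also have "(\<Sum>s\<in>{i - 1..<(i - 1) + (N - i)}. r ^ s *s F (omit i ! s)) = (\<Sum>k\<in>{i<..N}. r ^ (k - 2) *s F k)"
    by (rule sum.reindex_bij_witness[of _ "\<lambda>k. k - 2" "\<lambda>s. s + 2"])
       (use i in \<open>auto simp: omit_def nth_append simp del: upt_Suc\<close>)
  finally show ?thesis .
qed

text \<open>The factor \<open>r n\<close> rescales the argument by q3, which turns the powers beyond
  the gap into those of the shifted relation. This relation trades them for entries up to i, in the
  form of the partial products of the backward path.\<close>

lemma Lam_list_omit_modes:
  assumes i: "i \<in> {1..N}"
  defines "r \<equiv> \<lambda>n. q3 powi (- n)"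
  shows "r n *s snd (Lam_list (omit i)) n v
    = (\<Sum>k=1..i - 1. (r n ^ k - r n ^ (k - 1)) *s lamx k n v) - r n ^ (i - 1) *s lamx i n v"
proof -
  have "r n *s snd (Lam_list (omit i)) n v
    = r n *s (\<Sum>k\<in>{1..<i}. r n ^ (k - 1) *s lamx k n v) + r n *s (\<Sum>k\<in>{i<..N}. r n ^ (k - 2) *s lamx k n v)"
    using omit(1)[OF i] by (simp add: snd_Lam_list sum_omit[OF i, of "q3 powi (- n)" "\<lambda>k. lamx k n v"] r_def scale_right_distrib)
  also have "r n *s (\<Sum>k\<in>{1..<i}. r n ^ (k - 1) *s lamx k n v) = (\<Sum>k\<in>{1..<i}. r n ^ k *s lamx k n v)"
    unfolding scale_sum_right by (intro sum.cong refl) (auto simp flip: power_Suc)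
  also have "r n *s (\<Sum>k\<in>{i<..N}. r n ^ (k - 2) *s lamx k n v) = (\<Sum>k\<in>{i<..N}. r n ^ (k - 1) *s lamx k n v)"
    unfolding scale_sum_right
  proof (intro sum.cong refl)
    fix k assume "k \<in> {i<..N}"
    then have "k - 1 = Suc (k - 2)" using i by auto
    then show "r n *s r n ^ (k - 2) *s lamx k n v = r n ^ (k - 1) *s lamx k n v" by simp
  qed
  also have "(\<Sum>k\<in>{i<..N}. r n ^ (k - 1) *s lamx k n v)
    = - (\<Sum>k\<in>{1..<i}. r n ^ (k - 1) *s lamx k n v) - r n ^ (i - 1) *s lamx i n v"
  proof -
    have "{1..N} = {1..<i} \<union> ({i} \<union> {i<..N})" using i by auto
    then have "0 = (\<Sum>k\<in>{1..<i} \<union> ({i} \<union> {i<..N}). r n ^ (k - 1) *s lamx k n v)"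
      using lamx_relation_shifted[of n v] by (simp add: r_def)
    also have "\<dots> = (\<Sum>k\<in>{1..<i}. r n ^ (k - 1) *s lamx k n v)
      + (r n ^ (i - 1) *s lamx i n v + (\<Sum>k\<in>{i<..N}. r n ^ (k - 1) *s lamx k n v))"
      by (subst sum.union_disjoint; (subst sum.union_disjoint)?) auto
    finally show ?thesis by (simp add: algebra_simps eq_neg_iff_add_eq_0)
  qed
  also have "{1..<i} = {1..i - 1}" using i by auto
  finally show ?thesis unfolding sum_diff_lamx by (simp only: diff_conv_add_uminus add.assoc minus_add_distrib)
qed

lemma Wbar_last_eq:
  "cur_arg scale (qpow l3 (of_nat N / 2)) (Wbar_last scale N l3 tau lam beta)
    = path_Sigma scale Zs (path_minus N q3)"
proof -
  let ?h = "qpow l3 (of_nat N / 2)"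
  have U: "vop_M (Upsilon_last scale N l3 beta)"
  proof -
    have "snd (Upsilon_last scale N l3 beta) = (\<lambda>n v. (- 1 / (qpow l3 (of_nat N * of_int \<bar>n\<bar> / 2)
        - qpow l3 (- (of_nat N * of_int \<bar>n\<bar> / 2)))) *s beta n v)"
      by (simp add: Upsilon_last_def Let_def)
    then show ?thesis
      unfolding vop_M_def
      by (simp only: free_modes_scale[OF free_modes_beta]) (simp add: Upsilon_last_def commutes_M_id)
  qed
  \<comment> \<open>The definition of W_(N-1) carries the shift q3^((N-2)/2); against q3^(N/2) one
    factor q3 remains. It is to be expected: by W_N = 1 the inverse of \<Lambda>_1(z) is the product
    \<Lambda>_2(q3 z) \<Lambda>_3(q3^2 z) ..., which starts at q3 z.\<close>
  have hq: "?h * qpow l3 (- (of_nat (N - 1) - 1) / 2) = q3"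
  proof -
    have "complex_of_nat N / 2 + - (of_nat (N - 1) - 1) / 2 = of_nat 1"
      using N2 by (simp add: of_nat_diff field_simps)
    then show ?thesis using qpow_of_nat[of 1] by (simp flip: qpow_add)
  qed
  have Ls: "set (omit i) \<subseteq> {1..N}" if "i \<in> {1..N}" for i
    unfolding omit(1)[OF that] by blast
  have L: "vop_M (Lam_list (omit i))" if "i \<in> {1..N}" for i
    by (rule vop_M_Lam_list[OF omit(4)[OF that] Ls[OF that]])
  have "cur_arg scale ?h (Wbar_last scale N l3 tau lam beta)
    = cur_mult (vcur UN1) (cur_arg scale q3 (W_shifted scale N l3 tau lam (N - 1)))"
    unfolding Wbar_last_def
    by (simp only: cur_arg_cur_mult[OF qpow_nonzero lin_vop_current[OF U]] W_current_def cur_arg_cur_arg hq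
        UN1_def vop_current_arg[OF U qpow_nonzero])
  also have "cur_arg scale q3 (W_shifted scale N l3 tau lam (N - 1))
    = (\<lambda>m v. \<Sum>i\<in>{1..N}. vcur (varg q3 (Lam_list (omit i))) m v)"
    unfolding W_shifted_last cur_arg_sum
    by (intro ext sum.cong refl) (simp add: vop_current_arg[OF L q_nonzero(3)])
  also have "cur_mult (vcur UN1) \<dots>
    = (\<lambda>m v. \<Sum>i\<in>{1..N}. vcur (nord [UN1, varg q3 (Lam_list (omit i))]) m v)"
  proof (rule cur_mult_vop_sum)
    fix i assume i: "i \<in> {1..N}"
    show "vop_M (varg q3 (Lam_list (omit i)))" by (rule vop_M_arg[OF L[OF i]])
    have "bracket (snd UN1) (\<lambda>n v. (q3 powi (- n)) *s snd (Lam_list (omit i)) n v) (\<lambda>n. (q3 powi (- (- int n))) * 0)"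
      by (rule bracket_scale_right[OF _ bracket_Upsilon_Lam_list(2)[OF Ls[OF i]]])
         (use vop_M_Upsilon in \<open>simp add: vop_M_def\<close>)
    then show "bracket (snd UN1) (snd (varg q3 (Lam_list (omit i)))) (\<lambda>n. 0)"
      by (simp add: vop_arg_def)
  qed (simp_all add: vop_M_Upsilon)
  also have "\<dots> = (\<lambda>m v. \<Sum>j<N. vcur (nord [UN1, varg q3 (Lam_list (omit (Suc j)))]) m v)"
    by (intro ext sum.reindex_bij_witness[of _ Suc "\<lambda>j. j - 1"]) auto
  also have "\<dots> = (\<lambda>m v. \<Sum>j<N. vcur (Tminus j) m v)"
  proof (intro ext sum.cong refl)
    fix m v j assume "j \<in> {..<N}"
    then have j: "j < N" "Suc j \<in> {1..N}" by auto
    have "vcur (nord [UN1, varg q3 (Lam_list (omit (Suc j)))])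
      = vcur (Tminus j)"
    proof (rule vop_current_cong)
      have "fst (Lam_list (omit (Suc j))) = Lzi (Suc j)"
        unfolding fst_Lam_list[OF Ls[OF j(2)]]
        by (intro ext Lz_prod_except[OF j(2) omit(2)[OF j(2)] omit(1)[OF j(2)]])
      then show "fst (nord [UN1, varg q3 (Lam_list (omit (Suc j)))])
          = fst (Tminus j)"
        unfolding fst_nord_pair using j by (simp add: fst_vop_arg fst_Upsilon fst_Tv_minus)
      show "snd (nord [UN1, varg q3 (Lam_list (omit (Suc j)))]) n v
          = snd (Tminus j) n v" if "n \<noteq> 0" for n v
        unfolding snd_nord_pair snd_vop_arg Lam_list_omit_modes[OF j(2)] snd_Tv_minus[OF less_imp_le[OF j(1)]]
        using j(1) that by (simp add: snd_Upsilon)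
    qed
    then show "vcur (nord [UN1, varg q3 (Lam_list (omit (Suc j)))]) m v
      = vcur (Tminus j) m v" by simp
  qed
  finally show ?thesis by (simp only: path_Sigma_minus)
qed

end

section \<open>Partial products seen from an unfrozen vertex\<close>

context mode_families
begin

text \<open>A zero mode can be applied to the vector first; for \<open>Xs k\<close> on an
  eigenvector of s0 it then becomes a scalar.\<close>

lemma vop_current_comp_fst:
  assumes V: "vop_M V" and X: "commutes_M X"
  shows "vcur (fst V \<circ> X, snd V) m v = vcur V m (X v)"
proof -
  have VX: "vop_M (fst V \<circ> X, snd V)" using V X by (simp add: vop_M_def commutes_M_comp)
  have X': "vop_M (X, snd V)" using V X by (simp add: vop_M_def)
  have "X (neg_exp V q u) = neg_exp V q (X u)" "X (pos_exp V b u) = pos_exp V b (X u)" for q b u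
    using fst_neg_exp[OF X' V] fst_pos_exp[OF X' V] by simp_all
  then show ?thesis by (simp add: vop_current_eq[OF V] vop_current_eq[OF VX])
qed

end

context akos
begin

lemma Tv_commute:
  assumes f: "lin f" and s: "\<And>i. i \<le> j \<Longrightarrow> s i \<le> N"
    and x: "\<And>i n v. i \<le> N \<Longrightarrow> n \<noteq> 0 \<Longrightarrow> f (xs i n v) = xs i n (f v)" and n: "n \<noteq> 0"
  shows "f (snd (Tv c s j) n v) = snd (Tv c s j) n (f v)"
  using s
  by (induction j) (simp_all add: snd_Tv_0 snd_Tv_Suc lin_add[OF f] lin_scale[OF f] x n)

text \<open>
  Both paths look the same from an unfrozen vertex \<open>k\<close>: rescaling by the argument \<open>c k0\<close> at which
  the path meets \<open>k\<close>, they pass through \<open>k\<close> as the path \<open>X\<^sub>0 \<rightarrow> \<dots> \<rightarrow> X\<^sub>N\<close> passes through \<open>k0\<close>.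
\<close>

definition meets :: "(nat \<Rightarrow> complex) \<Rightarrow> (nat \<Rightarrow> nat) \<Rightarrow> nat \<Rightarrow> nat \<Rightarrow> bool"
  where "meets c s k0 k \<longleftrightarrow> 0 < k0 \<and> k0 < N \<and> s k0 = k \<and> c k0 \<noteq> 0 \<and>
    (\<forall>i\<le>N. s i \<le> N \<and> (s i = k \<longleftrightarrow> i = k0) \<and>
      (Suc (s i) = k \<or> s i = Suc k \<longleftrightarrow> Suc i = k0 \<or> i = Suc k0) \<and>
      (\<forall>n>0. c i powi (- int n) * cmat n (s i) k
               = c k0 powi (- int n) * cmat n i k0 \<and>
             c i powi int n * cmat n k (s i)
               = c k0 powi int n * cmat n k0 i))"

lemma meets_plus: "0 < k \<Longrightarrow> k < N \<Longrightarrow> meets (\<lambda>_. 1) (\<lambda>i. i) k k"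
  by (simp add: meets_def)

text \<open>Reversal exchanges the two neighbours of k and with them the matrix entries g and g
  q3^n. The ratio q3 of consecutive arguments compensates exactly for this exchange.\<close>

lemma meets_minus:
  assumes k: "0 < k" "k < N"
  shows "meets (\<lambda>i. q3 ^ i) (\<lambda>i. N - i) (N - k) k"
  unfolding meets_def
proof (intro conjI allI impI)
  fix i n :: nat assume i: "i \<le> N" and n: "n > 0"
  have e: "(q3 ^ j) powi (- int n) = inverse ((q3 ^ n) ^ j)" "(q3 ^ j) powi (int n) = (q3 ^ n) ^ j" for j
    by (simp_all add: power_int_minus power_mult[symmetric] mult.commute)
  have q: "q3 ^ n \<noteq> 0" using q_nonzero by simp
  consider "i = N - k" | "Suc i = N - k" | "i = Suc (N - k)" | "i \<noteq> N - k" "Suc i \<noteq> N - k" "i \<noteq> Suc (N - k)"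
    by linarith
  note cs = this
  show "(q3 ^ i) powi (- int n) * cmat n (N - i) k
    = (q3 ^ (N - k)) powi (- int n) * cmat n i (N - k)"
    using cs
  proof cases
    case 2
    then have "N - k = Suc i" "N - i = Suc k" "k \<noteq> N - i" using k by auto
    then show ?thesis unfolding e using k q by (simp add: akos_matrix_def)
  next
    case 3
    then have "N - i = k - 1" "k - Suc 0 \<noteq> k" using k i by auto
    then show ?thesis unfolding e using k q 3 by (simp add: akos_matrix_def)
  next
    case 4
    then have "N - i \<noteq> k" "k \<noteq> Suc (N - i)" "N - i \<noteq> Suc k" using k i by auto
    then show ?thesis using 4 by (auto simp: akos_matrix_def)
  qed (use k in \<open>auto simp: akos_matrix_def\<close>)
  show "(q3 ^ i) powi int n * cmat n k (N - i)
    = (q3 ^ (N - k)) powi int n * cmat n (N - k) i"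
    using cs
  proof cases
    case 2
    then have "N - k = Suc i" "N - i = Suc k" "k \<noteq> N - i" using k by auto
    then show ?thesis unfolding e using k q by (simp add: akos_matrix_def)
  next
    case 3
    then have "N - i = k - 1" "k - Suc 0 \<noteq> k" using k i by auto
    then show ?thesis unfolding e using k q 3 by (simp add: akos_matrix_def)
  next
    case 4
    then have "N - i \<noteq> k" "k \<noteq> Suc (N - i)" "N - i \<noteq> Suc k" using k i by auto
    then show ?thesis using 4 by (auto simp: akos_matrix_def)
  qed (use k in \<open>auto simp: akos_matrix_def\<close>)
qed (use k in \<open>auto simp: q_nonzero\<close>)

text \<open>Up to the common power of \<open>c k0\<close> these are partial sums of a column and of
  a row of the matrix at k0. With p = q3^n the column entries g p, - g (1 + p), g have the partial
  sums g p, - g, 0, and the row behaves likewise. Hence only j = k0 - 1 and j = k0 remain.\<close>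

lemma Tv_brackets:
  assumes me: "meets c s k0 k" and j: "j \<le> N"
  shows "bracket (snd (Tv c s j)) (xs k) (\<lambda>n. c k0 powi (- int n) *
      (if Suc j = k0 then gn n * q3 ^ n else if j = k0 then - gn n else 0) / of_nat n)"
    and "bracket (xs k) (snd (Tv c s j)) (\<lambda>n. c k0 powi int n *
      (if Suc j = k0 then gn n else if j = k0 then - gn n * q3 ^ n else 0) / of_nat n)"
proof -
  have k0: "0 < k0" "k0 < N" and k: "k \<le> N" using me by (auto simp: meets_def)
  have L: "bracket (\<lambda>n v. c i powi (- n) *s xs (s i) n v) (xs k)
      (\<lambda>n. c k0 powi (- int n) * cmat n i k0 / of_nat n)" if "i \<le> N" for i
    by (rule bracket_cong[OF bracket_scale_left[OF xs_free_modes xs_bracket]])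
       (use me that k in \<open>auto simp: meets_def\<close>)
  have R: "bracket (xs k) (\<lambda>n v. c i powi (- n) *s xs (s i) n v)
      (\<lambda>n. c k0 powi int n * cmat n k0 i / of_nat n)" if "i \<le> N" for i
    by (rule bracket_cong[OF bracket_scale_right[OF xs_free_modes xs_bracket]])
       (use me that k in \<open>auto simp: meets_def\<close>)
  have z: "snd (Tv c s 0) = (\<lambda>n v. c 0 powi (- n) *s xs (s 0) n v)"
    and S: "snd (Tv c s (Suc j)) = (\<lambda>n v. snd (Tv c s j) n v + c (Suc j) powi (- n) *s xs (s (Suc j)) n v)" for j
    by (simp_all add: fun_eq_iff snd_Tv_0 snd_Tv_Suc)
  show "bracket (snd (Tv c s j)) (xs k) (\<lambda>n. c k0 powi (- int n) *
      (if Suc j = k0 then gn n * q3 ^ n else if j = k0 then - gn n else 0) / of_nat n)"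
    using j
  proof (induction j)
    case 0
    show ?case unfolding z
      by (rule bracket_cong[OF L]) (use k0 in \<open>auto simp: akos_matrix_def\<close>)
  next
    case (Suc j)
    show ?case unfolding S
      by (rule bracket_cong[OF bracket_add_left[OF xs_free_modes Suc.IH L]])
         (use Suc.prems k0 in \<open>auto simp: akos_matrix_def divide_simps algebra_simps\<close>)
  qed
  show "bracket (xs k) (snd (Tv c s j)) (\<lambda>n. c k0 powi int n *
      (if Suc j = k0 then gn n else if j = k0 then - gn n * q3 ^ n else 0) / of_nat n)"
    using j
  proof (induction j)
    case 0
    show ?case unfolding z
      by (rule bracket_cong[OF R]) (use k0 in \<open>auto simp: akos_matrix_def\<close>)
  next
    case (Suc j)
    show ?case unfolding S
      by (rule bracket_cong[OF bracket_add_right[OF xs_free_modes Suc.IH R]])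
         (use Suc.prems k0 in \<open>auto simp: akos_matrix_def divide_simps algebra_simps\<close>)
  qed
qed

end

section \<open>Screening charges\<close>

text \<open>The disjunction covers both charges: \<sigma>^2 is q2 for \<sigma>_+ and q1 for
  \<sigma>_-, and \<sigma>'^2 is the other one. All brackets are symmetric in the two.\<close>

locale akos_screening = akos scale N q1 q2 q3 lam beta l1 l2 l3 tau
  for scale :: "complex \<Rightarrow> 'v \<Rightarrow> 'v::ab_group_add" (infixr "*s" 75)
    and N :: nat and q1 q2 q3 :: complex and lam beta and l1 l2 l3 tau :: complex +
  fixes k :: nat and ls ls' :: complex and s0 S :: "'v \<Rightarrow> 'v"
  assumes k: "0 < k" "k < N"
    and sigma: "exp (2 * ls) = q1 \<and> exp (2 * ls') = q2 \<or> exp (2 * ls) = q2 \<and> exp (2 * ls') = q1"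
    and rel: "screening_relations scale (akos_quiver N q1 q3) Xs xs k (ls, ls') s0 S"
begin

text \<open>In the notation of the screening charges these are \<open>\<sigma>\<close>, \<open>\<sigma>'\<^sup>2\<close> and half the commutator of \<open>s\<^sub>0\<close> with \<open>S\<close>.\<close>

definition sg :: complex where "sg = exp ls"

definition bb :: complex where "bb = exp (2 * ls')"

definition rr :: complex where "rr = ls' / ls"

lemma sg_square: "sg\<^sup>2 = exp (2 * ls)" "(sg ^ n)\<^sup>2 = exp (2 * ls) ^ n"
proof -
  show s2: "sg\<^sup>2 = exp (2 * ls)" by (simp add: sg_def exp_double)
  have "(sg ^ n)\<^sup>2 = (sg\<^sup>2) ^ n" by (simp add: power_mult[symmetric] mult.commute)
  then show "(sg ^ n)\<^sup>2 = exp (2 * ls) ^ n" unfolding s2 .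
qed

lemma sg_pow: "gn n = (1 - (sg ^ n)\<^sup>2) * (1 - bb ^ n)" "q3 ^ n = inverse ((sg ^ n)\<^sup>2 * bb ^ n)"
  "sg \<noteq> 0" "bb \<noteq> 0"
proof -
  have "exp (2 * ls) * bb = q1 * q2" using sigma by (auto simp: bb_def)
  then have "exp (2 * ls) ^ n * bb ^ n = (q1 * q2) ^ n" by (simp flip: power_mult_distrib)
  moreover have "q3 = inverse (q1 * q2)" using q123 by (metis inverse_unique)
  ultimately show "q3 ^ n = inverse ((sg ^ n)\<^sup>2 * bb ^ n)" by (simp only: sg_square(2) power_inverse)
  show "gn n = (1 - (sg ^ n)\<^sup>2) * (1 - bb ^ n)"
    using sigma unfolding sg_square(2) by (auto simp: bb_def gn_def)
  show "sg \<noteq> 0" "bb \<noteq> 0" by (simp_all add: sg_def bb_def)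
qed

lemma sg_neq_1: "n > 0 \<Longrightarrow> (sg ^ n)\<^sup>2 \<noteq> 1"
  unfolding sg_square(2) using sigma q_pow_neq_1 by auto

lemma ls_nonzero: "ls \<noteq> 0"
  using sg_neq_1[of 1] by (auto simp: sg_def)

lemma verts_akos: "verts (akos_quiver N q1 q3) = {0..N}"
  by (simp add: akos_quiver_def)

lemma s0_diag: "diagonalizable_op scale s0" and S_lin: "lin S"
  and Xk: "Xs k = fun_op scale (\<lambda>\<mu>. exp (- 2 * \<mu> * ls)) s0"
  and s0_X: "j \<le> N \<Longrightarrow> s0 (Xs j v) = Xs j (s0 v)"
  and s0_x: "j \<le> N \<Longrightarrow> n \<noteq> 0 \<Longrightarrow> s0 (xs j n v) = xs j n (s0 v)"
  and s0_S: "s0 (S v) = S (s0 v) + (2 * rr) *s S v"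
  and S_x: "j \<le> N \<Longrightarrow> n \<noteq> 0 \<Longrightarrow> S (xs j n v) = xs j n (S v)"
  using rel by (auto simp: screening_relations_def Let_def verts_akos rr_def algebra_simps)

lemma S_X_adj: "j \<le> N \<Longrightarrow> Suc j = k \<or> j = Suc k \<Longrightarrow> S (Xs j v) = inverse bb *s Xs j (S v)"
  and S_X_far: "j \<le> N \<Longrightarrow> j \<noteq> k \<Longrightarrow> \<not> (Suc j = k \<or> j = Suc k) \<Longrightarrow> S (Xs j v) = Xs j (S v)"
proof -
  have adj: "j \<noteq> k \<and> (labels (akos_quiver N q1 q3) j k \<noteq> [] \<or> labels (akos_quiver N q1 q3) k j \<noteq> [])
      \<longleftrightarrow> Suc j = k \<or> j = Suc k" if "j \<le> N" for j
    using that k by (auto simp: labels_akos)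
  have b: "exp (- 2 * ls') = inverse bb" by (simp add: bb_def exp_minus)
  show "j \<le> N \<Longrightarrow> Suc j = k \<or> j = Suc k \<Longrightarrow> S (Xs j v) = inverse bb *s Xs j (S v)"
    using rel adj[of j] unfolding screening_relations_def Let_def verts_akos b[symmetric] by simp
  show "j \<le> N \<Longrightarrow> j \<noteq> k \<Longrightarrow> \<not> (Suc j = k \<or> j = Suc k) \<Longrightarrow> S (Xs j v) = Xs j (S v)"
    using rel adj[of j] unfolding screening_relations_def Let_def verts_akos by simp
qed

lemma S_eigen:
  assumes "s0 v = \<mu> *s v"
  shows "s0 (S v) = (\<mu> + 2 * rr) *s S v"
  by (simp add: s0_S assms lin_scale[OF S_lin] scale_left_distrib)

lemma Xk_eigen: "s0 v = \<mu> *s v \<Longrightarrow> Xs k v = exp (- 2 * \<mu> * ls) *s v"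
  unfolding Xk by (rule fun_op_eigen[OF s0_diag])

text \<open>This relation is not imposed but follows: S raises the eigenvalue of s0 by
  \<open>2 * rr\<close>, and X_k = \<sigma>^(-2 s0) is thereby multiplied by \<sigma>^(-4 rr), which
  is \<open>bb\<close> to the power -2.\<close>

lemma S_X_k: "S (Xs k v) = bb\<^sup>2 *s Xs k (S v)"
proof (rule diagonalizable_eqI[OF s0_diag, where F = "\<lambda>v. S (Xs k v)" and G = "\<lambda>v. bb\<^sup>2 *s Xs k (S v)"])
  have "lin (Xs k)" by (rule commutes_M_lin[OF commutes_M_Xs])
  then show "lin (\<lambda>v. S (Xs k v))" "lin (\<lambda>v. bb\<^sup>2 *s Xs k (S v))"
    by (auto intro: lin_cmult lin_comp[OF S_lin] lin_comp[OF _ S_lin])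
  fix \<mu> u assume u: "s0 u = \<mu> *s u"
  have "bb\<^sup>2 * exp (- 2 * (\<mu> + 2 * rr) * ls) = exp (4 * ls' + - 2 * (\<mu> + 2 * rr) * ls)"
    by (simp add: bb_def exp_add flip: exp_double)
  also have "4 * ls' + - 2 * (\<mu> + 2 * rr) * ls = - 2 * \<mu> * ls"
    using ls_nonzero by (simp add: rr_def field_simps)
  finally have e: "bb\<^sup>2 * exp (- 2 * (\<mu> + 2 * rr) * ls) = exp (- 2 * \<mu> * ls)" .
  show "S (Xs k u) = bb\<^sup>2 *s Xs k (S u)"
    unfolding Xk_eigen[OF u] Xk_eigen[OF S_eigen[OF u]] lin_scale[OF S_lin] scale_scale e ..
qed

text \<open>The zero mode analogue of \<open>Tv_brackets\<close>: around k0 the factors 1/bb, bb^2,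
  1/bb have the partial products 1/bb, bb, 1.\<close>

lemma S_Tv:
  assumes me: "meets c s k0 k" and j: "j \<le> N"
  shows "S (fst (Tv c s j) v) = (if Suc j = k0 then inverse bb else if j = k0 then bb else 1) *s fst (Tv c s j) (S v)"
proof -
  have k0: "0 < k0" "k0 < N" using me by (auto simp: meets_def)
  have X: "S (Xs (s i) v) = (if Suc i = k0 \<or> i = Suc k0 then inverse bb else if i = k0 then bb\<^sup>2 else 1) *s Xs (s i) (S v)"
    if i: "i \<le> N" for i v
  proof -
    have si: "s i \<le> N" "s i = k \<longleftrightarrow> i = k0" "Suc (s i) = k \<or> s i = Suc k \<longleftrightarrow> Suc i = k0 \<or> i = Suc k0"
      using me i by (auto simp: meets_def)
    consider "Suc i = k0 \<or> i = Suc k0" | "i = k0" | "i \<noteq> k0" "\<not> (Suc i = k0 \<or> i = Suc k0)" by blast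
    then show ?thesis
    proof cases
      case 1
      then show ?thesis using S_X_adj[OF si(1)] si(3) by simp
    next
      case 2
      then show ?thesis using S_X_k si(2) by simp
    next
      case 3
      then show ?thesis using S_X_far[OF si(1)] si(2,3) by simp
    qed
  qed
  show ?thesis using j
  proof (induction j arbitrary: v)
    case 0
    show ?case using X[of 0 v] k0 by (simp add: fst_Tv_0)
  next
    case (Suc j)
    have l: "lin (fst (Tv c s j))" by (rule lin_fst_vop[OF vop_M_Tv])
    have "S (fst (Tv c s (Suc j)) v) = S (fst (Tv c s j) (Xs (s (Suc j)) v))" by (simp add: fst_Tv_Suc)
    also have "\<dots> = (if Suc j = k0 then inverse bb else if j = k0 then bb else 1)
        *s (if Suc (Suc j) = k0 \<or> Suc j = Suc k0 then inverse bb else if Suc j = k0 then bb\<^sup>2 else 1)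
        *s fst (Tv c s j) (Xs (s (Suc j)) (S v))"
      using Suc X[of "Suc j" v] by (simp add: lin_scale[OF l])
    also have "\<dots> = (if Suc (Suc j) = k0 then inverse bb else if Suc j = k0 then bb else 1) *s fst (Tv c s (Suc j)) (S v)"
      using sg_pow(4) by (auto simp: fst_Tv_Suc power2_eq_square)
    finally show ?case .
  qed
qed

text \<open>\<open>s\<^sub>n = ee n x\<^bsub>k,n\<^esub>\<close>, and \<open>Sh\<close> is \<open>S\<^sub>k(z)\<close> without its zero mode factor.\<close>

definition ee :: "int \<Rightarrow> complex"
  where "ee n = 1 / (qpow ls (of_int n) - qpow ls (- of_int n))"

definition Sh :: "'v vop" where "Sh = (id, \<lambda>n v. (- ee n) *s xs k n v)"

lemma vop_M_Sh: "vop_M Sh"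
  by (simp add: vop_M_def Sh_def commutes_M_id free_modes_scale xs_free_modes del: scale_minus_left)

lemma ee_nat:
  assumes "n > 0"
  shows "ee (int n) = - (sg ^ n) / (1 - (sg ^ n)\<^sup>2)" "ee (- int n) = sg ^ n / (1 - (sg ^ n)\<^sup>2)"
proof -
  have q: "qpow ls (of_nat n) = sg ^ n" "qpow ls (- of_nat n) = inverse (sg ^ n)"
    by (simp_all add: qpow_def sg_def exp_of_nat_mult exp_minus)
  have d: "1 - (sg ^ n)\<^sup>2 \<noteq> 0" using sg_neq_1[OF assms] by simp
  have "ee (int n) = 1 / (sg ^ n - inverse (sg ^ n))" "ee (- int n) = 1 / (inverse (sg ^ n) - sg ^ n)"
    by (simp_all add: ee_def q)
  moreover have "sg ^ n - inverse (sg ^ n) = - (1 - (sg ^ n)\<^sup>2) / sg ^ n" "inverse (sg ^ n) - sg ^ n = (1 - (sg ^ n)\<^sup>2) / sg ^ n"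
    using sg_pow(3) by (simp_all add: field_simps power2_eq_square)
  ultimately show "ee (int n) = - (sg ^ n) / (1 - (sg ^ n)\<^sup>2)" "ee (- int n) = sg ^ n / (1 - (sg ^ n)\<^sup>2)"
    using d by (simp_all add: minus_divide_right)
qed

text \<open>In terms of exponents, X_k(w) is \<open>Sh\<close> at \<sigma> w divided by
  \<open>Sh\<close> at w/\<sigma>.\<close>

lemma ee_diff: "n \<noteq> 0 \<Longrightarrow> ee n * sg powi n - ee n * sg powi (- n) = 1"
proof -
  assume n: "n \<noteq> 0"
  have *: "ee (int m) * sg ^ m - ee (int m) * inverse (sg ^ m) = 1"
    "ee (- int m) * inverse (sg ^ m) - ee (- int m) * sg ^ m = 1" if "m > 0" for m
    using sg_neq_1[OF that] sg_pow(3) unfolding ee_nat[OF that]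
    by (simp_all add: divide_simps power2_eq_square)
  show ?thesis
  proof (cases "n > 0")
    case True
    then show ?thesis using *(1)[of "nat n"] by (simp add: power_int_minus) (simp add: power_int_def)
  next
    case False
    then show ?thesis using *(2)[of "nat (- n)"] n by (simp add: power_int_minus) (simp add: power_int_def power_inverse)
  qed
qed

lemma Sh_brackets:
  assumes me: "meets c s k0 k" and j: "j \<le> N"
  shows "bracket_modes (pos_modes (snd (Tv c s j))) (neg_modes (snd Sh)) (\<lambda>n. - ee (- int n) * (c k0 powi (- int n) *
      (if Suc j = k0 then gn n * q3 ^ n else if j = k0 then - gn n else 0) / of_nat n))" (is ?thesis1)
    and "bracket_modes (pos_modes (snd Sh)) (neg_modes (snd (Tv c s j))) (\<lambda>n. - ee (int n) * (c k0 powi int n *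
      (if Suc j = k0 then gn n else if j = k0 then - gn n * q3 ^ n else 0) / of_nat n))" (is ?thesis2)
proof -
  have T: "snd (Tv c s j) \<in> free_modes" using vop_M_Tv by (simp add: vop_M_def)
  note R = bracket_scale_right[OF T Tv_brackets(1)[OF me j], of "\<lambda>n. - ee n"]
    and L = bracket_scale_left[OF T Tv_brackets(2)[OF me j], of "\<lambda>n. - ee n"]
  show ?thesis1 ?thesis2 unfolding Sh_def snd_conv by (fact R[unfolded bracket_def] L[unfolded bracket_def])+
qed

lemma fst_Sh: "fst Sh = id" by (simp add: Sh_def)

lemma Tv_screening_far:
  assumes me: "meets c s k0 k" and j: "j \<le> N" "Suc j \<noteq> k0" "j \<noteq> k0"
  shows "vcur (Tv c s j) m (S (vcur Sh M u))
    = S (vcur Sh M (vcur (Tv c s j) m u))"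
proof -
  have si: "i \<le> j \<Longrightarrow> s i \<le> N" for i using me j(1) by (auto simp: meets_def)
  have "S (vcur (Tv c s j) m w) = 1 *s vcur (Tv c s j) m (S w)" for w
    by (rule vop_current_intertwine[OF vop_M_Tv S_lin])
       (use S_Tv[OF me j(1)] j Tv_commute[OF S_lin si S_x] in auto)
  moreover have "vcur (Tv c s j) m (vcur Sh M u)
      = vcur Sh M (vcur (Tv c s j) m u)"
    by (rule vop_current_commute[OF vop_M_Tv vop_M_Sh])
       (use Sh_brackets[OF me j(1)] j in \<open>auto simp: fst_Sh\<close>)
  ultimately show ?thesis by (metis scale_one)
qed

lemma Tv_screening_pair:
  assumes me: "meets c s k0 k" and j: "Suc j = k0" and u: "s0 u = (of_int M - rr) *s u"
  shows "vcur (Tv c s j) m (S (vcur Sh M u))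
      + vcur (Tv c s k0) m (S (vcur Sh M u))
    = S (vcur Sh M (vcur (Tv c s j) m u))
      + S (vcur Sh M (vcur (Tv c s k0) m u))"
proof -
  let ?T = "Tv c s j" and ?T' = "Tv c s k0" and ?c = "c k0"
  \<comment> \<open>The delta functions sit at z = w/y = \<sigma> c w and at z = w/y' = c
    w/\<sigma>.\<close>
  define y where "y = inverse (sg * ?c)"
  define y' where "y' = sg / ?c"
  have k0: "0 < k0" "k0 < N" "s k0 = k" and c: "?c \<noteq> 0" using me by (auto simp: meets_def)
  have jN: "j \<le> N" "k0 \<le> N" using j k0 by auto
  have si: "i \<le> N \<Longrightarrow> s i \<le> N" for i using me by (auto simp: meets_def)
  have y0: "y \<noteq> 0" "y' \<noteq> 0" using c sg_pow(3) by (simp_all add: y_def y'_def)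
  have b0: "bb \<noteq> 0" by (rule sg_pow(4))
  have ST: "S (vcur ?T m w) = inverse bb *s vcur ?T m (S w)" for w
    by (rule vop_current_intertwine[OF vop_M_Tv S_lin])
       (use S_Tv[OF me jN(1)] j Tv_commute[OF S_lin si S_x] jN in auto)
  have ST': "S (vcur ?T' m w) = bb *s vcur ?T' m (S w)" for w
    by (rule vop_current_intertwine[OF vop_M_Tv S_lin])
       (use S_Tv[OF me jN(2)] j Tv_commute[OF S_lin si S_x] jN in auto)
  have pw: "?c powi (- int n) = inverse (?c ^ n)" "?c powi int n = ?c ^ n" for n
    by (simp_all add: power_int_minus)
  \<comment> \<open>The weight \<open>bb\<close> is the factor by which S fails to commute with T,
    and also the one that makes the two expansions belong to the same rational function. For T' both
    roles are played by \<open>inverse bb\<close>.\<close>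
  have P1: "bb *s vcur ?T m (vcur Sh M u) - vcur Sh M (vcur ?T m u)
    = ((bb - 1) * y powi M) *s vcur (nord [?T, varg (inverse y) Sh]) (m + M) u"
  proof (rule vop_commutator_delta[OF vop_M_Tv vop_M_Sh Sh_brackets[OF me jN(1)] _ y0(1) b0])
    fix n :: nat assume n: "n > 0"
    have d: "1 - (sg ^ n)\<^sup>2 \<noteq> 0" using sg_neq_1[OF n] by simp
    show "of_nat n * (- ee (- int n) * (?c powi (- int n) *
        (if Suc j = k0 then gn n * q3 ^ n else if j = k0 then - gn n else 0) / of_nat n))
      = (1 - inverse bb ^ n) * y ^ n"
      unfolding ee_nat[OF n] pw sg_pow(1,2) y_def using d n c j sg_pow(3,4)
      by (simp add: divide_simps power_mult_distrib power2_eq_square)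
    show "of_nat n * (- ee (int n) * (?c powi int n *
        (if Suc j = k0 then gn n else if j = k0 then - gn n * q3 ^ n else 0) / of_nat n))
      = (1 - bb ^ n) * inverse y ^ n"
      unfolding ee_nat[OF n] pw sg_pow(1,2) y_def using d n c j sg_pow(3,4)
      by (simp add: divide_simps power_mult_distrib)
  qed (simp add: fst_Sh)
  have P2: "inverse bb *s vcur ?T' m (vcur Sh M u) - vcur Sh M (vcur ?T' m u)
    = ((inverse bb - 1) * y' powi M) *s vcur (nord [?T', varg (inverse y') Sh]) (m + M) u"
  proof (rule vop_commutator_delta[OF vop_M_Tv vop_M_Sh Sh_brackets[OF me jN(2)] _ y0(2)])
    show "inverse bb \<noteq> 0" using b0 by simp
    fix n :: nat assume n: "n > 0"
    have d: "1 - (sg ^ n)\<^sup>2 \<noteq> 0" using sg_neq_1[OF n] by simp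
    show "of_nat n * (- ee (- int n) * (?c powi (- int n) *
        (if Suc k0 = k0 then gn n * q3 ^ n else if k0 = k0 then - gn n else 0) / of_nat n))
      = (1 - inverse (inverse bb) ^ n) * y' ^ n"
      unfolding ee_nat[OF n] pw sg_pow(1,2) y'_def using d n c j sg_pow(3,4)
      by (simp add: divide_simps power_mult_distrib)
    show "of_nat n * (- ee (int n) * (?c powi int n *
        (if Suc k0 = k0 then gn n else if k0 = k0 then - gn n * q3 ^ n else 0) / of_nat n))
      = (1 - inverse bb ^ n) * inverse y' ^ n"
      unfolding ee_nat[OF n] pw sg_pow(1,2) y'_def using d n c j sg_pow(3,4)
      by (simp add: divide_simps power_mult_distrib power2_eq_square) (simp add: algebra_simps)
  qed (simp add: fst_Sh)
  let ?F = "nord [?T, varg (inverse y) Sh]"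
  have VF: "vop_M ?F" by (rule vop_M_nord[OF vop_M_Tv vop_M_arg[OF vop_M_Sh]])
  have "vcur (nord [?T', varg (inverse y') Sh])
      = vcur (fst ?F \<circ> Xs k, snd ?F)"
  proof (rule vop_current_cong)
    show "fst (nord [?T', varg (inverse y') Sh]) = fst (fst ?F \<circ> Xs k, snd ?F)"
      using k0(3) fst_Tv_Suc[of c s j] unfolding j by (simp add: fst_nord_pair fst_vop_arg fst_Sh)
    fix n :: int and v assume n: "n \<noteq> 0"
    have "?c powi (- n) + inverse y' powi (- n) * - ee n
        = ?c powi (- n) * (1 - (ee n * sg powi n - ee n * sg powi (- n))) + inverse y powi (- n) * - ee n"
      using c sg_pow(3)
      by (simp add: y_def y'_def power_int_minus power_int_mult_distrib power_int_divide_distrib power_int_inverse field_simps)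
    also have "\<dots> = inverse y powi (- n) * - ee n" by (simp add: ee_diff[OF n])
    finally have e: "?c powi (- n) + inverse y' powi (- n) * - ee n = inverse y powi (- n) * - ee n" .
    have "snd (nord [?T', varg (inverse y') Sh]) n v
      = snd ?T n v + (?c powi (- n) + inverse y' powi (- n) * - ee n) *s xs k n v"
      using snd_Tv_Suc[of c s j n v] k0(3) unfolding j
      by (simp add: snd_nord_pair snd_vop_arg Sh_def scale_left_diff_distrib)
    also have "\<dots> = snd (fst ?F \<circ> Xs k, snd ?F) n v"
      unfolding e by (simp add: snd_nord_pair snd_vop_arg Sh_def del: scale_minus_left)
    finally show "snd (nord [?T', varg (inverse y') Sh]) n v = snd (fst ?F \<circ> Xs k, snd ?F) n v" .
  qed
  then have "vcur (nord [?T', varg (inverse y') Sh]) (m + M) u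
      = vcur ?F (m + M) (Xs k u)"
    by (simp add: vop_current_comp_fst[OF VF commutes_M_Xs])
  also have "\<dots> = exp (- 2 * (of_int M - rr) * ls) *s vcur ?F (m + M) u"
    by (simp add: Xk_eigen[OF u] lin_scale[OF lin_vop_current[OF VF]])
  \<comment> \<open>The factor \<open>bb\<close> comes from the shift \<open>rr\<close> of the
    eigenvalue, that is, from the Weyl ordering of the zero modes.\<close>
  also have "exp (- 2 * (of_int M - rr) * ls) = bb * (sg powi (- M) * sg powi (- M))"
  proof -
    have "- 2 * (of_int M - rr) * ls = 2 * ls' + (of_int (- M) * ls + of_int (- M) * ls)"
      using ls_nonzero by (simp add: rr_def field_simps)
    then show ?thesis by (simp only: exp_add bb_def sg_def exp_power_int)
  qed
  finally have F': "vcur (nord [?T', varg (inverse y') Sh]) (m + M) u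
      = (bb * (sg powi (- M) * sg powi (- M))) *s vcur ?F (m + M) u" .
  \<comment> \<open>Since y' = \<sigma>^2 y, the powers agree, and (1/bb - 1) bb = 1 - bb is
    opposite to bb - 1.\<close>
  have coef: "(bb - 1) * y powi M + ((inverse bb - 1) * y' powi M) * (bb * (sg powi (- M) * sg powi (- M))) = 0"
    using c b0 sg_pow(3)
    by (simp add: y_def y'_def power_int_minus power_int_mult_distrib power_int_divide_distrib power_int_inverse field_simps)
  let ?w = "vcur Sh M u"
  have "vcur ?T m (S ?w) + vcur ?T' m (S ?w)
    = S (bb *s vcur ?T m ?w) + S (inverse bb *s vcur ?T' m ?w)"
    using b0 by (simp add: lin_scale[OF S_lin] ST ST')
  also have "\<dots> = S (bb *s vcur ?T m ?w + inverse bb *s vcur ?T' m ?w)"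
    by (simp add: lin_add[OF S_lin])
  also have "bb *s vcur ?T m ?w + inverse bb *s vcur ?T' m ?w
    = vcur Sh M (vcur ?T m u) + vcur Sh M (vcur ?T' m u)
     + ((bb - 1) * y powi M + ((inverse bb - 1) * y' powi M) * (bb * (sg powi (- M) * sg powi (- M)))) *s vcur ?F (m + M) u"
    using P1 P2[unfolded F' scale_scale] by (simp only: scale_left_distrib diff_eq_eq) (simp add: algebra_simps)
  finally show ?thesis by (simp add: coef lin_add[OF S_lin])
qed

section \<open>The screening charge as a sum over eigenspaces\<close>

abbreviation Qk :: "'v \<Rightarrow> 'v"
  where "Qk \<equiv> screening_charge scale xs k (ls, ls') s0 S"

lemma P_lin: "lin (eigen_proj s0 \<mu>)"
  by (rule lin_eigen_proj[OF s0_diag])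

text \<open>On eigenvalue \<mu> the right factor gives z^(-\<mu>/2); S raises \<mu> by
  \<open>2 * rr\<close>, so the left one gives z^(-\<mu>/2 - rr). The total exponent - \<mu> - rr
  fixes \<mu>, and just one \<alpha> contributes.\<close>

lemma screening_zero_eq: "screening_zero scale s0 S \<gamma> v = S (eigen_proj s0 (- \<gamma> - rr) v)"
proof -
  have zp: "zpow_coeff scale (- 1 / 2) s0 \<alpha> = eigen_proj s0 (- 2 * \<alpha>)" for \<alpha>
  proof -
    have "(- 1 / 2 * \<mu> = \<alpha>) = (\<mu> = - 2 * \<alpha>)" for \<mu> :: complex
    proof
      assume "- 1 / 2 * \<mu> = \<alpha>"
      then have "- 2 * \<alpha> = - 2 * (- 1 / 2 * \<mu>)" by simp
      then show "\<mu> = - 2 * \<alpha>" by simp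
    qed simp
    then show ?thesis by (simp only: zpow_coeff_def eigen_proj_def)
  qed
  define f where "f \<alpha> = eigen_proj s0 (- 2 * \<alpha>) (S (eigen_proj s0 (- 2 * (\<gamma> - \<alpha>)) v))" for \<alpha>
  have f: "f \<alpha> = (if \<alpha> = (\<gamma> - rr) / 2 then S (eigen_proj s0 (- \<gamma> - rr) v) else 0)" for \<alpha>
  proof -
    have f1: "f \<alpha> = (if - 2 * (\<gamma> - \<alpha>) + 2 * rr = - 2 * \<alpha> then S (eigen_proj s0 (- 2 * (\<gamma> - \<alpha>)) v) else 0)"
      unfolding f_def by (rule eigen_proj_eigen[OF s0_diag S_eigen[OF eigen_eigen_proj[OF s0_diag]]])
    have "- 2 * (\<gamma> - \<alpha>) + 2 * rr - - 2 * \<alpha> = 4 * (\<alpha> - (\<gamma> - rr) / 2)" by (simp add: field_simps)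
    then have f2: "(- 2 * (\<gamma> - \<alpha>) + 2 * rr = - 2 * \<alpha>) = (\<alpha> = (\<gamma> - rr) / 2)"
      by (metis right_minus_eq mult_eq_0_iff zero_neq_numeral)
    have f3: "- 2 * (\<gamma> - (\<gamma> - rr) / 2) = - \<gamma> - rr" by (simp add: field_simps)
    show ?thesis
    proof (cases "\<alpha> = (\<gamma> - rr) / 2")
      case True
      then show ?thesis using f1 unfolding f2 unfolding True f3 by simp
    next
      case False
      then show ?thesis using f1 unfolding f2 by simp
    qed
  qed
  have "screening_zero scale s0 S \<gamma> v = Sum_any f"
    unfolding screening_zero_def zp f_def ..
  also have "\<dots> = (\<Sum>\<alpha>\<in>{(\<gamma> - rr) / 2}. f \<alpha>)"
    by (rule Sum_any.expand_superset) (auto simp: f)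
  finally show ?thesis by (simp add: f)
qed

lemma P_Sh: "eigen_proj s0 \<mu> (vcur Sh m v) = vcur Sh m (eigen_proj s0 \<mu> v)"
proof -
  have "eigen_proj s0 \<mu> (xs k n v) = xs k n (eigen_proj s0 \<mu> v)" if "n \<noteq> 0" for n v
    by (rule eigen_proj_commute[OF s0_diag, of "xs k n", symmetric])
       (use k that in \<open>auto intro: free_modes_lin[OF xs_free_modes] s0_x[symmetric]\<close>)
  then have "eigen_proj s0 \<mu> (vcur Sh m v) = 1 *s vcur Sh m (eigen_proj s0 \<mu> v)"
    by (intro vop_current_intertwine[OF vop_M_Sh P_lin])
       (simp_all add: Sh_def lin_scale[OF P_lin] del: scale_minus_left)
  then show ?thesis by simp
qed

text \<open>On the \<open>\<mu>\<close>-eigenspace of \<open>s\<^sub>0\<close> the zero mode factor of \<open>S\<^sub>k(z)\<close> is \<open>z\<close> to the power \<open>- \<mu> - rr\<close>, so only the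
  mode \<open>m = \<mu> + rr\<close> of \<open>Sh\<close> contributes to the coefficient of \<open>z\<^sup>0\<close>.\<close>

definition Qm :: "int \<Rightarrow> 'v \<Rightarrow> 'v"
  where "Qm m v = S (vcur Sh m (eigen_proj s0 (of_int m - rr) v))"

lemma screening_charge_eq: "Qk v = Sum_any (\<lambda>m. Qm m v)"
proof -
  have "(id, \<lambda>n u. - ((1 / (qpow ls (of_int n) - qpow ls (- of_int n))) *s xs k n u)) = Sh"
    unfolding Sh_def ee_def by simp
  then show ?thesis
    unfolding screening_charge_def screening_current_def Let_def fst_conv screening_zero_eq
    by (simp add: P_Sh Qm_def)
qed

lemma lin_Qm: "lin (Qm m)"
  unfolding Qm_def[abs_def] by (rule lin_comp[OF S_lin lin_comp[OF lin_vop_current[OF vop_M_Sh] P_lin]])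

lemma Qm_finite: "finite {m. Qm m v \<noteq> 0}"
proof -
  have "finite ((\<lambda>m::int. of_int m - rr) -` {\<mu>. eigen_proj s0 \<mu> v \<noteq> 0})"
    by (rule finite_vimageI[OF eigen_proj_finite_sum[OF s0_diag]]) (simp add: inj_def)
  then show ?thesis
    by (rule rev_finite_subset)
       (auto simp: Qm_def lin_zero[OF S_lin] lin_zero[OF lin_vop_current[OF vop_M_Sh]])
qed

lemma lin_screening_charge: "lin (Qk)"
  unfolding screening_charge_eq[abs_def] by (rule lin_Sum_any_op[OF lin_Qm Qm_finite])

text \<open>An operator commuting with s0 preserves its eigenspaces, so the claim can be checked for
  one mode M at a time, on vectors whose eigenvalue is tied to M. The cancellation of the delta
  functions depends on this tie.\<close>

lemma screening_charge_commute:
  assumes A: "lin A" and s: "\<And>v. A (s0 v) = s0 (A v)"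
    and c: "\<And>M u. s0 u = (of_int M - rr) *s u \<Longrightarrow>
      A (S (vcur Sh M u)) = S (vcur Sh M (A u))"
  shows "A \<circ> Qk = Qk \<circ> A"
proof
  fix v
  have "A (Qm m v) = Qm m (A v)" for m
    unfolding Qm_def c[OF eigen_eigen_proj[OF s0_diag]] eigen_proj_commute[OF s0_diag A s] ..
  then show "(A \<circ> Qk) v = (Qk \<circ> A) v"
    by (simp add: screening_charge_eq lin_Sum_any[OF A Qm_finite])
qed

lemma Tv_s0:
  assumes "meets c s k0 k" "j \<le> N"
  shows "vcur (Tv c s j) m (s0 v) = s0 (vcur (Tv c s j) m v)"
proof -
  have si: "i \<le> j \<Longrightarrow> s i \<le> N" for i using assms by (auto simp: meets_def)
  have f: "s0 (fst (Tv c s j) v) = fst (Tv c s j) (s0 v)" for v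
    using si by (induction j arbitrary: v) (auto simp: fst_Tv_0 fst_Tv_Suc s0_X)
  have "s0 (vcur (Tv c s j) m v) = 1 *s vcur (Tv c s j) m (s0 v)"
    by (rule vop_current_intertwine[OF vop_M_Tv diagonalizable_lin[OF s0_diag]])
       (simp_all add: f Tv_commute[OF diagonalizable_lin[OF s0_diag] si s0_x])
  then show ?thesis by simp
qed

text \<open>The full path has passed k0 and its next vertex, so contractions and zero mode factors
  have already cancelled.\<close>

lemma Psi_commutes_screening:
  assumes me: "meets c s k0 k"
  shows "vcur (Tv c s N) m \<circ> Qk
    = Qk \<circ> vcur (Tv c s N) m"
proof (rule screening_charge_commute)
  show "lin (vcur (Tv c s N) m)" by (rule lin_vop_current[OF vop_M_Tv])
  show "vcur (Tv c s N) m (s0 v) = s0 (vcur (Tv c s N) m v)" for v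
    by (rule Tv_s0[OF me order_refl])
  show "vcur (Tv c s N) m (S (vcur Sh M u))
      = S (vcur Sh M (vcur (Tv c s N) m u))" for M u
    by (rule Tv_screening_far[OF me]) (use me in \<open>auto simp: meets_def\<close>)
qed

text \<open>The sum ends at N - 1 and 0 < k0 < N, so both members of the cancelling pair k0 - 1, k0
  occur in it; every other summand commutes by itself.\<close>

lemma Sigma_commutes_screening:
  assumes me: "meets c s k0 k"
  shows "(\<lambda>v. \<Sum>j<N. vcur (Tv c s j) m v) \<circ> Qk
    = Qk \<circ> (\<lambda>v. \<Sum>j<N. vcur (Tv c s j) m v)"
proof (rule screening_charge_commute)
  have k0: "0 < k0" "k0 < N" using me by (auto simp: meets_def)
  show "lin (\<lambda>v. \<Sum>j<N. vcur (Tv c s j) m v)"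
    by (intro lin_sum_op lin_vop_current vop_M_Tv)
  show "(\<Sum>j<N. vcur (Tv c s j) m (s0 v)) = s0 (\<Sum>j<N. vcur (Tv c s j) m v)" for v
    unfolding lin_sum[OF diagonalizable_lin[OF s0_diag]]
    by (intro sum.cong refl Tv_s0[OF me]) simp
  fix M u assume u: "s0 u = (of_int M - rr) *s u"
  define L where "L j = vcur (Tv c s j) m (S (vcur Sh M u))" for j
  define R where "R j = S (vcur Sh M (vcur (Tv c s j) m u))" for j
  have split: "{..<N} = {k0 - 1, k0} \<union> ({..<N} - {k0 - 1, k0})" using k0 by auto
  have sum_split: "(\<Sum>j<N. F j) = (F (k0 - 1) + F k0) + (\<Sum>j\<in>{..<N} - {k0 - 1, k0}. F j)" for F :: "nat \<Rightarrow> 'v"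
    by (subst split, subst sum.union_disjoint) (use k0 in auto)
  have far: "(\<Sum>j\<in>{..<N} - {k0 - 1, k0}. L j) = (\<Sum>j\<in>{..<N} - {k0 - 1, k0}. R j)"
  proof (intro sum.cong refl)
    fix j assume "j \<in> {..<N} - {k0 - 1, k0}"
    then show "L j = R j" unfolding L_def R_def by (intro Tv_screening_far[OF me]) auto
  qed
  have pair: "L (k0 - 1) + L k0 = R (k0 - 1) + R k0"
    unfolding L_def R_def by (rule Tv_screening_pair[OF me _ u]) (use k0 in simp)
  have "(\<Sum>j<N. L j) = (\<Sum>j<N. R j)"
    by (simp only: sum_split[of L] sum_split[of R] far pair)
  then show "(\<Sum>j<N. vcur (Tv c s j) m (S (vcur Sh M u)))
    = S (vcur Sh M (\<Sum>j<N. vcur (Tv c s j) m u))"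
    by (simp add: L_def R_def lin_sum[OF lin_vop_current[OF vop_M_Sh]] lin_sum[OF S_lin])
qed

lemma gen_alg_commute:
  assumes "A \<in> gen_alg scale G" "lin Q" "\<And>B. B \<in> G \<Longrightarrow> B \<circ> Q = Q \<circ> B"
  shows "A \<circ> Q = Q \<circ> A"
  using assms(1)
proof induction
  case (gen A)
  then show ?case by (rule assms(3))
qed (auto simp: fun_eq_iff lin_scale[OF assms(2)] lin_add[OF assms(2)])

abbreviation currents :: "('v \<Rightarrow> 'v) set"
  where "currents \<equiv> range (path_Sigma scale Zs (path_plus N)) \<union> range (path_Psi scale Zs (path_plus N)) \<union>
      range (path_Sigma scale Zs (path_minus N q3)) \<union> range (path_Psi scale Zs (path_minus N q3))"

lemma currents_commute_screening:
  assumes "A \<in> gen_alg scale currents"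
  shows "A \<circ> Qk = Qk \<circ> A"
  using assms
proof (rule gen_alg_commute[OF _ lin_screening_charge])
  note plus = meets_plus[OF k] and minus = meets_minus[OF k]
  fix B assume "B \<in> currents"
  then show "B \<circ> Qk = Qk \<circ> B"
    unfolding path_Sigma_plus path_Sigma_minus path_Psi_plus path_Psi_minus
    using Sigma_commutes_screening[OF plus] Psi_commutes_screening[OF plus]
      Sigma_commutes_screening[OF minus] Psi_commutes_screening[OF minus] by blast
qed

end

theorem proposition3p1:
  fixes scale :: "complex \<Rightarrow> 'v \<Rightarrow> 'v::ab_group_add"
    and N :: nat and q1 q2 q3 l1 l2 l3 tau :: complex
    and lam :: "nat \<Rightarrow> int \<Rightarrow> 'v \<Rightarrow> 'v" and beta :: "int \<Rightarrow> 'v \<Rightarrow> 'v"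
  assumes N: "N \<ge> 2"
    and logs: "q1 = exp l1" "q2 = exp l2" "q3 = exp l3"
    and q123: "q1 * q2 * q3 = 1"
    and generic: "\<And>a b :: int. q1 powi a * q2 powi b = 1 \<Longrightarrow> a = 0 \<and> b = 0"
    and tau: "tau ^ 2 = - (l1 * l2)"
    and free_fields: "free_field_module scale N q1 q2 q3 lam beta"
  shows "\<exists>X x. let
        Q = akos_quiver N q1 q3;
        Z = (\<lambda>j. (X j, x j));
        P_plus = path_plus N;
        P_minus = path_minus N q3;
        U1 = Upsilon_first scale N l3 beta;
        UN1 = vop_arg scale (qpow l3 (of_nat N / 2)) (Upsilon_last scale N l3 beta);
        W1 = Wbar_first scale N l3 tau lam beta;
        WN1 = cur_arg scale (qpow l3 (of_nat N / 2)) (Wbar_last scale N l3 tau lam beta)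
      in
      free_field_vops scale N tau lam beta (verts Q) X x \<and>
      quiver_relations scale Q (exp (l2 / 2)) X x \<and>
      W1 = path_Sigma scale Z P_plus \<and>
      vop_current scale (nord [U1, UN1]) = path_Psi scale Z P_plus \<and>
      WN1 = path_Sigma scale Z P_minus \<and>
      vop_current scale (nord [vop_arg scale (qpow l3 (of_nat N)) U1, UN1])
        = path_Psi scale Z P_minus \<and>
      (\<forall>k\<in>{1..N - 1}. \<forall>pos s0 S.
         let L = screening_logs (l2 / 2) l1 pos in
         screening_relations scale Q X x k L s0 S \<longrightarrow>
         (\<forall>A \<in> gen_alg scale
                 (range (path_Sigma scale Z P_plus) \<union> range (path_Psi scale Z P_plus) \<union>
                  range (path_Sigma scale Z P_minus) \<union> range (path_Psi scale Z P_minus)).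
            A \<circ> screening_charge scale x k L s0 S = screening_charge scale x k L s0 S \<circ> A))"
proof -
  interpret free_field_module scale N q1 q2 q3 lam beta by (rule free_fields)
  interpret akos scale N q1 q2 q3 lam beta l1 l2 l3 tau
    by unfold_locales (use N logs q123 generic in auto)
  have screening: "A \<circ> screening_charge scale xs k L s0 S = screening_charge scale xs k L s0 S \<circ> A"
    if k: "k \<in> {1..N - 1}" and L: "L = screening_logs (l2 / 2) l1 pos"
      and rel: "screening_relations scale (akos_quiver N q1 q3) Xs xs k L s0 S"
      and A: "A \<in> gen_alg scale (range (path_Sigma scale Zs (path_plus N)) \<union> range (path_Psi scale Zs (path_plus N)) \<union>
        range (path_Sigma scale Zs (path_minus N q3)) \<union> range (path_Psi scale Zs (path_minus N q3)))"
    for k pos s0 S A L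
  proof -
    obtain ls ls' where L': "L = (ls, ls')" by (cases L)
    interpret akos_screening scale N q1 q2 q3 lam beta l1 l2 l3 tau k ls ls' s0 S
    proof
      show "0 < k" "k < N" using k N by auto
      show "exp (2 * ls) = q1 \<and> exp (2 * ls') = q2 \<or> exp (2 * ls) = q2 \<and> exp (2 * ls') = q1"
      proof -
        have "ls = (if pos then l2 / 2 else l1 / 2)" "ls' = (if pos then l1 / 2 else l2 / 2)"
          using L L' by (auto simp: screening_logs_def)
        then show ?thesis using logs by simp
      qed
      show "screening_relations scale (akos_quiver N q1 q3) Xs xs k (ls, ls') s0 S" using rel L' by simp
    qed
    show ?thesis unfolding L' by (rule currents_commute_screening[OF A])
  qed
  show ?thesis
    unfolding Let_def
    using free_field_vops_akos quiver_relations_akos Wbar_first_eq Wbar_last_eq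
      Psi_plus_eq[unfolded U1_def UN1_def] Psi_minus_eq[unfolded U1_def UN1_def] screening
    by (intro exI[of _ Xs] exI[of _ xs]) (auto simp: akos_quiver_def)
qed

end
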